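(* There is a deterministic algorithm that, given a quiver $Q=(Q_0,Q_1)$ (possibly with directed cycles) and a representation $V$ of $Q$ with dimension vector $\alpha$, checks whether $V$ is semistable in $O\big(\alpha(Q_0)^{20}+\alpha(Q_0)^{2\omega-2}|Q_1|\big)$ time, where $\alpha(Q_0)=\sum_{i\in Q_0}\alpha(i)$ and $\omega$ denotes the exponent of the complexity of matrix multiplication.
   Context: A quiver is a finite directed multigraph, loops and parallel arcs allowed; $ta$, $ha$ are the tail and head of $a\in Q_1$. A representation $V$ of $Q$ with dimension vector $\alpha$ consists of spaces $V(i)=\mathbb{C}^{\alpha(i)}$ ($i\in Q_0$) and $\alpha(ha)\times\alpha(ta)$ complex matrices $V(a)$ ($a\in Q_1$). $V$ is semistable (under the action of $\mathrm{GL}(Q,\alpha)=\prod_{i\in Q_0}\mathrm{GL}(\alpha(i))$ by $g\cdot V=(g_{ha}V(a)g_{ta}^{-1})_{a\in Q_1}$) if $$\inf_{g\in\mathrm{GL}(Q,\alpha)}\sum_{a\in Q_1}\|g_{ha}V(a)g_{ta}^{-1}\|_{\mathrm F}^2>0 ,$$ i.e. the orbit closure of $V$ does not contain the origin. Time is counted in arithmetic operations on the entries; $\omega$ is such that two $n\times n$ matrices can be multiplied in $O(n^\omega)$ operations. *)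

theory Defs
  imports
    Complex_Main
    "Jordan_Normal_Form.Matrix"
    "Graph_Theory.Digraph"
begin

section \<open>Semistable representations of quivers\<close>

text \<open>
  A quiver is a \<^locale>\<open>fin_digraph\<close>, which permits loops, parallel arcs and directed cycles.
  Vertices and arcs are named by natural numbers, because the quiver has to be written down as
  the input of an algorithm.
\<close>

type_synonym quiver = "(nat, nat) pre_digraph"

definition is_representation :: "quiver \<Rightarrow> (nat \<Rightarrow> nat) \<Rightarrow> (nat \<Rightarrow> complex mat) \<Rightarrow> bool" where
  "is_representation Q \<alpha> V \<longleftrightarrow>
     (\<forall>a \<in> arcs Q. V a \<in> carrier_mat (\<alpha> (head Q a)) (\<alpha> (tail Q a)))"

definition total_dim :: "quiver \<Rightarrow> (nat \<Rightarrow> nat) \<Rightarrow> nat" where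
  "total_dim Q \<alpha> = (\<Sum>i \<in> verts Q. \<alpha> i)"

abbreviation matrix_ring :: "nat \<Rightarrow> complex mat ring" where
  "matrix_ring n \<equiv> ring_mat TYPE(complex) n ()"

definition GL :: "quiver \<Rightarrow> (nat \<Rightarrow> nat) \<Rightarrow> (nat \<Rightarrow> complex mat) set" where
  "GL Q \<alpha> = (\<Pi>\<^sub>E i \<in> verts Q. Units (matrix_ring (\<alpha> i)))"

definition act :: "quiver \<Rightarrow> (nat \<Rightarrow> nat) \<Rightarrow> (nat \<Rightarrow> complex mat) \<Rightarrow> (nat \<Rightarrow> complex mat)
    \<Rightarrow> nat \<Rightarrow> complex mat" where
  "act Q \<alpha> g V a =
     g (head Q a) * V a * (inv\<^bsub>matrix_ring (\<alpha> (tail Q a))\<^esub> (g (tail Q a)))"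

definition frobenius_norm :: "complex mat \<Rightarrow> real" where
  "frobenius_norm A = sqrt (\<Sum>i<dim_row A. \<Sum>j<dim_col A. (cmod (A $$ (i, j)))\<^sup>2)"

definition semistable :: "quiver \<Rightarrow> (nat \<Rightarrow> nat) \<Rightarrow> (nat \<Rightarrow> complex mat) \<Rightarrow> bool" where
  "semistable Q \<alpha> V \<longleftrightarrow>
     (INF g \<in> GL Q \<alpha>. \<Sum>a \<in> arcs Q. (frobenius_norm (act Q \<alpha> g V a))\<^sup>2) > 0"


section \<open>Algorithms and their arithmetic cost\<close>

text \<open>
  The machine model is a WHILE language in the style of N. D. Jones. Its data are binary trees,
  and the leaves may hold exact complex numbers. A program maps the current tree to a new tree.
  Complex numbers are accessible only through the field operations, the constants \<open>0\<close> and \<open>1\<close>,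
  and a zero test. The cost of a run counts the executed field operations and zero tests;
  data movement and control flow, which do not touch the entries, are free.
\<close>

datatype tree = Tip | Num complex | Node tree tree

datatype prog =
    Skip
  | Make_Tip
  | Make_Zero
  | Make_One
  | Left
  | Right
  | Fork prog prog
  | Seq prog prog
  | If_Node prog prog prog
  | While_Node prog prog
  | Add
  | Sub
  | Mul
  | Div
  | Is_Zero

fun enc_bool :: "bool \<Rightarrow> tree" where
  "enc_bool False = Tip"
| "enc_bool True = Node Tip Tip"

text \<open>
  \<open>run P s t s'\<close>: started on \<open>s\<close>, the program \<open>P\<close> halts with result \<open>s'\<close> and cost \<open>t\<close>.
  Ill-typed operations and divisions by zero have no rule, so they block the run.
\<close>

inductive run :: "prog \<Rightarrow> tree \<Rightarrow> nat \<Rightarrow> tree \<Rightarrow> bool" where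
  skip: "run Skip s 0 s"
| tip: "run Make_Tip s 0 Tip"
| zero: "run Make_Zero s 0 (Num 0)"
| one: "run Make_One s 0 (Num 1)"
| left: "run Left (Node x y) 0 x"
| right: "run Right (Node x y) 0 y"
| fork: "run p s t x \<Longrightarrow> run q s u y \<Longrightarrow> run (Fork p q) s (t + u) (Node x y)"
| seq: "run p s t s' \<Longrightarrow> run q s' u s'' \<Longrightarrow> run (Seq p q) s (t + u) s''"
| if_true: "run c s t (Node x y) \<Longrightarrow> run p s u s' \<Longrightarrow> run (If_Node c p q) s (t + u) s'"
| if_false: "run c s t Tip \<Longrightarrow> run q s u s' \<Longrightarrow> run (If_Node c p q) s (t + u) s'"
| while_true: "run c s t (Node x y) \<Longrightarrow> run p s u s' \<Longrightarrow> run (While_Node c p) s' v s'' \<Longrightarrow>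
    run (While_Node c p) s (t + u + v) s''"
| while_false: "run c s t Tip \<Longrightarrow> run (While_Node c p) s t s"
| add: "run Add (Node (Num x) (Num y)) 1 (Num (x + y))"
| sub: "run Sub (Node (Num x) (Num y)) 1 (Num (x - y))"
| mul: "run Mul (Node (Num x) (Num y)) 1 (Num (x * y))"
| div: "y \<noteq> 0 \<Longrightarrow> run Div (Node (Num x) (Num y)) 1 (Num (x / y))"
| is_zero: "run Is_Zero (Num x) 1 (enc_bool (x = 0))"

inductive_cases run_SkipE: "run Skip s t r"
inductive_cases run_Make_TipE: "run Make_Tip s t r"
inductive_cases run_Make_ZeroE: "run Make_Zero s t r"
inductive_cases run_Make_OneE: "run Make_One s t r"
inductive_cases run_LeftE: "run Left s t r"
inductive_cases run_RightE: "run Right s t r"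
inductive_cases run_ForkE: "run (Fork p q) s t r"
inductive_cases run_SeqE: "run (Seq p q) s t r"
inductive_cases run_If_NodeE: "run (If_Node c p q) s t r"
inductive_cases run_While_NodeE: "run (While_Node c p) s t r"
inductive_cases run_AddE: "run Add s t r"
inductive_cases run_SubE: "run Sub s t r"
inductive_cases run_MulE: "run Mul s t r"
inductive_cases run_DivE: "run Div s t r"
inductive_cases run_Is_ZeroE: "run Is_Zero s t r"

lemma run_deterministic:
  assumes "run P s t r" and "run P s t' r'"
  shows "t' = t \<and> r' = r"
  using assms
proof (induction arbitrary: t' r' rule: run.induct)
  case (fork p s t x q u y)
  from fork.prems show ?case
    by (rule run_ForkE) (auto dest: fork.IH)
next
  case (seq p s t s' q u s'')
  from seq.prems show ?case
    by (rule run_SeqE) (use seq.IH in metis)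
next
  case (if_true c s t x y p u s' q)
  from if_true.prems show ?case
    by (rule run_If_NodeE) (use if_true.IH in \<open>metis tree.distinct(3)\<close>)+
next
  case (if_false c s t q u s' p)
  from if_false.prems show ?case
    by (rule run_If_NodeE) (use if_false.IH in \<open>metis tree.distinct(3)\<close>)+
next
  case (while_true c s t x y p u s' v s'')
  from while_true.prems show ?case
    by (rule run_While_NodeE) (use while_true.IH in \<open>metis tree.distinct(3)\<close>)+
next
  case (while_false c s t p)
  from while_false.prems show ?case
    by (rule run_While_NodeE) (use while_false.IH in \<open>metis tree.distinct(3)\<close>)+
qed (auto elim: run_SkipE run_Make_TipE run_Make_ZeroE run_Make_OneE run_LeftE run_RightE
    run_AddE run_SubE run_MulE run_DivE run_Is_ZeroE)


section \<open>Encoding of the inputs\<close>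

fun enc_list :: "tree list \<Rightarrow> tree" where
  "enc_list [] = Tip"
| "enc_list (x # xs) = Node x (enc_list xs)"

text \<open>Natural numbers are written in unary; as control flow is free, this affects no cost.\<close>

definition enc_nat :: "nat \<Rightarrow> tree" where
  "enc_nat n = enc_list (replicate n Tip)"

definition enc_mat :: "complex mat \<Rightarrow> tree" where
  "enc_mat A = enc_list (map (\<lambda>row. enc_list (map Num row)) (mat_to_list A))"

definition enc_representation :: "quiver \<Rightarrow> (nat \<Rightarrow> nat) \<Rightarrow> (nat \<Rightarrow> complex mat) \<Rightarrow> tree" where
  "enc_representation Q \<alpha> V =
     Node
       (enc_list (map (\<lambda>i. Node (enc_nat i) (enc_nat (\<alpha> i))) (sorted_list_of_set (verts Q))))
       (enc_list (map (\<lambda>a. Node (enc_nat (tail Q a)) (Node (enc_nat (head Q a)) (enc_mat (V a))))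
         (sorted_list_of_set (arcs Q))))"


section \<open>The exponent of matrix multiplication\<close>

text \<open>Two \<open>n \<times> n\<close> matrices can be multiplied in \<open>O(n\<^sup>\<omega>)\<close> operations.\<close>

definition matmul_exponent :: "real \<Rightarrow> bool" where
  "matmul_exponent \<omega> \<longleftrightarrow>
     (\<exists>P C. \<forall>n \<ge> 1. \<forall>A \<in> carrier_mat n n. \<forall>B \<in> carrier_mat n n.
        \<exists>t. run P (Node (enc_nat n) (Node (enc_mat A) (enc_mat B))) t (enc_mat (A * B)) \<and>
            real t \<le> C * real n powr \<omega>)"

end

theory Submission
  imports
    Defs
    "Jordan_Normal_Form.Schur_Decomposition"
begin

text \<open>
  Put \<open>n = \<alpha>(Q\<^sub>0)\<close> and pad every \<open>V(a)\<close> to an \<open>n \<times> n\<close> matrix. The representation is not semistable iff all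
  words of length \<open>n\<close> in these matrices vanish. If they vanish, a weighted sum over all paths defines
  Hermitian forms at the vertices, whose Cholesky factors are elements of \<open>GL(Q, \<alpha>)\<close> that make all
  \<open>V(a)\<close> arbitrarily small. If they do not vanish, some word has a nonzero trace, because an algebra of
  nilpotent matrices is nilpotent; the trace is invariant under \<open>GL(Q, \<alpha>)\<close> and bounds the norm from below.

  The algorithm first selects at most \<open>n\<^sup>2\<close> arcs whose matrices span all padded matrices. It keeps a list
  \<open>K\<close> of \<open>n\<^sup>2\<close> vectors whose common annihilator is the span of the arcs selected so far. The arcs are
  read in batches of \<open>n\<^sup>2\<close>, and a batch is skipped if its product with \<open>K\<close>, a multiplication of matrices
  of size \<open>n\<^sup>2\<close>, is zero. This costs \<open>O(n\<^bsup>2\<omega>-2\<^esup>)\<close> per arc, and the elementary elimination that treats any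
  other batch is needed at most \<open>n\<^sup>2\<close> times. With so few arcs left, the images of all words of length
  \<open>1, \<dots>, n\<close> are computed in polynomial time. The zero tests need \<open>\<omega> \<ge> 2\<close>, which holds as every number
  in the output of a program is an input, \<open>0\<close>, \<open>1\<close> or the result of an operation.
\<close>

text \<open>Put d = n^2. Testing one flattened matrix against the d vectors of \<open>K\<close>
  separately takes about d^2 = n^4 operations, more than the n^(2\<omega>-2) allowed per arc once
  \<omega> < 3. A square product of size d tests d arcs together, and d^\<omega> / d =
  n^(2\<omega>-2): this is the origin of the exponent. Being square, the product wants exactly d
  arcs and exactly d vectors. Hence used-up vectors become zero instead of leaving \<open>K\<close>,
  and the fewer than d arcs behind the last full batch are inserted one by one, at a price that does
  not depend on the number of arcs. A spanning subset of the arcs suffices because a word is linear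
  in each of its letters. There may still be exponentially many words of length n, so for each
  length only at most n images spanning all the others are kept. They are selected and never
  combined, so each of them is the image of a unit vector under an actual word, and being nonzero it
  witnesses a word that does not vanish.\<close>

section \<open>A functional layer over the WHILE language\<close>

text \<open>\<open>T\<close> is an upper bound and not the exact cost, so the two branches of a
  conditional can share one bound and data-dependent costs need only be majorised.\<close>

definition ev :: "prog \<Rightarrow> tree \<Rightarrow> nat \<Rightarrow> tree \<Rightarrow> bool" where
  "ev P s T r \<longleftrightarrow> (\<exists>t\<le>T. run P s t r)"

lemma ev_run: "run P s t r \<Longrightarrow> ev P s t r"
  unfolding ev_def by blast

lemma ev_mono: "ev P s T r \<Longrightarrow> T \<le> T' \<Longrightarrow> ev P s T' r"
  unfolding ev_def by (meson le_trans)

lemma ev_eq: "ev P s T r \<Longrightarrow> T \<le> T' \<Longrightarrow> r = r' \<Longrightarrow> ev P s T' r'"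
  using ev_mono by blast

lemma ev_Skip: "ev Skip s 0 s"
  and ev_Tip: "ev Make_Tip s 0 Tip"
  and ev_Zero: "ev Make_Zero s 0 (Num 0)"
  and ev_One: "ev Make_One s 0 (Num 1)"
  and ev_Left: "ev Left (Node x y) 0 x"
  and ev_Right: "ev Right (Node x y) 0 y"
  by (rule ev_run, rule run.intros)+

lemma ev_Fork: "ev p s T x \<Longrightarrow> ev q s U y \<Longrightarrow> ev (Fork p q) s (T + U) (Node x y)"
  unfolding ev_def by (meson add_mono run.fork)

lemma ev_Seq: "ev p s T s' \<Longrightarrow> ev q s' U r \<Longrightarrow> ev (Seq p q) s (T + U) r"
  unfolding ev_def by (meson add_mono run.seq)

lemma ev_If_true: "ev c s T (Node x y) \<Longrightarrow> ev p s U r \<Longrightarrow> ev (If_Node c p q) s (T + U) r"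
  unfolding ev_def by (meson add_mono run.if_true)

lemma ev_If_false: "ev c s T Tip \<Longrightarrow> ev q s U r \<Longrightarrow> ev (If_Node c p q) s (T + U) r"
  unfolding ev_def by (meson add_mono run.if_false)

lemma ev_If_bool:
  assumes "ev c s T (enc_bool b)"
    and "b \<Longrightarrow> ev p s U r"
    and "\<not> b \<Longrightarrow> ev q s U r'"
  shows "ev (If_Node c p q) s (T + U) (if b then r else r')"
  using assms by (cases b) (auto intro: ev_If_true ev_If_false)

text \<open>An encoded list doubles as a condition, since it is a \<open>Node\<close> exactly if it
  is not empty.\<close>

lemma ev_If_list:
  assumes "ev c s T (enc_list xs)"
    and "xs \<noteq> [] \<Longrightarrow> ev p s U r"
    and "xs = [] \<Longrightarrow> ev q s U r'"
  shows "ev (If_Node c p q) s (T + U) (if xs = [] then r' else r)"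
  using assms by (cases xs) (auto intro: ev_If_true ev_If_false)

lemma ev_Add: "ev p s T (Num x) \<Longrightarrow> ev q s U (Num y) \<Longrightarrow> ev (Seq (Fork p q) Add) s (T + U + 1) (Num (x + y))"
  and ev_Sub: "ev p s T (Num x) \<Longrightarrow> ev q s U (Num y) \<Longrightarrow> ev (Seq (Fork p q) Sub) s (T + U + 1) (Num (x - y))"
  and ev_Mul: "ev p s T (Num x) \<Longrightarrow> ev q s U (Num y) \<Longrightarrow> ev (Seq (Fork p q) Mul) s (T + U + 1) (Num (x * y))"
  by (rule ev_Seq[OF ev_Fork ev_run]; (assumption | rule run.intros))+

lemma ev_Div:
  "ev p s T (Num x) \<Longrightarrow> ev q s U (Num y) \<Longrightarrow> y \<noteq> 0 \<Longrightarrow>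
    ev (Seq (Fork p q) Div) s (T + U + 1) (Num (x / y))"
  by (rule ev_Seq[OF ev_Fork ev_run]; (assumption | rule run.intros))

lemma ev_Is_Zero: "ev p s T (Num x) \<Longrightarrow> ev (Seq p Is_Zero) s (T + 1) (enc_bool (x = 0))"
  by (rule ev_Seq[OF _ ev_run]; (assumption | rule run.intros))

text \<open>
  Programs are read as expressions whose state \<open>Node x\<^sub>0 (Node x\<^sub>1 \<dots>)\<close> is an environment;
  \<open>arg k\<close> looks up the de Bruijn index \<open>k\<close>.
\<close>

fun arg :: "nat \<Rightarrow> prog" where
  "arg 0 = Left"
| "arg (Suc k) = Seq Right (arg k)"

fun lookup :: "nat \<Rightarrow> tree \<Rightarrow> tree" where
  "lookup 0 (Node x s) = x"
| "lookup (Suc k) (Node x s) = lookup k s"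
| "lookup _ _ = Tip"

fun depth :: "tree \<Rightarrow> nat" where
  "depth (Node x s) = Suc (depth s)"
| "depth _ = 0"

lemma ev_arg: "k < depth s \<Longrightarrow> ev (arg k) s 0 (lookup k s)"
proof (induction k s rule: lookup.induct)
  case (2 k x s)
  then show ?case
    using ev_Seq[OF ev_Right, of "arg k" s 0 _ x] by simp
qed (auto intro: ev_Left)

lemma ev_arg': "k < depth s \<Longrightarrow> lookup k s = r \<Longrightarrow> ev (arg k) s 0 r"
  using ev_arg by blast

text \<open>The bound value is pushed onto the environment, so inside the body every earlier index
  is one higher.\<close>

definition Let_in :: "prog \<Rightarrow> prog \<Rightarrow> prog" where
  "Let_in e b = Seq (Fork e Skip) b"

lemma ev_Let: "ev e s T x \<Longrightarrow> ev b (Node x s) U r \<Longrightarrow> ev (Let_in e b) s (T + U) r"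
  unfolding Let_in_def using ev_Seq[OF ev_Fork[OF _ ev_Skip]] by fastforce

definition fst_of :: "prog \<Rightarrow> prog" where "fst_of e = Seq e Left"
definition snd_of :: "prog \<Rightarrow> prog" where "snd_of e = Seq e Right"

lemma ev_fst: "ev e s T (Node x y) \<Longrightarrow> ev (fst_of e) s T x"
  and ev_snd: "ev e s T (Node x y) \<Longrightarrow> ev (snd_of e) s T y"
  unfolding fst_of_def snd_of_def using ev_Seq[OF _ ev_Left] ev_Seq[OF _ ev_Right] by fastforce+

text \<open>The loop state is \<open>Node (Node rest acc) env\<close>. The body sees the current
  element as index 0, the accumulator as index 1 and the outer environment from index 2 on.\<close>

definition Fold_Step :: "prog \<Rightarrow> prog" where
  "Fold_Step b = Fork (Fork (Seq (Seq Left Left) Right)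
     (Seq (Fork (Seq (Seq Left Left) Left) (Fork (Seq Left Right) Right)) b)) Right"

definition Fold :: "prog \<Rightarrow> prog \<Rightarrow> prog \<Rightarrow> prog" where
  "Fold l a b = Seq (Seq (Fork (Fork l a) Skip)
     (While_Node (Seq Left Left) (Fold_Step b)))
     (Seq Left Right)"

text \<open>The cost of a round may depend on the accumulator, which is what makes an amortised
  analysis of the batches possible.\<close>

primrec fold_cost :: "('a \<Rightarrow> 'b \<Rightarrow> nat) \<Rightarrow> ('a \<Rightarrow> 'b \<Rightarrow> 'b) \<Rightarrow> 'a list \<Rightarrow> 'b \<Rightarrow> nat" where
  "fold_cost c f [] acc = 0"
| "fold_cost c f (x # xs) acc = c x acc + fold_cost c f xs (f x acc)"

text \<open>The invariant \<open>I\<close> records the lengths inside the accumulator, on which the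
  cost bounds of the bodies depend.\<close>

lemma ev_fold_loop:
  assumes step: "\<And>x acc. x \<in> set xs \<Longrightarrow> I acc \<Longrightarrow>
      ev b (Node (e x) (Node (E acc) s)) (c x acc) (E (f x acc)) \<and> I (f x acc)"
    and "I acc"
  shows "ev (While_Node (Seq Left Left) (Fold_Step b))
     (Node (Node (enc_list (map e xs)) (E acc)) s) (fold_cost c f xs acc)
     (Node (Node Tip (E (fold f xs acc))) s)"
  using assms
proof (induction xs arbitrary: acc)
  case Nil
  have "run (Seq Left Left) (Node (Node Tip (E acc)) s) (0 + 0) Tip"
    by (rule run.intros)+
  then show ?case
    by (auto intro!: ev_run dest: run.while_false)
next
  case (Cons x xs)
  let ?s = "Node (Node (enc_list (map e (x # xs))) (E acc)) s"
  have b: "ev b (Node (e x) (Node (E acc) s)) (c x acc) (E (f x acc))" "I (f x acc)"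
    using Cons.prems by auto
  have "ev (Fold_Step b) ?s
        (0 + 0 + 0 + (0 + 0 + 0 + (0 + 0 + 0) + c x acc) + 0)
        (Node (Node (enc_list (map e xs)) (E (f x acc))) s)"
    by (simp only: Fold_Step_def list.map enc_list.simps) (rule ev_Fork ev_Seq ev_Left ev_Right b)+
  then obtain u where u: "u \<le> c x acc" "run (Fold_Step b) ?s u
        (Node (Node (enc_list (map e xs)) (E (f x acc))) s)"
    unfolding ev_def by auto
  obtain v where v: "v \<le> fold_cost c f xs (f x acc)" "run (While_Node (Seq Left Left) (Fold_Step b))
     (Node (Node (enc_list (map e xs)) (E (f x acc))) s) v
     (Node (Node Tip (E (fold f xs (f x acc)))) s)"
    using Cons.IH[OF Cons.prems(1) b(2)] unfolding ev_def by auto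
  have "run (Seq Left Left) ?s (0 + 0) (Node (e x) (enc_list (map e xs)))"
    by (simp only: list.map enc_list.simps) (rule run.intros)+
  from run.while_true[OF this u(2) v(2)] show ?case
    unfolding ev_def using u(1) v(1) by (intro exI[of _ "0 + 0 + u + v"]) simp
qed

lemma ev_Fold_cost:
  assumes "ev l s T (enc_list (map e xs))" and "ev a s U (E acc)"
    and "\<And>x acc. x \<in> set xs \<Longrightarrow> I acc \<Longrightarrow>
      ev b (Node (e x) (Node (E acc) s)) (c x acc) (E (f x acc)) \<and> I (f x acc)"
    and "I acc"
  shows "ev (Fold l a b) s (T + U + fold_cost c f xs acc) (E (fold f xs acc))"
proof -
  have "ev (Fold l a b) s ((T + U + 0) + fold_cost c f xs acc + (0 + 0)) (E (fold f xs acc))"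
    unfolding Fold_def
    by (rule ev_Seq ev_Fork ev_Left ev_Right ev_Skip assms(1,2) ev_fold_loop[where I = I] assms(3,4)
        | assumption)+
  then show ?thesis by simp
qed

lemma fold_cost_const: "fold_cost (\<lambda>_ _. c) f xs acc = length xs * c"
  by (induction xs arbitrary: acc) auto

lemma ev_Fold:
  assumes "ev l s T (enc_list (map e xs))" and "ev a s U (E acc)"
    and "\<And>x acc. x \<in> set xs \<Longrightarrow> I acc \<Longrightarrow>
      ev b (Node (e x) (Node (E acc) s)) c (E (f x acc)) \<and> I (f x acc)"
    and "I acc"
  shows "ev (Fold l a b) s (T + U + length xs * c) (E (fold f xs acc))"
  using ev_Fold_cost[where e = e and E = E, OF assms(1,2), of I b "\<lambda>_ _. c" f] assms(3,4) fold_cost_const by metis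

lemma ev_Fold_free:
  assumes "ev l s T (enc_list (map e xs))" and "ev a s U (E acc)"
    and "\<And>x acc. x \<in> set xs \<Longrightarrow> ev b (Node (e x) (Node (E acc) s)) 0 (E (f x acc))"
  shows "ev (Fold l a b) s (T + U) (E (fold f xs acc))"
  using ev_Fold[where e = e and E = E, OF assms(1,2), of "\<lambda>_. True" b 0 f] assms(3) by simp

section \<open>List operations derived from the fold\<close>

definition Rev :: "prog \<Rightarrow> prog" where
  "Rev p = Fold p Make_Tip (Fork (arg 0) (arg 1))"

lemma ev_Rev:
  assumes "ev p s T (enc_list xs)"
  shows "ev (Rev p) s T (enc_list (rev xs))"
proof -
  have "ev (Rev p) s (T + 0) (enc_list (fold Cons xs []))"
    unfolding Rev_def
  proof (rule ev_Fold_free[where e = "\<lambda>x. x"])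
    fix x :: tree and acc
    have "ev (Fork (arg 0) (arg 1)) (Node x (Node (enc_list acc) s)) (0 + 0) (Node x (enc_list acc))"
      by (rule ev_Fork ev_arg' | simp)+
    then show "ev (Fork (arg 0) (arg 1)) (Node x (Node (enc_list acc) s)) 0 (enc_list (x # acc))"
      by simp
  qed (use assms ev_Tip in simp_all)
  then show ?thesis by (simp add: fold_Cons_rev)
qed

definition Append :: "prog \<Rightarrow> prog \<Rightarrow> prog" where
  "Append p q = Fold (Rev p) q (Fork (arg 0) (arg 1))"

lemma ev_Append:
  assumes "ev p s T (enc_list xs)" and "ev q s U (enc_list ys)"
  shows "ev (Append p q) s (T + U) (enc_list (xs @ ys))"
proof -
  have "ev (Append p q) s (T + U) (enc_list (fold Cons (rev xs) ys))"
    unfolding Append_def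
  proof (rule ev_Fold_free[where e = "\<lambda>x. x"])
    fix x :: tree and acc
    have "ev (Fork (arg 0) (arg 1)) (Node x (Node (enc_list acc) s)) (0 + 0) (Node x (enc_list acc))"
      by (rule ev_Fork ev_arg' | simp)+
    then show "ev (Fork (arg 0) (arg 1)) (Node x (Node (enc_list acc) s)) 0 (enc_list (x # acc))"
      by simp
  qed (use assms ev_Rev in simp_all)
  then show ?thesis by (simp add: fold_Cons_rev)
qed

text \<open>The accumulator is removed before \<open>b\<close> runs: unlike in \<open>Fold\<close>,
  the outer environment starts at index 1. With bodies that return at most one element this is also
  a filter.\<close>

definition Concat_Map :: "prog \<Rightarrow> prog \<Rightarrow> prog" where
  "Concat_Map l b = Fold l Make_Tip (Append (arg 1) (Seq (Fork Left (Seq Right Right)) b))"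

lemma ev_Concat_Map:
  assumes "ev l s T (enc_list (map e xs))"
    and "\<And>x. x \<in> set xs \<Longrightarrow> ev b (Node (e x) s) c (enc_list (g x))"
  shows "ev (Concat_Map l b) s (T + length xs * c) (enc_list (concat (map g xs)))"
proof -
  have "ev (Concat_Map l b) s (T + 0 + length xs * c) (enc_list (fold (\<lambda>x acc. acc @ g x) xs []))"
    unfolding Concat_Map_def
  proof (rule ev_Fold[where e = e and I = "\<lambda>_. True"])
    fix x acc assume x: "x \<in> set xs"
    have "ev (Append (arg 1) (Seq (Fork Left (Seq Right Right)) b)) (Node (e x) (Node (enc_list acc) s))
        (0 + (0 + (0 + 0) + c)) (enc_list (acc @ g x))"
      by (rule ev_Append ev_arg' ev_Seq ev_Fork ev_Left ev_Right assms x | simp)+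
    then show "ev (Append (arg 1) (Seq (Fork Left (Seq Right Right)) b)) (Node (e x) (Node (enc_list acc) s))
        c (enc_list (acc @ g x)) \<and> True" by simp
  qed (use assms ev_Tip in simp_all)
  moreover have "fold (\<lambda>x acc. acc @ g x) xs ys = ys @ concat (map g xs)" for ys
    by (induction xs arbitrary: ys) auto
  ultimately show ?thesis by simp
qed

definition Map :: "prog \<Rightarrow> prog \<Rightarrow> prog" where
  "Map l b = Concat_Map l (Fork b Make_Tip)"

lemma ev_Map:
  assumes "ev l s T (enc_list (map e xs))"
    and "\<And>x. x \<in> set xs \<Longrightarrow> ev b (Node (e x) s) c (g x)"
  shows "ev (Map l b) s (T + length xs * c) (enc_list (map g xs))"
proof -
  have "ev (Fork b Make_Tip) (Node (e x) s) c (enc_list [g x])" if "x \<in> set xs" for x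
    using ev_Fork[OF assms(2)[OF that] ev_Tip] by simp
  from ev_Concat_Map[OF assms(1) this] show ?thesis
    unfolding Map_def by simp
qed

lemma ev_Map_free:
  assumes "ev l s T (enc_list (map e xs))"
    and "\<And>x. x \<in> set xs \<Longrightarrow> ev b (Node (e x) s) 0 (g x)"
  shows "ev (Map l b) s T (enc_list (map g xs))"
  using ev_Map[OF assms] by simp

lemma ev_Concat_Map_free:
  assumes "ev l s T (enc_list (map e xs))"
    and "\<And>x. x \<in> set xs \<Longrightarrow> ev b (Node (e x) s) 0 (enc_list (g x))"
  shows "ev (Concat_Map l b) s T (enc_list (concat (map g xs)))"
  using ev_Concat_Map[OF assms] by simp

text \<open>A fold consumes only one list, so the second list is taken apart inside the accumulator;
  \<open>out\<close> grows in reverse.\<close>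

fun zip_step :: "tree \<Rightarrow> tree list \<times> tree list \<Rightarrow> tree list \<times> tree list" where
  "zip_step x ([], out) = ([], out)"
| "zip_step x (y # ys, out) = (ys, Node x y # out)"

definition Zip :: "prog \<Rightarrow> prog \<Rightarrow> prog" where
  "Zip p q = Rev (snd_of (Fold p (Fork q Make_Tip)
     (If_Node (fst_of (arg 1))
       (Fork (snd_of (fst_of (arg 1))) (Fork (Fork (arg 0) (fst_of (fst_of (arg 1)))) (snd_of (arg 1))))
       (arg 1))))"

lemma fold_zip_step: "snd (fold zip_step xs (ys, out)) = rev (map2 Node xs ys) @ out"
proof (induction xs arbitrary: ys out)
  case (Cons x xs)
  then show ?case
  proof (cases ys)
    case Nil
    have "fold zip_step zs ([], out) = ([], out)" for zs by (induction zs) auto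
    with Nil show ?thesis by simp
  qed auto
qed auto

lemma ev_Zip:
  assumes "ev p s T (enc_list xs)" and "ev q s U (enc_list ys)"
  shows "ev (Zip p q) s (T + U) (enc_list (map2 Node xs ys))"
proof -
  define E where "E = (\<lambda>(ys, out). Node (enc_list ys) (enc_list out))"
  let ?b = "If_Node (fst_of (arg 1))
       (Fork (snd_of (fst_of (arg 1))) (Fork (Fork (arg 0) (fst_of (fst_of (arg 1)))) (snd_of (arg 1))))
       (arg 1)"
  have "ev (Fold p (Fork q Make_Tip) ?b) s (T + (U + 0)) (E (fold zip_step xs (ys, [])))"
  proof (rule ev_Fold_free[where e = "\<lambda>x. x"])
    show "ev (Fork q Make_Tip) s (U + 0) (E (ys, []))"
      unfolding E_def using ev_Fork[OF assms(2) ev_Tip] by simp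
    fix x :: tree and acc :: "tree list \<times> tree list"
    obtain zs out where acc: "acc = (zs, out)" by force
    show "ev ?b (Node x (Node (E acc) s)) 0 (E (zip_step x acc))"
    proof (cases zs)
      case Nil
      have "ev ?b (Node x (Node (E acc) s)) (0 + 0) (E (zip_step x acc))"
        unfolding acc Nil E_def
        by (rule ev_If_false, rule ev_fst, rule ev_arg', simp, simp, rule ev_arg') simp_all
      then show ?thesis by simp
    next
      case (Cons z zs')
      have s: "ev (arg 1) (Node x (Node (E acc) s)) 0 (Node (Node z (enc_list zs')) (enc_list out))"
        unfolding acc Cons E_def by (rule ev_arg') simp_all
      have "ev ?b (Node x (Node (E acc) s)) (0 + (0 + (0 + 0 + 0))) (E (zip_step x acc))"
        unfolding acc Cons E_def zip_step.simps prod.case enc_list.simps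
        by (rule ev_If_true ev_Fork ev_fst ev_snd s[unfolded acc Cons E_def prod.case enc_list.simps]
            | (rule ev_arg', simp, simp; fail))+
      then show ?thesis by simp
    qed
  qed (use assms in simp_all)
  moreover have "E (fold zip_step xs (ys, [])) = Node (enc_list (fst (fold zip_step xs (ys, []))))
      (enc_list (rev (map2 Node xs ys)))"
    using fold_zip_step[of xs ys "[]"] unfolding E_def case_prod_beta by simp
  ultimately have "ev (snd_of (Fold p (Fork q Make_Tip) ?b)) s (T + U) (enc_list (rev (map2 Node xs ys)))"
    by (auto intro: ev_snd)
  from ev_Rev[OF this] show ?thesis unfolding Zip_def by simp
qed

text \<open>Unary digits are cancelled against each other. The accumulator is
  \<open>Node r Tip\<close> while \<open>r\<close> is left of the second number, and
  \<open>Tip\<close> once that number has run out.\<close>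

definition Eq_nat :: "prog \<Rightarrow> prog \<Rightarrow> prog" where
  "Eq_nat p q = Let_in
     (Fold p (Fork q Make_Tip)
       (If_Node (arg 1) (If_Node (fst_of (arg 1)) (Fork (snd_of (fst_of (arg 1))) Make_Tip) Make_Tip)
         Make_Tip))
     (If_Node (arg 0) (If_Node (fst_of (arg 0)) Make_Tip (Fork Make_Tip Make_Tip)) Make_Tip)"

fun strip :: "nat option \<Rightarrow> nat option" where
  "strip (Some (Suc n)) = Some n"
| "strip _ = None"

lemma fold_strip: "fold (\<lambda>_. strip) (replicate m x) (Some n) = (if m \<le> n then Some (n - m) else None)"
proof (induction m arbitrary: n)
  case (Suc m)
  have "(strip ^^ k) None = None" for k by (induction k) auto
  then show ?case using Suc by (cases n) (auto simp: funpow_swap1)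
qed simp

lemma ev_Eq_nat:
  assumes "ev p s T (enc_nat m)" and "ev q s U (enc_nat n)"
  shows "ev (Eq_nat p q) s (T + U) (enc_bool (m = n))"
proof -
  let ?p = "If_Node (arg 0) (If_Node (fst_of (arg 0)) Make_Tip (Fork Make_Tip Make_Tip)) Make_Tip"
  define E where "E = (\<lambda>x. case x of None \<Rightarrow> Tip | Some n \<Rightarrow> Node (enc_nat n) Tip)"
  let ?b = "If_Node (arg 1) (If_Node (fst_of (arg 1)) (Fork (snd_of (fst_of (arg 1))) Make_Tip) Make_Tip)
         Make_Tip"
  have "ev (Fold p (Fork q Make_Tip) ?b) s (T + (U + 0)) (E (fold (\<lambda>_. strip) (replicate m Tip) (Some n)))"
  proof (rule ev_Fold_free[where e = "\<lambda>x. x"])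
    show "ev (Fork q Make_Tip) s (U + 0) (E (Some n))"
      unfolding E_def using ev_Fork[OF assms(2) ev_Tip] by simp
    fix x :: tree and acc :: "nat option"
    show "ev ?b (Node x (Node (E acc) s)) 0 (E (strip acc))"
    proof (cases "\<exists>k. acc = Some (Suc k)")
      case True
      then obtain k where k: "acc = Some (Suc k)" by blast
      have s: "ev (arg 1) (Node x (Node (E acc) s)) 0 (Node (Node Tip (enc_nat k)) Tip)"
        unfolding k E_def by (rule ev_arg') (simp_all add: enc_nat_def)
      have "ev ?b (Node x (Node (E acc) s)) (0 + (0 + (0 + 0))) (Node (enc_nat k) Tip)"
        by (rule ev_If_true ev_Fork ev_fst ev_snd ev_Tip s)+
      then show ?thesis by (simp add: k E_def)
    next
      case False
      then consider "acc = None" | "acc = Some 0"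
        by (metis not0_implies_Suc not_None_eq)
      then show ?thesis
      proof cases
        case 1
        have "ev ?b (Node x (Node (E acc) s)) (0 + 0) Tip"
          by (rule ev_If_false, rule ev_arg') (simp_all add: 1 E_def ev_Tip)
        then show ?thesis by (simp add: 1 E_def)
      next
        case 2
        have s: "ev (arg 1) (Node x (Node (E acc) s)) 0 (Node Tip Tip)"
          unfolding 2 E_def by (rule ev_arg') (simp_all add: enc_nat_def)
        have "ev ?b (Node x (Node (E acc) s)) (0 + (0 + 0)) Tip"
          by (rule ev_If_true, rule s, rule ev_If_false, rule ev_fst, rule s, rule ev_Tip)
        then show ?thesis by (simp add: 2 E_def)
      qed
    qed
  qed (use assms in \<open>simp_all add: enc_nat_def\<close>)
  then have *: "ev (Fold p (Fork q Make_Tip) ?b) s (T + U) (E (if m \<le> n then Some (n - m) else None))"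
    (is "ev _ _ _ ?r") by (simp only: fold_strip add_0_right)
  have "ev ?p
      (Node ?r s) 0 (enc_bool (m = n))"
  proof -
    have r: "ev (arg 0) (Node ?r s) 0 ?r" by (rule ev_arg') simp_all
    consider "m < n" | "m = n" | "m > n" by linarith
    then show ?thesis
    proof cases
      case 1
      then obtain k where "n - m = Suc k" by (metis Suc_diff_Suc)
      then have r': "?r = Node (Node Tip (enc_nat k)) Tip" using 1 by (simp add: E_def enc_nat_def)
      have "ev ?p
          (Node ?r s) (0 + (0 + 0)) Tip"
        by (rule ev_If_true ev_fst r[unfolded r'] ev_Tip | subst r')+
      then show ?thesis using 1 by simp
    next
      case 2
      then have r': "?r = Node Tip Tip" by (simp add: E_def enc_nat_def)
      have "ev ?p
          (Node (Node Tip Tip) s) (0 + (0 + (0 + 0))) (Node Tip Tip)"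
        by (rule ev_If_true, rule r[unfolded r'], rule ev_If_false, rule ev_fst, rule r[unfolded r'])
          (rule ev_Fork ev_Tip)+
      then show ?thesis unfolding r' using 2 by simp
    next
      case 3
      then have r': "?r = Tip" by (simp add: E_def)
      have "ev ?p
          (Node Tip s) (0 + 0) Tip"
        by (rule ev_If_false, rule r[unfolded r'], rule ev_Tip)
      then show ?thesis unfolding r' using 3 by simp
    qed
  qed
  from ev_Let[OF * this] show ?thesis unfolding Eq_nat_def by simp
qed

lemma ev_args:
  "ev (arg 0) (Node a s) 0 a"
  "ev (arg 1) (Node a (Node b s)) 0 b"
  "ev (arg 2) (Node a (Node b (Node c s))) 0 c"
  "ev (arg 3) (Node a (Node b (Node c (Node d s)))) 0 d"
  "ev (arg 4) (Node a (Node b (Node c (Node d (Node e s))))) 0 e"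
  "ev (arg 5) (Node a (Node b (Node c (Node d (Node e (Node f s)))))) 0 f"
  by (rule ev_arg'; simp add: numeral_eq_Suc)+

declare arg.simps [simp del]

lemma ev_Fork_free: "ev p s 0 x \<Longrightarrow> ev q s 0 y \<Longrightarrow> ev (Fork p q) s 0 (Node x y)"
  using ev_Fork by fastforce

lemmas ev_basic = ev_Fork ev_fst ev_snd ev_args ev_Tip ev_Zero ev_One

section \<open>Vector operations as programs\<close>

text \<open>The bilinear product, without conjugation: programs have only the field
  operations.\<close>

definition dot :: "complex list \<Rightarrow> complex list \<Rightarrow> complex" where
  "dot xs ys = sum_list (map2 (*) xs ys)"

abbreviation enc_vec :: "complex list \<Rightarrow> tree" where
  "enc_vec xs \<equiv> enc_list (map Num xs)"

abbreviation enc_rows :: "complex list list \<Rightarrow> tree" where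
  "enc_rows A \<equiv> enc_list (map enc_vec A)"

lemma ev_zeros: "ev p s 0 (enc_nat n) \<Longrightarrow> ev (Map p Make_Zero) s 0 (enc_vec (replicate n 0))"
  using ev_Map_free[of p s 0 "\<lambda>x. x" "replicate n Tip" Make_Zero "\<lambda>_. Num 0"] ev_Zero
  by (simp add: enc_nat_def)

definition Dot :: "prog \<Rightarrow> prog \<Rightarrow> prog" where
  "Dot p q = Fold (Zip p q) Make_Zero
     (Seq (Fork (arg 1) (Seq (Fork (fst_of (arg 0)) (snd_of (arg 0))) Mul)) Add)"

lemma enc_zip_vec: "map2 Node (map Num xs) (map Num ys) = map (\<lambda>(x, y). Node (Num x) (Num y)) (zip xs ys)"
  by (simp add: zip_map1 zip_map2 split_def)

lemma ev_Dot:
  assumes "ev p s T (enc_vec xs)" and "ev q s U (enc_vec ys)"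
  shows "ev (Dot p q) s (T + U + 2 * length xs) (Num (dot xs ys))"
proof -
  have "ev (Dot p q) s (T + U + 0 + length (zip xs ys) * 2) (Num (fold (\<lambda>(x, y) acc. acc + x * y) (zip xs ys) 0))"
    unfolding Dot_def
  proof (rule ev_Fold[where e = "\<lambda>(x, y). Node (Num x) (Num y)" and E = Num and I = "\<lambda>_. True"])
    show "ev (Zip p q) s (T + U) (enc_list (map (\<lambda>(x, y). Node (Num x) (Num y)) (zip xs ys)))"
      using ev_Zip[OF assms] unfolding enc_zip_vec .
    fix z :: "complex \<times> complex" and acc :: complex
    obtain x y where z: "z = (x, y)" by force
    have "ev (Seq (Fork (arg 1) (Seq (Fork (fst_of (arg 0)) (snd_of (arg 0))) Mul)) Add)
        (Node (Node (Num x) (Num y)) (Node (Num acc) s)) (0 + (0 + 0 + 1) + 1) (Num (acc + x * y))"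
      by (rule ev_Add ev_Mul ev_basic)+
    then show "ev (Seq (Fork (arg 1) (Seq (Fork (fst_of (arg 0)) (snd_of (arg 0))) Mul)) Add)
        (Node (case z of (x, y) \<Rightarrow> Node (Num x) (Num y)) (Node (Num acc) s)) 2
        (Num ((case z of (x, y) \<Rightarrow> \<lambda>acc. acc + x * y) acc)) \<and> True"
      by (simp add: z numeral_2_eq_2)
  qed (simp_all add: ev_Zero)
  moreover have "fold (\<lambda>(x, y) acc. acc + x * y) zs a = a + sum_list (map (\<lambda>(x, y). x * y) zs)"
    for zs :: "(complex \<times> complex) list" and a
    by (induction zs arbitrary: a) (auto simp: algebra_simps)
  ultimately show ?thesis
    by (elim ev_eq) (auto simp: dot_def)
qed

definition axmy :: "complex \<Rightarrow> complex list \<Rightarrow> complex list \<Rightarrow> complex list" where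
  "axmy c xs ys = map2 (\<lambda>x y. x - c * y) xs ys"

text \<open>The scalar \<open>c\<close> is evaluated inside the map, below the current pair, so its
  indices are one higher than those of \<open>p\<close> and \<open>q\<close>.\<close>

definition Axmy :: "prog \<Rightarrow> prog \<Rightarrow> prog \<Rightarrow> prog" where
  "Axmy c p q = Map (Zip p q)
     (Seq (Fork (fst_of (arg 0)) (Seq (Fork c (snd_of (arg 0))) Mul)) Sub)"

lemma ev_Axmy:
  assumes "ev p s T (enc_vec xs)" and "ev q s U (enc_vec ys)"
    and "\<And>x. ev c (Node x s) 0 (Num r)"
  shows "ev (Axmy c p q) s (T + U + 2 * length xs) (enc_vec (axmy r xs ys))"
proof -
  have "ev (Axmy c p q) s (T + U + length (zip xs ys) * 2)
      (enc_list (map (\<lambda>z. Num (fst z - r * snd z)) (zip xs ys)))"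
    unfolding Axmy_def
  proof (rule ev_Map[where e = "\<lambda>(x, y). Node (Num x) (Num y)"])
    show "ev (Zip p q) s (T + U) (enc_list (map (\<lambda>(x, y). Node (Num x) (Num y)) (zip xs ys)))"
      using ev_Zip[OF assms(1,2)] unfolding enc_zip_vec .
    fix z :: "complex \<times> complex"
    obtain x y where z: "z = (x, y)" by force
    have "ev (Seq (Fork (fst_of (arg 0)) (Seq (Fork c (snd_of (arg 0))) Mul)) Sub)
        (Node (Node (Num x) (Num y)) s) (0 + (0 + 0 + 1) + 1) (Num (x - r * y))"
      by (rule ev_Sub ev_Mul ev_basic assms(3))+
    then show "ev (Seq (Fork (fst_of (arg 0)) (Seq (Fork c (snd_of (arg 0))) Mul)) Sub)
        (Node (case z of (x, y) \<Rightarrow> Node (Num x) (Num y)) s) 2 (Num (fst z - r * snd z))"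
      by (simp add: z numeral_2_eq_2)
  qed
  then show ?thesis
    by (elim ev_eq) (auto simp: axmy_def split_def comp_def)
qed

text \<open>The identity matrix. The zeros of the new row come from mapping over the old rows, which
  have the right number, so the program needs no counter.\<close>

primrec idm :: "nat \<Rightarrow> complex list list" where
  "idm 0 = []"
| "idm (Suc n) = (1 # map (\<lambda>_. 0) (idm n)) # map ((#) 0) (idm n)"

lemma length_idm [simp]: "length (idm n) = n"
  by (induction n) auto

lemma length_idm_row: "k \<in> set (idm n) \<Longrightarrow> length k = n"
  by (induction n arbitrary: k) auto

definition Idm :: "prog \<Rightarrow> prog" where
  "Idm p = Fold p Make_Tip
     (Fork (Fork Make_One (Map (arg 1) Make_Zero)) (Map (arg 1) (Fork Make_Zero (arg 0))))"

lemma ev_Idm: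
  assumes "ev p s T (enc_nat n)"
  shows "ev (Idm p) s T (enc_rows (idm n))"
proof -
  define f :: "complex list list \<Rightarrow> complex list list"
    where "f acc = (1 # map (\<lambda>_. 0) acc) # map ((#) 0) acc" for acc
  have "ev (Idm p) s (T + 0) (enc_rows (fold (\<lambda>_. f) (replicate n Tip) []))"
    unfolding Idm_def
  proof (rule ev_Fold_free[where e = "\<lambda>x. x"])
    fix x :: tree and acc
    let ?s = "Node x (Node (enc_rows acc) s)"
    have acc: "ev (arg 1) ?s 0 (enc_rows acc)"
      by (rule ev_args)
    have "ev (Fork (Fork Make_One (Map (arg 1) Make_Zero)) (Map (arg 1) (Fork Make_Zero (arg 0)))) ?s
      0 (Node (Node (Num 1) (enc_list (map (\<lambda>_. Num 0) acc)))
        (enc_list (map (\<lambda>r. Node (Num 0) (enc_vec r)) acc)))"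
      by (rule ev_Fork_free ev_Map_free[OF acc] ev_args ev_Zero ev_One)+
    then show "ev (Fork (Fork Make_One (Map (arg 1) Make_Zero)) (Map (arg 1) (Fork Make_Zero (arg 0)))) ?s
      0 (enc_rows (f acc))"
      by (simp add: f_def comp_def)
  qed (use assms in \<open>simp_all add: enc_nat_def ev_Tip\<close>)
  moreover have "fold (\<lambda>_. f) (replicate n Tip) [] = idm n"
  proof -
    have "(f ^^ n) [] = idm n" by (induction n) (simp_all add: f_def)
    then show ?thesis by simp
  qed
  ultimately show ?thesis by simp
qed

definition transpose_rows :: "nat \<Rightarrow> complex list list \<Rightarrow> complex list list" where
  "transpose_rows d A = foldr (map2 (#)) A (replicate d [])"

definition Transp :: "prog \<Rightarrow> prog \<Rightarrow> prog" where
  "Transp p z = Fold (Rev p) (Map z Make_Tip) (Zip (arg 0) (arg 1))"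

lemma ev_Transp:
  assumes "ev p s T (enc_rows A)" and "ev z s U (enc_nat d)"
  shows "ev (Transp p z) s (T + U) (enc_rows (transpose_rows d A))"
proof -
  have "ev (Transp p z) s (T + U) (enc_rows (fold (map2 (#)) (rev A) (replicate d [])))"
    unfolding Transp_def
  proof (rule ev_Fold_free)
    show "ev (Rev p) s T (enc_rows (rev A))"
      using ev_Rev[OF assms(1)] by (simp add: rev_map)
    have "ev (Map z Make_Tip) s U (enc_list (map (\<lambda>_. Tip) (replicate d Tip)))"
      by (rule ev_Map_free[where e = "\<lambda>x. x"]) (use assms(2) in \<open>simp_all add: enc_nat_def ev_Tip\<close>)
    then show "ev (Map z Make_Tip) s U (enc_rows (replicate d []))"
      by simp
    fix x acc
    have "ev (Zip (arg 0) (arg 1)) (Node (enc_vec x) (Node (enc_rows acc) s)) (0 + 0)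
        (enc_list (map2 Node (map Num x) (map enc_vec acc)))"
      by (rule ev_Zip ev_args)+
    moreover have "map2 Node (map Num x) (map enc_vec acc) = map enc_vec (map2 (#) x acc)"
      by (simp add: zip_map1 zip_map2 split_def)
    ultimately show "ev (Zip (arg 0) (arg 1)) (Node (enc_vec x) (Node (enc_rows acc) s)) 0
        (enc_rows (map2 (#) x acc))"
      by simp
  qed
  then show ?thesis by (simp add: transpose_rows_def foldr_conv_fold)
qed

text \<open>One mark per nonzero entry; the resulting list can be used directly as a condition, at
  the price of one zero test per entry.\<close>

definition Nonzero_Entries :: "prog \<Rightarrow> prog" where
  "Nonzero_Entries p = Concat_Map p
     (Concat_Map (arg 0) (If_Node (Seq (arg 0) Is_Zero) Make_Tip (Fork Make_Tip Make_Tip)))"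

lemma ev_Nonzero_Entries:
  assumes "ev p s T (enc_rows A)" and "\<And>r. r \<in> set A \<Longrightarrow> length r = n"
  shows "\<exists>zs. (zs = [] \<longleftrightarrow> (\<forall>r \<in> set A. \<forall>z \<in> set r. z = 0)) \<and>
    ev (Nonzero_Entries p) s (T + length A * n) (enc_list zs)"
proof -
  let ?p = "If_Node (Seq (arg 0) Is_Zero) Make_Tip (Fork Make_Tip Make_Tip)"
  have "ev (Nonzero_Entries p) s (T + length A * n)
    (enc_list (concat (map (\<lambda>r. concat (map (\<lambda>z. if z = 0 then [] else [Tip]) r)) A)))"
    unfolding Nonzero_Entries_def
  proof (rule ev_Concat_Map[OF assms(1)])
    fix r assume "r \<in> set A"
    have "ev (Concat_Map (arg 0) ?p)
      (Node (enc_vec r) s) (0 + length r * 1) (enc_list (concat (map (\<lambda>z. if z = 0 then [] else [Tip]) r)))"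
    proof (rule ev_Concat_Map[OF ev_args(1)])
      fix z
      have "ev ?p (Node (Num z) (Node (enc_vec r) s))
        (0 + 1 + (0 + 0)) (if z = 0 then Tip else Node Tip Tip)"
        by (rule ev_If_bool[OF ev_Is_Zero[OF ev_args(1)]])
          (use ev_Fork_free[OF ev_Tip ev_Tip] ev_Tip in simp_all)
      then show "ev ?p (Node (Num z) (Node (enc_vec r) s))
        1 (enc_list (if z = 0 then [] else [Tip]))"
        by (auto split: if_splits)
    qed
    then show "ev (Concat_Map (arg 0) ?p)
      (Node (enc_vec r) s) n (enc_list (concat (map (\<lambda>z. if z = 0 then [] else [Tip]) r)))"
      using assms(2)[OF \<open>r \<in> set A\<close>] by simp
  qed
  then show ?thesis
    by (intro exI[of _ "concat (map (\<lambda>r. concat (map (\<lambda>z. if z = 0 then [] else [Tip]) r)) A)"])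
      (auto split: if_splits)
qed

section \<open>Extracting a spanning set\<close>

text \<open>
  If \<open>x \<bullet> k\<^sub>0 \<noteq> 0\<close>, replacing every \<open>k\<close> by \<open>k - (x \<bullet> k / x \<bullet> k\<^sub>0) k\<^sub>0\<close> adds \<open>x\<close> to the common
  annihilator of \<open>K\<close>. The pivot becomes \<open>0\<close>, so the length of \<open>K\<close> stays fixed while its number of
  nonzero vectors drops. The second components \<open>p\<close> are carried along as data.
\<close>

fun ins :: "complex list \<times> 'p \<Rightarrow> 'p list \<times> complex list list \<Rightarrow> 'p list \<times> complex list list" where
  "ins (x, p) (S, K) = (case filter (\<lambda>k. dot x k \<noteq> 0) K of
      [] \<Rightarrow> (S, K)
    | k\<^sub>0 # _ \<Rightarrow> (p # S, map (\<lambda>k. axmy (dot x k / dot x k\<^sub>0) k k\<^sub>0) K))"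

fun enc_elem :: "('p \<Rightarrow> tree) \<Rightarrow> complex list \<times> 'p \<Rightarrow> tree" where
  "enc_elem ep (x, p) = Node (enc_vec x) (ep p)"

fun enc_state :: "('p \<Rightarrow> tree) \<Rightarrow> 'p list \<times> complex list list \<Rightarrow> tree" where
  "enc_state ep (S, K) = Node (enc_list (map ep S)) (enc_rows K)"

text \<open>The filtered list is both the test for a pivot and, through its head, the pivot. The
  division cannot block, because every vector in that list has a nonzero product with the inserted
  one.\<close>

definition Ins :: prog where
  "Ins = Let_in
     (Concat_Map (snd_of (arg 1))
        (If_Node (Seq (Dot (fst_of (arg 1)) (arg 0)) Is_Zero) Make_Tip (Fork (arg 0) Make_Tip)))
     (If_Node (arg 0)
        (Let_in (Dot (fst_of (arg 1)) (fst_of (arg 0)))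
          (Fork (Fork (snd_of (arg 2)) (fst_of (arg 3)))
            (Map (snd_of (arg 3))
              (Let_in (Seq (Fork (Dot (fst_of (arg 3)) (arg 0)) (arg 1)) Div)
                (Axmy (arg 1) (arg 1) (fst_of (arg 3)))))))
        (arg 2))"

definition ins_shape :: "nat \<Rightarrow> nat \<Rightarrow> 'p list \<times> complex list list \<Rightarrow> bool" where
  "ins_shape m D = (\<lambda>(S, K). length K = m \<and> (\<forall>k \<in> set K. length k = D))"

lemma length_axmy [simp]: "length (axmy c xs ys) = min (length xs) (length ys)"
  by (simp add: axmy_def)

lemma ins_shape_ins: "ins_shape m D st \<Longrightarrow> ins_shape m D (ins x st)"
proof (cases x, cases st)
  fix v p S K
  assume sh: "ins_shape m D st" and x: "x = (v, p)" and st: "st = (S, K)"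
  show "ins_shape m D (ins x st)"
  proof (cases "filter (\<lambda>k. dot v k \<noteq> 0) K")
    case (Cons k0 ks)
    then have "k0 \<in> set K" by (metis filter_is_subset list.set_intros(1) subsetD)
    then show ?thesis using sh Cons by (auto simp: x st ins_shape_def)
  qed (use sh in \<open>simp add: x st\<close>)
qed

text \<open>Each of the \<open>m\<close> vectors costs \<open>2 * D + 1\<close> for the product and
  zero test in the search for pivots, then \<open>4 * D + 1\<close> for a product, a quotient and a
  subtraction. The last \<open>2 * D\<close> is the product with the pivot.\<close>

definition ins_cost :: "nat \<Rightarrow> nat \<Rightarrow> nat" where
  "ins_cost m D = m * (6 * D + 2) + 2 * D"

lemma ev_Ins:
  assumes sh: "ins_shape m D st" and len: "length (fst x) = D"
  shows "ev Ins (Node (enc_elem ep x) (Node (enc_state ep st) s)) (ins_cost m D) (enc_state ep (ins x st))"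
proof -
  let ?p = "Let_in (Seq (Fork (Dot (fst_of (arg 3)) (arg 0)) (arg 1)) Div) (Axmy (arg 1) (arg 1) (fst_of (arg 3)))"
  let ?q = "If_Node (Seq (Dot (fst_of (arg 1)) (arg 0)) Is_Zero) Make_Tip (Fork (arg 0) Make_Tip)"
  obtain v p where x: "x = (v, p)" by force
  obtain S K where st: "st = (S, K)" by force
  let ?e = "Node (Node (enc_vec v) (ep p)) (Node (Node (enc_list (map ep S)) (enc_rows K)) s)"
  define piv where "piv = filter (\<lambda>k. dot v k \<noteq> 0) K"
  have lenK: "length K = m" and lenk: "\<And>k. k \<in> set K \<Longrightarrow> length k = D" and lenv: "length v = D"
    using sh len by (auto simp: ins_shape_def st x)
  have c1: "ev (Concat_Map (snd_of (arg 1)) ?q)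
      ?e (0 + length K * (2 * D + 1)) (enc_list (concat (map (\<lambda>k. if dot v k = 0 then [] else [enc_vec k]) K)))"
  proof (rule ev_Concat_Map[where e = enc_vec])
    show "ev (snd_of (arg 1)) ?e 0 (enc_rows K)" by (rule ev_basic)+
    fix k assume "k \<in> set K"
    have "ev ?q
       (Node (enc_vec k) ?e) ((0 + 0 + 2 * length v) + 1 + (0 + 0))
       (if dot v k = 0 then Tip else Node (enc_vec k) Tip)"
    proof (rule ev_If_bool)
      show "ev (Seq (Dot (fst_of (arg 1)) (arg 0)) Is_Zero) (Node (enc_vec k) ?e)
         ((0 + 0 + 2 * length v) + 1) (enc_bool (dot v k = 0))"
        by (rule ev_Is_Zero ev_Dot ev_basic)+
    qed (use ev_Fork[OF ev_args(1) ev_Tip] ev_Tip in auto)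
    then show "ev ?q
       (Node (enc_vec k) ?e) (2 * D + 1) (enc_list (if dot v k = 0 then [] else [enc_vec k]))"
      by (auto simp: lenv split: if_splits)
  qed
  have "concat (map (\<lambda>k. if dot v k = 0 then [] else [enc_vec k]) K) = map enc_vec piv"
    unfolding piv_def by (induction K) auto
  with c1 have c1: "ev (Concat_Map (snd_of (arg 1)) ?q)
      ?e (m * (2 * D + 1)) (enc_rows piv)"
    by (simp add: lenK)
  have "ev Ins ?e (m * (2 * D + 1) + (m * (4 * D + 1) + 2 * D)) (enc_state ep (ins x st))"
    unfolding Ins_def
  proof (rule ev_Let[OF c1])
    let ?P = "Let_in (Dot (fst_of (arg 1)) (fst_of (arg 0)))
          (Fork (Fork (snd_of (arg 2)) (fst_of (arg 3)))
            (Map (snd_of (arg 3)) ?p))"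
    show "ev (If_Node (arg 0) ?P (arg 2)) (Node (enc_rows piv) ?e) (m * (4 * D + 1) + 2 * D)
       (enc_state ep (ins x st))"
    proof (cases piv)
      case Nil
      have "ev (If_Node (arg 0) ?P (arg 2)) (Node Tip ?e) (0 + 0) (Node (enc_list (map ep S)) (enc_rows K))"
        by (rule ev_If_false ev_args)+
      then show ?thesis
        using Nil by (auto simp: x st piv_def elim: ev_mono)
    next
      case (Cons k0 ks)
      let ?e1 = "Node (enc_rows piv) ?e"
      let ?e2 = "Node (Num (dot v k0)) ?e1"
      have k0: "k0 \<in> set K" "dot v k0 \<noteq> 0"
      proof -
        have "k0 \<in> set piv" using Cons by simp
        then show "k0 \<in> set K" "dot v k0 \<noteq> 0" by (simp_all add: piv_def)
      qed
      have m: "ev (Map (snd_of (arg 3)) ?p) ?e2 (0 + length K * (4 * D + 1))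
            (enc_list (map (\<lambda>k. enc_vec (axmy (dot v k / dot v k0) k k0)) K))"
      proof (rule ev_Map[where e = enc_vec])
        show "ev (snd_of (arg 3)) ?e2 0 (enc_rows K)" by (rule ev_basic)+
        fix k assume k: "k \<in> set K"
        have p: "ev (fst_of (arg 3)) (Node (Num r) (Node (enc_vec k) ?e2)) 0 (enc_vec k0)" for r
          by (rule ev_fst[where y = "enc_rows ks"]) (use Cons ev_args(4) in simp)
        have "ev ?p (Node (enc_vec k) ?e2)
             ((0 + 0 + 2 * length v) + 0 + 1 + (0 + 0 + 2 * length k))
             (enc_vec (axmy (dot v k / dot v k0) k k0))"
          by (rule ev_Let ev_Div ev_Axmy ev_Dot p k0(2) ev_basic)+
        then show "ev ?p (Node (enc_vec k) ?e2) (4 * D + 1)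
             (enc_vec (axmy (dot v k / dot v k0) k k0))"
          by (simp add: lenv lenk[OF k])
      qed
      have p0: "ev (fst_of (arg 0)) ?e1 0 (enc_vec k0)"
        by (rule ev_fst[where y = "enc_rows ks"]) (use Cons ev_args(1) in simp)
      have q0: "ev (arg 0) ?e1 0 (Node (enc_vec k0) (enc_rows ks))"
        using Cons ev_args(1) by simp
      have "ev (If_Node (arg 0) ?P (arg 2)) ?e1
         (0 + ((0 + 0 + 2 * length v) + (0 + 0 + (0 + length K * (4 * D + 1)))))
         (Node (Node (ep p) (enc_list (map ep S)))
           (enc_list (map (\<lambda>k. enc_vec (axmy (dot v k / dot v k0) k k0)) K)))"
        by (rule ev_If_true[OF q0] ev_Let ev_Dot p0 m ev_basic)+
      then show ?thesis
        using Cons by (elim ev_eq) (auto simp: x st piv_def lenv lenK comp_def)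
    qed
  qed
  then show ?thesis
    by (simp add: x st ins_cost_def algebra_simps)
qed

lemma ins_shape_fold: "ins_shape m D st \<Longrightarrow> ins_shape m D (fold ins xs st)"
  by (induction xs arbitrary: st) (simp_all add: ins_shape_ins)

lemma ev_Fold_Ins:
  assumes "ev l s T (enc_list (map (enc_elem ep) xs))" and "ev a s U (enc_state ep st)"
    and "ins_shape m D st" and "\<And>x. x \<in> set xs \<Longrightarrow> length (fst x) = D"
  shows "ev (Fold l a Ins) s (T + U + length xs * ins_cost m D) (enc_state ep (fold ins xs st))"
  by (rule ev_Fold[where I = "ins_shape m D"])
    (use assms ev_Ins ins_shape_ins in blast)+

section \<open>Many tests as one square matrix product\<close>

lemma dot_sum: "length xs = length ys \<Longrightarrow> dot xs ys = (\<Sum>i<length xs. xs ! i * ys ! i)"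
  unfolding dot_def by (subst sum_list_sum_nth) (simp add: atLeast0LessThan)

lemma transpose_rows_eq: "(\<And>r. r \<in> set A \<Longrightarrow> length r = d) \<Longrightarrow>
    transpose_rows d A = map (\<lambda>i. map (\<lambda>r. r ! i) A) [0..<d]"
proof (induction A)
  case (Cons r A)
  then have IH: "transpose_rows d A = map (\<lambda>i. map (\<lambda>r. r ! i) A) [0..<d]" and l: "length r = d"
    by auto
  have "transpose_rows d (r # A) = map2 (#) r (map (\<lambda>i. map (\<lambda>r. r ! i) A) [0..<d])"
    using IH by (simp add: transpose_rows_def)
  also have "\<dots> = map (\<lambda>i. map (\<lambda>r. r ! i) (r # A)) [0..<d]"
    by (rule nth_equalityI) (use l in auto)
  finally show ?case .
qed (simp add: transpose_rows_def map_replicate_const)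

lemma enc_mat_rows:
  assumes "length A = d" and "\<And>r. r \<in> set A \<Longrightarrow> length r = n"
  shows "enc_mat (mat_of_rows_list n A) = enc_rows A"
proof -
  have "mat_to_list (mat_of_rows_list n A) = A"
    unfolding mat_to_list_def mat_of_rows_list_def
    by (rule nth_equalityI) (use assms in \<open>auto intro!: nth_equalityI\<close>)
  then show ?thesis by (simp add: enc_mat_def)
qed

text \<open>The product of \<open>X\<close> with the transpose of \<open>K\<close> contains every
  \<open>dot x k\<close>, so one matrix multiplication replaces \<open>d * d\<close> separate
  products.\<close>

lemma enc_mat_mult_transp:
  assumes "length X = d" "\<And>x. x \<in> set X \<Longrightarrow> length x = d"
    and "length K = d" "\<And>k. k \<in> set K \<Longrightarrow> length k = d"
  shows "enc_mat (mat_of_rows_list d X * mat_of_rows_list d (transpose_rows d K)) =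
    enc_rows (map (\<lambda>x. map (dot x) K) X)"
proof -
  let ?A = "mat_of_rows_list d X" and ?B = "mat_of_rows_list d (transpose_rows d K)"
  have dims: "?A \<in> carrier_mat d d" "?B \<in> carrier_mat d d"
    using assms(1,3,4) by (auto simp: mat_of_rows_list_def transpose_rows_eq)
  have entry: "(?A * ?B) $$ (i, j) = dot (X ! i) (K ! j)" if i: "i < d" and j: "j < d" for i j
  proof -
    have "(?A * ?B) $$ (i, j) = (\<Sum>l = 0..<d. ?A $$ (i, l) * ?B $$ (l, j))"
      using dims i j by (simp add: scalar_prod_def)
    also have "\<dots> = (\<Sum>l<d. X ! i ! l * K ! j ! l)"
      unfolding atLeast0LessThan
      by (rule sum.cong)
        (use i j assms(1,3,4) in \<open>simp_all add: mat_of_rows_list_def transpose_rows_eq[OF assms(4)]\<close>)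
    also have "\<dots> = dot (X ! i) (K ! j)"
      using assms i j by (subst dot_sum) simp_all
    finally show ?thesis .
  qed
  have "mat_to_list (?A * ?B) = map (\<lambda>x. map (dot x) K) X"
    unfolding mat_to_list_def
    by (rule nth_equalityI)
      (use dims entry assms(1,3) in \<open>auto intro!: nth_equalityI simp del: index_mult_mat(1)\<close>)
  then show ?thesis by (simp add: enc_mat_def comp_def)
qed

text \<open>The potential of the amortised analysis: it is at most \<open>length K\<close>, and
  every insertion that selects its element lowers it.\<close>

definition nonzero_count :: "complex list list \<Rightarrow> nat" where
  "nonzero_count K = length (filter (\<lambda>k. \<exists>z \<in> set k. z \<noteq> 0) K)"

definition annihilates :: "complex list list \<Rightarrow> complex list \<Rightarrow> bool" where
  "annihilates K x \<longleftrightarrow> (\<forall>k \<in> set K. dot x k = 0)"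

lemma ins_annihilates: "annihilates (snd st) (fst x) \<Longrightarrow> ins x st = st"
proof (cases x, cases st)
  fix v p S K
  assume "annihilates (snd st) (fst x)" and x: "x = (v, p)" and st: "st = (S, K)"
  then have "filter (\<lambda>k. dot v k \<noteq> 0) K = []" by (auto simp: annihilates_def filter_empty_conv)
  then show "ins x st = st" by (simp add: x st)
qed

lemma length_filter_strict:
  "(\<And>k. k \<in> set K \<Longrightarrow> Q k \<Longrightarrow> P k) \<Longrightarrow> k\<^sub>0 \<in> set K \<Longrightarrow> P k\<^sub>0 \<Longrightarrow> \<not> Q k\<^sub>0 \<Longrightarrow>
    length (filter Q K) < length (filter P K)"
proof (induction K)
  case (Cons k K)
  have "length (filter Q K) \<le> length (filter P K)"
  proof -
    have "\<forall>k \<in> set K. Q k \<longrightarrow> P k" using Cons.prems(1) by simp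
    then show ?thesis by (induction K) auto
  qed
  then show ?case using Cons by auto
qed simp

lemma dot_zero_right: "\<forall>z \<in> set ys. z = 0 \<Longrightarrow> dot xs ys = 0"
proof -
  assume "\<forall>z \<in> set ys. z = 0"
  then have "map2 (*) xs ys = map (\<lambda>_. 0) (zip xs ys)"
    by (auto dest: set_zip_rightD)
  then show ?thesis unfolding dot_def by (simp only: sum_list_0)
qed

lemma ins_not_annihilates:
  assumes "\<not> annihilates K v"
  obtains k\<^sub>0 where "k\<^sub>0 \<in> set K" "dot v k\<^sub>0 \<noteq> 0"
    "ins (v, p) (S, K) = (p # S, map (\<lambda>k. axmy (dot v k / dot v k\<^sub>0) k k\<^sub>0) K)"
proof (cases "filter (\<lambda>k. dot v k \<noteq> 0) K")
  case Nil
  then show ?thesis using assms by (auto simp: annihilates_def filter_empty_conv)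
next
  case (Cons k0 ks)
  then have "k0 \<in> set (filter (\<lambda>k. dot v k \<noteq> 0) K)" by simp
  then have "k0 \<in> set K" "dot v k0 \<noteq> 0" by simp_all
  then show ?thesis using Cons by (intro that[of k0]) simp_all
qed

text \<open>A zero vector has product 0 with \<open>v\<close> and is left alone, while the pivot,
  nonzero because its product with \<open>v\<close> is, becomes zero.\<close>

lemma nonzero_count_ins:
  assumes "\<not> annihilates K v"
  shows "nonzero_count (snd (ins (v, p) (S, K))) < nonzero_count K"
proof -
  obtain k0 where k0: "k0 \<in> set K" "dot v k0 \<noteq> 0"
    and i: "ins (v, p) (S, K) = (p # S, map (\<lambda>k. axmy (dot v k / dot v k0) k k0) K)"
    using ins_not_annihilates[OF assms] .
  have "nonzero_count (snd (ins (v, p) (S, K))) =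
     length (filter (\<lambda>k. \<exists>z \<in> set (axmy (dot v k / dot v k0) k k0). z \<noteq> 0) K)"
    by (simp only: i nonzero_count_def snd_conv filter_map length_map comp_def)
  also have "\<dots> < nonzero_count K"
    unfolding nonzero_count_def
  proof (rule length_filter_strict[OF _ k0(1)])
    fix k assume "\<exists>z \<in> set (axmy (dot v k / dot v k0) k k0). z \<noteq> 0"
    then show "\<exists>z \<in> set k. z \<noteq> 0"
      using dot_zero_right[of k v] by (fastforce simp: axmy_def dest: set_zip_leftD)
  next
    show "\<exists>z \<in> set k0. z \<noteq> 0" using dot_zero_right[of k0 v] k0(2) by blast
    show "\<not> (\<exists>z \<in> set (axmy (dot v k0 / dot v k0) k0 k0). z \<noteq> 0)"
      using k0(2) by (auto simp: axmy_def zip_same)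
  qed
  finally show ?thesis .
qed

lemma nonzero_count_ins_le: "nonzero_count (snd (ins x st)) \<le> nonzero_count (snd st)"
proof (cases "annihilates (snd st) (fst x)")
  case False
  then show ?thesis using nonzero_count_ins[of "snd st" "fst x" "snd x" "fst st"] by simp
qed (simp add: ins_annihilates)

lemma nonzero_count_fold_le: "nonzero_count (snd (fold ins xs st)) \<le> nonzero_count (snd st)"
proof (induction xs arbitrary: st)
  case (Cons x xs)
  then show ?case using nonzero_count_ins_le[of x st] by (metis fold_simps(2) le_trans)
qed simp

lemma fold_ins_annihilates: "(\<forall>x \<in> set xs. annihilates (snd st) (fst x)) \<Longrightarrow> fold ins xs st = st"
  by (induction xs) (simp_all add: ins_annihilates)

lemma nonzero_count_fold:
  "\<not> (\<forall>x \<in> set xs. annihilates (snd st) (fst x)) \<Longrightarrow>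
    nonzero_count (snd (fold ins xs st)) < nonzero_count (snd st)"
proof (induction xs)
  case (Cons x xs)
  show ?case
  proof (cases "annihilates (snd st) (fst x)")
    case True
    then show ?thesis using Cons by (simp add: ins_annihilates)
  next
    case False
    have "nonzero_count (snd (ins x st)) < nonzero_count (snd st)"
      using nonzero_count_ins[of "snd st" "fst x" "snd x" "fst st"] False by simp
    then show ?thesis using nonzero_count_fold_le[of xs "ins x st"] by simp
  qed
qed simp

text \<open>Every selected element is paid for by a vector of \<open>K\<close> that turns to zero.
  This bounds the number of selections by the initial length of \<open>K\<close>.\<close>

lemma length_fold_ins:
  "length (fst (fold ins xs st)) + nonzero_count (snd (fold ins xs st)) \<le>
    length (fst st) + nonzero_count (snd st)"
proof (induction xs arbitrary: st)
  case (Cons x xs)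
  have "length (fst (ins x st)) + nonzero_count (snd (ins x st)) \<le> length (fst st) + nonzero_count (snd st)"
  proof (cases "annihilates (snd st) (fst x)")
    case False
    obtain v p S K where x: "x = (v, p)" and st: "st = (S, K)" by (metis surj_pair)
    have v: "\<not> annihilates K v" using False by (simp add: x st)
    obtain k0 where "k0 \<in> set K" "dot v k0 \<noteq> 0" and i: "ins (v, p) (S, K) =
        (p # S, map (\<lambda>k. axmy (dot v k / dot v k0) k k0) K)"
      using ins_not_annihilates[OF v] .
    show ?thesis
      using nonzero_count_ins[OF v, of p S] by (simp add: x st i del: ins.simps)
  qed (simp add: ins_annihilates)
  then show ?case using Cons[of "ins x st"] by simp
qed simp

lemma nonzero_count_le: "nonzero_count K \<le> length K"
  by (simp add: nonzero_count_def)

lemma length_fold_ins_idm: "length (fst (fold ins xs ([], idm n))) \<le> n"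
  using length_fold_ins[of xs "([], idm n)"] nonzero_count_le[of "idm n"] by simp

lemma set_fold_ins: "set (fst (fold ins xs st)) \<subseteq> set (fst st) \<union> snd ` set xs"
proof (induction xs arbitrary: st)
  case (Cons x xs)
  have "set (fst (ins x st)) \<subseteq> set (fst st) \<union> {snd x}"
    by (cases x; cases st) (auto split: list.splits)
  then show ?case using Cons[of "ins x st"] by auto
qed simp

lemma ins_shape_idm: "ins_shape n n (S, idm n)"
  by (simp add: ins_shape_def length_idm_row)

section \<open>Batched insertion by matrix multiplication\<close>

text \<open>\<open>r\<close> is the number of free places in the buffer. The specification inserts
  every full batch; the program may skip an annihilated one, because its insertion would not change
  the state.\<close>

fun batch_step :: "nat \<Rightarrow> complex list \<times> 'p \<Rightarrow>
    (complex list \<times> 'p) list \<times> nat \<times> 'p list \<times> complex list list \<Rightarrow>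
    (complex list \<times> 'p) list \<times> nat \<times> 'p list \<times> complex list list" where
  "batch_step d x (buf, r, st) =
     (if r \<le> 1 then ([], d, fold ins (buf @ [x]) st) else (buf @ [x], r - 1, st))"

fun enc_batch :: "('p \<Rightarrow> tree) \<Rightarrow> (complex list \<times> 'p) list \<times> nat \<times> 'p list \<times> complex list list \<Rightarrow> tree" where
  "enc_batch ep (buf, r, st) =
     Node (enc_list (map (enc_elem ep) buf)) (Node (enc_nat r) (enc_state ep st))"

fun batch_inv :: "nat \<Rightarrow> (complex list \<times> 'p) list \<times> nat \<times> 'p list \<times> complex list list \<Rightarrow> bool" where
  "batch_inv d (buf, r, st) \<longleftrightarrow>
     1 \<le> r \<and> length buf + r = d \<and> (\<forall>y \<in> set buf. length (fst y) = d) \<and> ins_shape d d st"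

lemma batch_inv_step: "batch_inv d acc \<Longrightarrow> length (fst x) = d \<Longrightarrow> batch_inv d (batch_step d x acc)"
proof (cases acc)
  case (fields buf r S K)
  assume "batch_inv d acc" "length (fst x) = d"
  then show ?thesis unfolding fields
    using ins_shape_fold[of d d "(S, K)" buf] ins_shape_ins[of d d "fold ins buf (S, K)" x] by auto
qed

lemma batch_inv_fold:
  "batch_inv d acc \<Longrightarrow> (\<And>x. x \<in> set xs \<Longrightarrow> length (fst x) = d) \<Longrightarrow>
    batch_inv d (fold (batch_step d) xs acc)"
proof (induction xs arbitrary: acc)
  case (Cons x xs)
  have "batch_inv d (batch_step d x acc)"
    by (rule batch_inv_step) (use Cons.prems in auto)
  then show ?case using Cons by (simp del: batch_step.simps)
qed simp

text \<open>Batching delays insertions but keeps their order; what remains in the buffer at the end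
  still has to be inserted.\<close>

lemma fold_batch_step:
  assumes "fold (batch_step d) xs (buf, r, st) = (buf', r', st')"
  shows "fold ins buf' st' = fold ins (buf @ xs) st"
  using assms
proof (induction xs arbitrary: buf r st)
  case (Cons x xs)
  then show ?case by (cases "r \<le> 1") fastforce+
qed simp

text \<open>\<open>M\<close> takes natural numbers as values so that it can enter the bounds of
  \<open>ev\<close>; it will be C n^\<omega> rounded down.\<close>

locale matmul_program =
  fixes P\<^sub>0 :: prog and M :: "nat \<Rightarrow> nat"
  assumes ev_P0: "\<And>n A B. n \<ge> 1 \<Longrightarrow> A \<in> carrier_mat n n \<Longrightarrow> B \<in> carrier_mat n n \<Longrightarrow>
    ev P\<^sub>0 (Node (enc_nat n) (Node (enc_mat A) (enc_mat B))) (M n) (enc_mat (A * B))"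
begin

definition Check :: "prog \<Rightarrow> prog \<Rightarrow> prog \<Rightarrow> prog" where
  "Check d X K = Nonzero_Entries (Seq (Fork d (Fork X (Transp K d))) P\<^sub>0)"

lemma ev_Check:
  assumes "ev n s 0 (enc_nat d)" and "ev x s 0 (enc_rows X)" and "ev k s 0 (enc_rows K)"
    and X: "length X = d" "\<And>x. x \<in> set X \<Longrightarrow> length x = d"
    and K: "length K = d" "\<And>k. k \<in> set K \<Longrightarrow> length k = d"
    and "d \<ge> 1"
  shows "\<exists>zs. (zs = [] \<longleftrightarrow> (\<forall>x \<in> set X. annihilates K x)) \<and>
    ev (Check n x k) s (M d + d * d) (enc_list zs)"
proof -
  have "set (transpose_rows d K) \<subseteq> {r. length r = d}" "length (transpose_rows d K) = d"
    using K by (auto simp: transpose_rows_eq)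
  then have tr: "enc_mat (mat_of_rows_list d (transpose_rows d K)) = enc_rows (transpose_rows d K)"
    "mat_of_rows_list d (transpose_rows d K) \<in> carrier_mat d d"
    using enc_mat_rows[of "transpose_rows d K" d d] by (auto simp: mat_of_rows_list_def)
  have "ev (Seq (Fork n (Fork x (Transp k n))) P\<^sub>0) s (0 + (0 + (0 + 0)) + M d)
      (enc_mat (mat_of_rows_list d X * mat_of_rows_list d (transpose_rows d K)))"
  proof (rule ev_Seq)
    show "ev (Fork n (Fork x (Transp k n))) s (0 + (0 + (0 + 0)))
      (Node (enc_nat d) (Node (enc_mat (mat_of_rows_list d X)) (enc_mat (mat_of_rows_list d (transpose_rows d K)))))"
      unfolding tr(1) using ev_Fork[OF assms(1) ev_Fork[OF assms(2) ev_Transp[OF assms(3,1)]]]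
      by (simp add: enc_mat_rows[OF X])
  qed (rule ev_P0, use assms tr in \<open>auto simp: mat_of_rows_list_def\<close>)
  then have "ev (Seq (Fork n (Fork x (Transp k n))) P\<^sub>0) s (M d) (enc_rows (map (\<lambda>x. map (dot x) K) X))"
    by (simp add: enc_mat_mult_transp[OF X K])
  moreover have "length r = d" if "r \<in> set (map (\<lambda>x. map (dot x) K) X)" for r
    using that K(1) by auto
  ultimately have "\<exists>zs. (zs = [] \<longleftrightarrow> (\<forall>r \<in> set (map (\<lambda>x. map (dot x) K) X). \<forall>z \<in> set r. z = 0)) \<and>
      ev (Check n x k) s (M d + length (map (\<lambda>x. map (dot x) K) X) * d) (enc_list zs)"
    unfolding Check_def by (rule ev_Nonzero_Entries)
  then show ?thesis
    by (simp add: X(1) annihilates_def)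
qed

text \<open>Below the two bindings, index 0 is \<open>r - 1\<close>, index 1 the extended buffer,
  index 3 the old state and index 4 the size \<open>d\<close>.\<close>

definition Batch :: prog where
  "Batch = Let_in (Append (fst_of (arg 1)) (Fork (arg 0) Make_Tip))
     (Let_in (snd_of (fst_of (snd_of (arg 2))))
       (If_Node (arg 0)
         (Fork (arg 1) (Fork (arg 0) (snd_of (snd_of (arg 3)))))
         (Fork Make_Tip (Fork (arg 4)
           (If_Node (Check (arg 4) (Map (arg 1) (fst_of (arg 0))) (snd_of (snd_of (snd_of (arg 3)))))
              (Fold (arg 1) (snd_of (snd_of (arg 3))) Ins)
              (snd_of (snd_of (arg 3))))))))"

fun batch_cost :: "nat \<Rightarrow> complex list \<times> 'p \<Rightarrow>
    (complex list \<times> 'p) list \<times> nat \<times> 'p list \<times> complex list list \<Rightarrow> nat" where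
  "batch_cost d x (buf, r, st) =
     (if r \<le> 1 then M d + d * d +
        (if \<forall>y \<in> set (buf @ [x]). annihilates (snd st) (fst y) then 0 else d * ins_cost d d)
      else 0)"

lemma ev_Batch:
  assumes inv: "batch_inv d acc" and x: "length (fst x) = d"
  shows "ev Batch (Node (enc_elem ep x) (Node (enc_batch ep acc) (Node (enc_nat d) s)))
    (batch_cost d x acc) (enc_batch ep (batch_step d x acc))"
proof -
  let ?p = "Check (arg 4) (Map (arg 1) (fst_of (arg 0))) (snd_of (snd_of (snd_of (arg 3))))"
  obtain buf r S K where acc: "acc = (buf, r, S, K)" by (cases acc)
  let ?st = "(S, K)"
  let ?b = "buf @ [x]"
  obtain r' where r: "r = Suc r'" and len: "length buf + r = d"
    and buf: "\<And>y. y \<in> set ?b \<Longrightarrow> length (fst y) = d" and sh: "ins_shape d d ?st"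
    using inv x unfolding acc by (cases r) auto
  let ?s = "Node (enc_elem ep x) (Node (Node (enc_list (map (enc_elem ep) buf))
     (Node (Node Tip (enc_nat r')) (Node (enc_list (map ep S)) (enc_rows K)))) (Node (enc_nat d) s))"
  let ?s1 = "Node (enc_list (map (enc_elem ep) ?b)) ?s"
  let ?s2 = "Node (enc_nat r') ?s1"
  let ?I = "If_Node ?p
              (Fold (arg 1) (snd_of (snd_of (arg 3))) Ins)
              (snd_of (snd_of (arg 3)))"
  let ?J = "If_Node (arg 0)
         (Fork (arg 1) (Fork (arg 0) (snd_of (snd_of (arg 3)))))
         (Fork Make_Tip (Fork (arg 4) ?I))"
  have s: "ev (snd_of (snd_of (arg 3))) ?s2 0 (enc_state ep ?st)"
    unfolding enc_state.simps by (rule ev_basic)+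
  have K: "length K = d" "\<And>k. k \<in> set K \<Longrightarrow> length k = d"
    using sh by (auto simp: ins_shape_def)
  have J: "ev ?J ?s2 (batch_cost d x acc) (enc_batch ep (batch_step d x acc))"
  proof (cases r')
    case (Suc r'')
    have a0: "ev (arg 0) ?s2 0 (Node Tip (enc_nat r''))"
      using ev_args(1) by (simp add: Suc enc_nat_def)
    have "ev ?J ?s2 (0 + (0 + (0 + 0))) (Node (enc_list (map (enc_elem ep) ?b)) (Node (enc_nat r') (enc_state ep ?st)))"
      by (rule ev_If_true[OF a0] ev_Fork s ev_args)+
    then show ?thesis using Suc r by (simp add: acc)
  next
    case 0
    have a0: "ev (arg 0) ?s2 0 Tip"
      using ev_args(1) by (simp add: 0 enc_nat_def)
    have "ev (Map (arg 1) (fst_of (arg 0))) ?s2 0 (enc_list (map (\<lambda>y. enc_vec (fst y)) ?b))"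
    proof (rule ev_Map_free[OF ev_args(2)])
      fix y :: "complex list \<times> 'a"
      show "ev (fst_of (arg 0)) (Node (enc_elem ep y) ?s2) 0 (enc_vec (fst y))"
        by (cases y) (auto intro: ev_fst ev_args)
    qed
    then have X: "ev (Map (arg 1) (fst_of (arg 0))) ?s2 0 (enc_rows (map fst ?b))"
      by (simp add: comp_def)
    have "\<exists>zs. (zs = [] \<longleftrightarrow> (\<forall>x \<in> set (map fst ?b). annihilates K x)) \<and>
      ev ?p ?s2 (M d + d * d) (enc_list zs)"
    proof (rule ev_Check[OF ev_args(5) X])
      show "ev (snd_of (snd_of (snd_of (arg 3)))) ?s2 0 (enc_rows K)"
        by (rule ev_basic)+
      show "length v = d" if "v \<in> set (map fst ?b)" for v
      proof -
        from that obtain y where "v = fst y" "y \<in> set ?b" unfolding set_map by (rule imageE)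
        then show ?thesis using buf by blast
      qed
    qed (use K len r 0 in simp_all)
    then obtain zs where zs: "zs = [] \<longleftrightarrow> (\<forall>y \<in> set ?b. annihilates K (fst y))"
      and ch: "ev ?p ?s2
        (M d + d * d) (enc_list zs)" by auto
    have "ev ?I ?s2 (batch_cost d x acc) (enc_state ep (fold ins ?b ?st))"
    proof (cases "zs = []")
      case True
      have "ev ?I ?s2 (M d + d * d + 0) (enc_state ep ?st)"
        by (rule ev_If_false[OF _ s]) (use ch True in simp)
      then show ?thesis
        using True zs r 0 fold_ins_annihilates[of ?b ?st] by (simp add: acc)
    next
      case False
      then obtain z zs' where z: "zs = z # zs'" by (cases zs) auto
      have "ev ?I ?s2 (M d + d * d + (0 + 0 + length ?b * ins_cost d d)) (enc_state ep (fold ins ?b ?st))"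
      proof (rule ev_If_true)
        show "ev (Fold (arg 1) (snd_of (snd_of (arg 3))) Ins) ?s2 (0 + 0 + length ?b * ins_cost d d)
          (enc_state ep (fold ins ?b ?st))"
          by (rule ev_Fold_Ins[OF ev_args(2) s sh buf])
      qed (use ch z in simp)
      moreover have "length ?b = d" using len r 0 by simp
      moreover have "batch_cost d x acc = M d + d * d + d * ins_cost d d"
        using False zs r 0 by (auto simp: acc)
      ultimately show ?thesis
        by (simp only: add_0)
    qed
    then have "ev ?J ?s2 (0 + (0 + (0 + batch_cost d x acc))) (Node Tip (Node (enc_nat d) (enc_state ep (fold ins ?b ?st))))"
      by (intro ev_If_false[OF a0] ev_Fork ev_Tip ev_args)
    then show ?thesis using 0 r by (simp add: acc)
  qed
  have "ev Batch ?s (0 + (0 + 0) + (0 + batch_cost d x acc)) (enc_batch ep (batch_step d x acc))"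
    unfolding Batch_def
  proof (rule ev_Let)
    show "ev (Append (fst_of (arg 1)) (Fork (arg 0) Make_Tip)) ?s (0 + (0 + 0))
      (enc_list (map (enc_elem ep) buf @ [enc_elem ep x]))"
    proof (rule ev_Append)
      show "ev (fst_of (arg 1)) ?s 0 (enc_list (map (enc_elem ep) buf))" by (rule ev_basic)+
      show "ev (Fork (arg 0) Make_Tip) ?s (0 + 0) (enc_list [enc_elem ep x])"
        unfolding enc_list.simps by (rule ev_basic)+
    qed
    show "ev (Let_in (snd_of (fst_of (snd_of (arg 2)))) ?J)
      (Node (enc_list (map (enc_elem ep) buf @ [enc_elem ep x])) ?s)
      (0 + batch_cost d x acc) (enc_batch ep (batch_step d x acc))"
      by (rule ev_Let, (rule ev_basic)+) (use J in simp)
  qed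
  then show ?thesis
    by (simp add: acc r enc_nat_def)
qed

text \<open>The quotient counts the full batches, \<open>d - r\<close> being the number of elements
  already buffered. Each elimination is paid for by a drop of \<open>nonzero_count\<close>, since
  some element of its batch is not annihilated.\<close>

lemma fold_cost_batch:
  assumes "1 \<le> r" "r \<le> d"
  shows "fold_cost (batch_cost d) (batch_step d) xs (buf, r, st) \<le>
    ((d - r + length xs) div d) * (M d + d * d) + nonzero_count (snd st) * (d * ins_cost d d)"
  using assms
proof (induction xs arbitrary: buf r st)
  case (Cons x xs)
  show ?case
  proof (cases "r = 1")
    case False
    then have "d - (r - 1) + length xs = d - r + length (x # xs)" using Cons.prems by simp
    then show ?thesis
      using Cons.IH[of "r - 1" "buf @ [x]" st] Cons.prems False by simp
  next
    case True
    let ?st = "fold ins (buf @ [x]) st"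
    let ?D = "d * ins_cost d d"
    define q where "q = (length xs) div d"
    have q: "(d - r + length (x # xs)) div d = q + 1"
      using Cons.prems True by (simp add: q_def)
    have IH: "fold_cost (batch_cost d) (batch_step d) xs ([], d, ?st) \<le>
      q * (M d + d * d) + nonzero_count (snd ?st) * ?D"
      using Cons.IH[of d "[]" ?st] Cons.prems by (simp add: q_def)
    have c: "(if \<forall>y \<in> set (buf @ [x]). annihilates (snd st) (fst y) then 0 else ?D) +
        nonzero_count (snd ?st) * ?D \<le> nonzero_count (snd st) * ?D"
    proof (cases "\<forall>y \<in> set (buf @ [x]). annihilates (snd st) (fst y)")
      case True
      then show ?thesis using fold_ins_annihilates[of "buf @ [x]" st] by simp
    next
      case False
      have "Suc (nonzero_count (snd ?st)) * ?D \<le> nonzero_count (snd st) * ?D"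
        using nonzero_count_fold[OF False] by (intro mult_right_mono) auto
      moreover have "(if \<forall>y \<in> set (buf @ [x]). annihilates (snd st) (fst y) then 0 else ?D) = ?D"
        using False by (rule if_not_P)
      ultimately show ?thesis by simp
    qed
    have "fold_cost (batch_cost d) (batch_step d) (x # xs) (buf, r, st) =
      M d + d * d + (if \<forall>y \<in> set (buf @ [x]). annihilates (snd st) (fst y) then 0 else ?D) +
      fold_cost (batch_cost d) (batch_step d) xs ([], d, ?st)"
      using True by simp
    also have "\<dots> \<le> M d + d * d + (if \<forall>y \<in> set (buf @ [x]). annihilates (snd st) (fst y) then 0 else ?D) +
      (q * (M d + d * d) + nonzero_count (snd ?st) * ?D)"
      by (rule add_left_mono[OF IH])
    also have "\<dots> = (q + 1) * (M d + d * d) +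
      ((if \<forall>y \<in> set (buf @ [x]). annihilates (snd st) (fst y) then 0 else ?D) + nonzero_count (snd ?st) * ?D)"
      by (simp only: distrib_right mult_1 ac_simps)
    also have "\<dots> \<le> (q + 1) * (M d + d * d) + nonzero_count (snd st) * ?D"
      by (rule add_left_mono[OF c])
    finally show ?thesis unfolding q .
  qed
qed simp

definition Stage1 :: "prog \<Rightarrow> prog" where
  "Stage1 h = Let_in
     (Fold h (Fork Make_Tip (Fork (arg 0) (Fork Make_Tip (Idm (arg 0))))) Batch)
     (fst_of (Fold (fst_of (arg 0)) (snd_of (snd_of (arg 0))) Ins))"

text \<open>In the factor \<open>d + 1\<close>, \<open>d\<close> bounds the batches that are
  eliminated, because the potential starts at most at \<open>d\<close>, and 1 accounts for the
  leftover buffer.\<close>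

lemma ev_Stage1:
  assumes h: "ev h (Node (enc_nat d) s) 0 (enc_list (map (enc_elem ep) xs))"
    and xs: "\<And>x. x \<in> set xs \<Longrightarrow> length (fst x) = d" and d: "d \<ge> 1"
  shows "ev (Stage1 h) (Node (enc_nat d) s)
    ((length xs div d) * (M d + d * d) + (d + 1) * (d * ins_cost d d))
    (enc_list (map ep (fst (fold ins xs ([], idm d)))))"
proof -
  let ?s = "Node (enc_nat d) s"
  let ?acc = "([], d, [], idm d)"
  let ?c = "fold_cost (batch_cost d) (batch_step d) xs ?acc"
  have inv0: "batch_inv d ?acc" using d ins_shape_idm by auto
  have f: "ev (Fold h (Fork Make_Tip (Fork (arg 0) (Fork Make_Tip (Idm (arg 0))))) Batch) ?s
     (0 + (0 + (0 + (0 + 0))) + ?c) (enc_batch ep (fold (batch_step d) xs ?acc))"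
  proof (rule ev_Fold_cost[OF h])
    show "ev (Fork Make_Tip (Fork (arg 0) (Fork Make_Tip (Idm (arg 0))))) ?s (0 + (0 + (0 + 0))) (enc_batch ep ?acc)"
      unfolding enc_batch.simps enc_state.simps list.map enc_list.simps by (rule ev_Idm ev_basic)+
    show "batch_inv d ?acc" by (rule inv0)
    show "ev Batch (Node (enc_elem ep x) (Node (enc_batch ep acc) ?s)) (batch_cost d x acc)
        (enc_batch ep (batch_step d x acc)) \<and> batch_inv d (batch_step d x acc)"
      if "x \<in> set xs" "batch_inv d acc" for x acc
      using ev_Batch[OF that(2)] batch_inv_step[OF that(2)] xs[OF that(1)] by blast
  qed
  obtain buf r S K where res: "fold (batch_step d) xs ?acc = (buf, r, S, K)"
    by (metis surj_pair)
  have "batch_inv d (fold (batch_step d) xs ?acc)"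
    using inv0 xs by (rule batch_inv_fold)
  then have inv: "length buf \<le> d" "\<And>y. y \<in> set buf \<Longrightarrow> length (fst y) = d" "ins_shape d d (S, K)"
    unfolding res by auto
  let ?e = "Node (enc_list (map (enc_elem ep) buf)) (Node (enc_nat r) (enc_state ep (S, K)))"
  have g: "ev (Fold (fst_of (arg 0)) (snd_of (snd_of (arg 0))) Ins) (Node ?e ?s)
      (0 + 0 + length buf * ins_cost d d) (enc_state ep (fold ins buf (S, K)))"
  proof (rule ev_Fold_Ins[OF _ _ inv(3,2)])
    show "ev (fst_of (arg 0)) (Node ?e ?s) 0 (enc_list (map (enc_elem ep) buf))"
      by (rule ev_basic)+
    show "ev (snd_of (snd_of (arg 0))) (Node ?e ?s) 0 (enc_state ep (S, K))"
      by (rule ev_basic)+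
  qed
  obtain S' K' where res': "fold ins buf (S, K) = (S', K')" by force
  have r: "fold ins xs ([], idm d) = (S', K')"
    using fold_batch_step[OF res] res' by simp
  have "ev (Stage1 h) ?s ((0 + (0 + (0 + (0 + 0))) + ?c) + (0 + 0 + length buf * ins_cost d d))
     (enc_list (map ep S'))"
    unfolding Stage1_def
    by (rule ev_Let[OF f], rule ev_fst, unfold res enc_batch.simps)
      (use g in \<open>simp add: res'\<close>)
  moreover have "?c \<le> (length xs div d) * (M d + d * d) + d * (d * ins_cost d d)"
  proof -
    have "nonzero_count (idm d) * (d * ins_cost d d) \<le> d * (d * ins_cost d d)"
      using nonzero_count_le[of "idm d"] by (intro mult_right_mono) auto
    then show ?thesis
      using fold_cost_batch[OF d le_refl, of xs "[]" "([], idm d)"]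
      unfolding snd_conv diff_self_eq_0 add_0 by linarith
  qed
  moreover have "length buf * ins_cost d d \<le> d * ins_cost d d"
    using inv(1) by (intro mult_right_mono) auto
  ultimately have "ev (Stage1 h) ?s
      ((length xs div d) * (M d + d * d) + (d + 1) * (d * ins_cost d d)) (enc_list (map ep S'))"
    unfolding distrib_right[of d 1] mult_1 add_0 by (elim ev_mono) linarith
  then show ?thesis by (simp add: r)
qed

end

section \<open>The iterated images\<close>

definition mv :: "complex list list \<Rightarrow> complex list \<Rightarrow> complex list" where
  "mv A x = map (\<lambda>r. dot r x) A"

text \<open>Each image is paired with itself: \<open>ins\<close> returns second components, and here
  the selected object is the vector itself.\<close>

definition images :: "complex list list list \<Rightarrow> complex list list \<Rightarrow> (complex list \<times> complex list) list" where
  "images S X = concat (map (\<lambda>A. map (\<lambda>x. (mv A x, mv A x)) X) S)"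

definition next_images :: "nat \<Rightarrow> complex list list list \<Rightarrow> complex list list \<Rightarrow> complex list list" where
  "next_images n S X = fst (fold ins (images S X) ([], idm n))"

definition sq_rows :: "nat \<Rightarrow> complex list list \<Rightarrow> bool" where
  "sq_rows n A \<longleftrightarrow> length A = n \<and> (\<forall>r \<in> set A. length r = n)"

text \<open>The outer fold runs over the unary number \<open>n\<close> and ignores its elements, so
  it is a loop of \<open>n\<close> rounds.\<close>

definition Stage2 :: prog where
  "Stage2 = Fold (arg 1) (Idm (arg 1))
     (fst_of (Fold
        (Concat_Map (arg 2) (Map (arg 2)
          (Let_in (Map (arg 1) (Dot (arg 0) (arg 1))) (Fork (arg 0) (arg 0)))))
        (Fork Make_Tip (Idm (arg 3))) Ins))"

lemma length_images: "length (images S X) = length S * length X"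
  unfolding images_def by (induction S) auto

lemma set_images: "set (images S X) = {(mv A x, mv A x) | A x. A \<in> set S \<and> x \<in> set X}"
  unfolding images_def by auto

lemma next_images_shape:
  assumes "\<And>A. A \<in> set S \<Longrightarrow> sq_rows n A"
  shows "length (next_images n S X) \<le> n" and "x \<in> set (next_images n S X) \<Longrightarrow> length x = n"
proof -
  show "length (next_images n S X) \<le> n"
    unfolding next_images_def by (rule length_fold_ins_idm)
  assume "x \<in> set (next_images n S X)"
  then have "x \<in> snd ` set (images S X)"
    unfolding next_images_def using set_fold_ins by fastforce
  then show "length x = n"
    using assms by (auto simp: set_images mv_def sq_rows_def)
qed

text \<open>In each of the \<open>n\<close> rounds there are at most \<open>k * n\<close>
  matrix-vector products of \<open>2 * n * n\<close> operations, and as many insertions into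
  \<open>n\<close> vectors of length \<open>n\<close>.\<close>

definition stage2_cost :: "nat \<Rightarrow> nat \<Rightarrow> nat" where
  "stage2_cost k n = n * (k * (n * (n * (2 * n))) + k * n * ins_cost n n)"

lemma ev_Stage2:
  assumes S: "\<And>A. A \<in> set S \<Longrightarrow> sq_rows n A" and "length S \<le> k"
  shows "ev Stage2 (Node (enc_list (map enc_rows S)) (Node (enc_nat n) s)) (stage2_cost k n)
    (enc_rows ((next_images n S ^^ n) (idm n)))"
proof -
  let ?p = "Fork Make_Tip (Idm (arg 3))"
  let ?q = "Map (arg 1) (Dot (arg 0) (arg 1))"
  let ?s = "Node (enc_list (map enc_rows S)) (Node (enc_nat n) s)"
  let ?c = "k * (n * (n * (2 * n))) + k * n * ins_cost n n"
  have "ev Stage2 ?s (0 + 0 + length (replicate n Tip) * ?c)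
      (enc_rows (fold (\<lambda>_. next_images n S) (replicate n Tip) (idm n)))"
    unfolding Stage2_def
  proof (rule ev_Fold[where e = "\<lambda>x. x" and I = "\<lambda>X. length X \<le> n \<and> (\<forall>x \<in> set X. length x = n)"])
    show "ev (arg 1) ?s 0 (enc_list (map (\<lambda>x. x) (replicate n Tip)))"
      using ev_args(2) by (simp add: enc_nat_def)
    show "ev (Idm (arg 1)) ?s 0 (enc_rows (idm n))" by (rule ev_Idm ev_args)+
    show "length (idm n) \<le> n \<and> (\<forall>x \<in> set (idm n). length x = n)"
      by (simp add: length_idm_row)
    fix t :: tree and X :: "complex list list"
    assume X: "length X \<le> n \<and> (\<forall>x \<in> set X. length x = n)"
    let ?s' = "Node t (Node (enc_rows X) ?s)"
    let ?m = "Map (arg 2) (Let_in ?q (Fork (arg 0) (arg 0)))"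
    have l: "ev (Concat_Map (arg 2) ?m) ?s' (0 + length S * (n * (n * (2 * n))))
        (enc_list (concat (map (\<lambda>A. map (\<lambda>x. Node (enc_vec (mv A x)) (enc_vec (mv A x))) X) S)))"
    proof (rule ev_Concat_Map[OF ev_args(3)])
      fix A assume A: "A \<in> set S"
      have "ev ?m (Node (enc_rows A) ?s') (0 + length X * (n * (2 * n)))
          (enc_list (map (\<lambda>x. Node (enc_vec (mv A x)) (enc_vec (mv A x))) X))"
      proof (rule ev_Map[OF ev_args(3)])
        fix x
        let ?s'' = "Node (enc_vec x) (Node (enc_rows A) ?s')"
        have "ev ?q ?s'' (0 + length A * (2 * n))
            (enc_list (map (\<lambda>r. Num (dot r x)) A))"
        proof (rule ev_Map[OF ev_args(2)])
          fix r assume "r \<in> set A"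
          have "ev (Dot (arg 0) (arg 1)) (Node (enc_vec r) ?s'') (0 + 0 + 2 * length r) (Num (dot r x))"
            by (rule ev_Dot ev_args)+
          then show "ev (Dot (arg 0) (arg 1)) (Node (enc_vec r) ?s'') (2 * n) (Num (dot r x))"
            using S[OF A] \<open>r \<in> set A\<close> by (simp add: sq_rows_def)
        qed
        then have "ev ?q ?s'' (n * (2 * n)) (enc_vec (mv A x))"
          using S[OF A] by (simp add: sq_rows_def mv_def comp_def)
        from ev_Let[OF this ev_Fork_free[OF ev_args(1) ev_args(1)]]
        show "ev (Let_in ?q (Fork (arg 0) (arg 0))) ?s'' (n * (2 * n))
            (Node (enc_vec (mv A x)) (enc_vec (mv A x)))" by simp
      qed
      moreover have "length X * (n * (2 * n)) \<le> n * (n * (2 * n))"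
        using X by (intro mult_right_mono) auto
      ultimately show "ev ?m (Node (enc_rows A) ?s') (n * (n * (2 * n)))
          (enc_list (map (\<lambda>x. Node (enc_vec (mv A x)) (enc_vec (mv A x))) X))"
        by (elim ev_mono) simp
    qed
    have "concat (map (\<lambda>A. map (\<lambda>x. Node (enc_vec (mv A x)) (enc_vec (mv A x))) X) S) =
        map (enc_elem enc_vec) (images S X)"
      unfolding images_def by (simp add: map_concat comp_def)
    with l have l: "ev (Concat_Map (arg 2) ?m) ?s' (length S * (n * (n * (2 * n))))
        (enc_list (map (enc_elem enc_vec) (images S X)))" by simp
    obtain S' K' where r: "fold ins (images S X) ([], idm n) = (S', K')" by force
    have "ev (fst_of (Fold (Concat_Map (arg 2) ?m) ?p Ins)) ?s'
      (length S * (n * (n * (2 * n))) + (0 + 0) + length (images S X) * ins_cost n n)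
      (enc_rows S')"
    proof (rule ev_fst)
      have "ev (Fold (Concat_Map (arg 2) ?m) ?p Ins) ?s'
        (length S * (n * (n * (2 * n))) + (0 + 0) + length (images S X) * ins_cost n n)
        (enc_state enc_vec (fold ins (images S X) ([], idm n)))"
      proof (rule ev_Fold_Ins[OF l])
        show "ev ?p ?s' (0 + 0) (enc_state enc_vec ([], idm n))"
          unfolding enc_state.simps list.map enc_list.simps by (rule ev_Fork ev_Tip ev_Idm ev_args)+
        show "length (fst y) = n" if "y \<in> set (images S X)" for y
          using that S by (auto simp: set_images mv_def sq_rows_def)
      qed (rule ins_shape_idm)
      then show "ev (Fold (Concat_Map (arg 2) ?m) ?p Ins) ?s'
        (length S * (n * (n * (2 * n))) + (0 + 0) + length (images S X) * ins_cost n n)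
        (Node (enc_rows S') (enc_rows K'))"
        by (simp add: r)
    qed
    moreover have "length S * (n * (n * (2 * n))) \<le> k * (n * (n * (2 * n)))"
      using assms(2) by (intro mult_right_mono) auto
    moreover have "length (images S X) * ins_cost n n \<le> k * n * ins_cost n n"
      unfolding length_images using assms(2) X by (intro mult_right_mono mult_mono) auto
    ultimately have "ev (fst_of (Fold (Concat_Map (arg 2) ?m) ?p Ins)) ?s' ?c
      (enc_rows S')"
      by (elim ev_mono) linarith
    then have "ev (fst_of (Fold (Concat_Map (arg 2) ?m) ?p Ins)) ?s' ?c
      (enc_rows (next_images n S X))"
      by (simp add: next_images_def r)
    then show "ev (fst_of (Fold (Concat_Map (arg 2) ?m) ?p Ins)) ?s' ?c
      (enc_rows (next_images n S X)) \<and> length (next_images n S X) \<le> n \<and>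
        (\<forall>x \<in> set (next_images n S X). length x = n)"
      using next_images_shape[OF S] by blast
  qed
  then show ?thesis by (simp add: stage2_cost_def)
qed

section \<open>Correctness of the extraction\<close>

lemma dot_commute: "dot xs ys = dot ys xs"
  unfolding dot_def by (subst zip_commute) (simp add: comp_def split_def mult.commute)

lemma dot_Nil [simp]: "dot [] ys = 0" "dot xs [] = 0"
  by (simp_all add: dot_def)

lemma dot_Cons [simp]: "dot (x # xs) (y # ys) = x * y + dot xs ys"
  by (simp add: dot_def)

lemma axmy_simps [simp]: "axmy c (x # xs) (y # ys) = (x - c * y) # axmy c xs ys" "axmy c [] ys = []"
  by (simp_all add: axmy_def)

lemma dot_axmy_right:
  "length ks = length xs \<Longrightarrow> length xs = length ys \<Longrightarrow> dot ks (axmy c xs ys) = dot ks xs - c * dot ks ys"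
  by (induction ks xs ys rule: list_induct3) (auto simp: algebra_simps)

lemma dot_axmy_left:
  "length xs = length ys \<Longrightarrow> length ks = length xs \<Longrightarrow> dot (axmy c xs ys) ks = dot xs ks - c * dot ys ks"
  using dot_axmy_right[of ks xs ys c] by (simp add: dot_commute[of _ ks])

lemma axmy_axmy: "length xs = length ys \<Longrightarrow> axmy (- c) (axmy c xs ys) ys = xs"
  by (induction xs ys rule: list_induct2) simp_all

lemma axmy_replicate: "axmy c (replicate n 0) (replicate n 0) = replicate n 0"
  by (induction n) simp_all

text \<open>Linear subspaces; the single operation x - c y covers both sums and multiples.\<close>

definition lin_closed :: "nat \<Rightarrow> complex list set \<Rightarrow> bool" where
  "lin_closed n Z \<longleftrightarrow> (\<forall>x \<in> Z. length x = n) \<and> replicate n 0 \<in> Z \<and>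
     (\<forall>x \<in> Z. \<forall>y \<in> Z. \<forall>c. axmy c x y \<in> Z)"

definition ann :: "nat \<Rightarrow> complex list list \<Rightarrow> complex list set" where
  "ann n K = {x. length x = n \<and> annihilates K x}"

lemma lin_closed_zero: "lin_closed n {replicate n 0}"
  by (simp add: lin_closed_def axmy_replicate)

lemma dot_replicate_left: "dot (replicate n 0) ys = 0"
  by (metis dot_commute dot_zero_right in_set_replicate)

lemma lin_closed_ann: "(\<And>k. k \<in> set K \<Longrightarrow> length k = n) \<Longrightarrow> lin_closed n (ann n K)"
  by (auto simp: lin_closed_def ann_def annihilates_def dot_axmy_left dot_replicate_left)

lemma ann_idm: "ann n (idm n) = {replicate n 0}"
proof (induction n)
  case 0
  then show ?case by (auto simp: ann_def annihilates_def)
next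
  case (Suc n)
  have zero: "dot xs (map (\<lambda>_. 0) ys) = 0" for xs and ys :: "complex list list"
    by (rule dot_zero_right) simp
  have "annihilates (idm (Suc n)) (x # xs) \<longleftrightarrow> x = 0 \<and> annihilates (idm n) xs" for x xs
    by (auto simp: annihilates_def zero)
  then have *: "x # xs \<in> ann (Suc n) (idm (Suc n)) \<longleftrightarrow> x # xs = replicate (Suc n) 0" for x xs
    using Suc by (auto simp: ann_def set_eq_iff simp del: idm.simps)
  have "[] \<notin> ann (Suc n) (idm (Suc n))" by (simp add: ann_def)
  show ?case
  proof (rule Set.set_eqI)
    show "u \<in> ann (Suc n) (idm (Suc n)) \<longleftrightarrow> u \<in> {replicate (Suc n) 0}" for u
      using \<open>[] \<notin> _\<close> * by (cases u) (simp_all del: idm.simps)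
  qed
qed

text \<open>Unit vectors generate the whole space: the tails of the vectors of \<open>Z\<close> with
  first entry 0 form a subspace in one dimension less, and a multiple of the first unit vector then
  supplies the first entry.\<close>

lemma lin_closed_idm:
  "lin_closed n Z \<Longrightarrow> set (idm n) \<subseteq> Z \<Longrightarrow> length x = n \<Longrightarrow> x \<in> Z"
proof (induction n arbitrary: Z x)
  case 0
  then show ?case by (simp add: lin_closed_def)
next
  case (Suc n)
  obtain a y where x: "x = a # y" and y: "length y = n" using Suc.prems(3) by (cases x) auto
  let ?Z = "{y. 0 # y \<in> Z}"
  have cl: "\<And>x y c. x \<in> Z \<Longrightarrow> y \<in> Z \<Longrightarrow> axmy c x y \<in> Z"
    using Suc.prems(1) by (simp add: lin_closed_def)
  have "lin_closed n ?Z"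
    unfolding lin_closed_def
  proof (intro conjI ballI allI; (elim CollectE)?)
    show "replicate n 0 \<in> ?Z" using Suc.prems(1) by (simp add: lin_closed_def)
    fix u assume u: "0 # u \<in> Z"
    show "length u = n" using Suc.prems(1) u by (auto simp: lin_closed_def)
    fix v c assume "0 # v \<in> Z"
    from cl[OF u this, of c] show "axmy c u v \<in> ?Z" by simp
  qed
  moreover have "set (idm n) \<subseteq> ?Z" using Suc.prems(2) by auto
  ultimately have "0 # y \<in> Z" using Suc.IH[of ?Z y] y by simp
  moreover have e: "1 # map (\<lambda>_. 0) (idm n) \<in> Z" using Suc.prems(2) by simp
  ultimately have "axmy (- a) (0 # y) (1 # map (\<lambda>_. 0) (idm n)) \<in> Z" by (rule cl)
  moreover have "axmy c y (map (\<lambda>_. 0) (idm n)) = y" for c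
    using y by (simp add: axmy_def map_replicate_const list_eq_iff_nth_eq)
  ultimately show ?case by (simp add: x)
qed

context
  fixes \<phi> :: "'p \<Rightarrow> complex list" and n :: nat
begin

text \<open>Asserted for all subspaces \<open>Z\<close>, this says that the annihilator of
  \<open>K\<close> lies in the span of the selected vectors, without speaking of spans.
  \<open>\<phi>\<close> recovers the vector from the data that is selected.\<close>

definition span_inv :: "complex list set \<Rightarrow> 'p list \<times> complex list list \<Rightarrow> bool" where
  "span_inv Z = (\<lambda>(S, K). (\<forall>p \<in> set S. \<phi> p \<in> Z) \<longrightarrow> ann n K \<subseteq> Z)"

text \<open>The first two claims say that the annihilator grows by at least \<open>v\<close>, the
  third that it does not outgrow the selected vectors. The fourth will ensure that nothing is
  selected from vectors that are all zero.\<close>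

lemma ann_ins:
  assumes sh: "ins_shape m n (S, K)" and v: "length v = n" and p: "\<phi> p = v"
    and ins: "ins (v, p) (S, K) = (S', K')"
  shows "ann n K \<subseteq> ann n K'" and "v \<in> ann n K'"
    and "\<forall>Z. lin_closed n Z \<longrightarrow> span_inv Z (S, K) \<longrightarrow> span_inv Z (S', K')"
    and "\<forall>q \<in> set S'. q \<in> set S \<or> (\<exists>z \<in> set (\<phi> q). z \<noteq> 0)"
proof -
  have len: "\<And>k. k \<in> set K \<Longrightarrow> length k = n"
    using sh by (simp add: ins_shape_def)
  have "ann n K \<subseteq> ann n K' \<and> v \<in> ann n K' \<and>
      (\<forall>Z. lin_closed n Z \<longrightarrow> span_inv Z (S, K) \<longrightarrow> span_inv Z (S', K')) \<and>
      (\<forall>q \<in> set S'. q \<in> set S \<or> (\<exists>z \<in> set (\<phi> q). z \<noteq> 0))"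
  proof (cases "annihilates K v")
    case True
    then have "S' = S" "K' = K"
      using ins_annihilates[of "(S, K)" "(v, p)"] ins by auto
    with True show ?thesis
      by (simp add: ann_def v)
  next
    case False
    obtain k0 where k0: "k0 \<in> set K" "dot v k0 \<noteq> 0"
      and ins': "ins (v, p) (S, K) = (p # S, map (\<lambda>k. axmy (dot v k / dot v k0) k k0) K)"
      using ins_not_annihilates[OF False] .
    have S': "S' = p # S" and K': "K' = map (\<lambda>k. axmy (dot v k / dot v k0) k k0) K"
      using ins' ins by auto
    have d: "dot x (axmy c k k0) = dot x k - c * dot x k0" if "length x = n" "k \<in> set K" for x k c
      using dot_axmy_right[of x k k0 c] that len k0(1) by simp
    have "ann n K \<subseteq> ann n K'"
      using k0 by (auto simp: K' ann_def annihilates_def d)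
    moreover have "v \<in> ann n K'"
      using k0 v by (auto simp: K' ann_def annihilates_def d)
    moreover have "span_inv Z (S', K')" if Z: "lin_closed n Z" and inv: "span_inv Z (S, K)" for Z
      unfolding span_inv_def
    proof (clarify)
      fix x assume Sp: "\<forall>q \<in> set S'. \<phi> q \<in> Z" and x: "x \<in> ann n K'"
      then have vZ: "v \<in> Z" and old: "ann n K \<subseteq> Z"
        using p inv by (auto simp: S' span_inv_def)
      \<comment> \<open>The multiple of \<open>v\<close> that makes x - c v orthogonal to
        \<open>k0\<close>. That \<open>x\<close> annihilates the updated vectors then means that x -
        c v annihilates all the old ones.\<close>
      let ?c = "dot x k0 / dot v k0"
      have lx: "length x = n" using x by (simp add: ann_def)
      have "dot (axmy ?c x v) k = 0" if "k \<in> set K" for k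
      proof -
        have "dot x (axmy (dot v k / dot v k0) k k0) = 0"
          using x that by (simp add: ann_def annihilates_def K')
        then have "dot x k - dot v k / dot v k0 * dot x k0 = 0"
          by (simp add: d[OF lx that])
        then show ?thesis
          using dot_axmy_left[of x v k ?c] lx v len[OF that] by (simp add: algebra_simps)
      qed
      then have "axmy ?c x v \<in> ann n K"
        using lx v by (simp add: ann_def annihilates_def)
      then have "axmy (- ?c) (axmy ?c x v) v \<in> Z"
        using old vZ Z unfolding lin_closed_def by blast
      then show "x \<in> Z" using axmy_axmy[of x v ?c] lx v by simp
    qed
    moreover have "\<exists>z \<in> set v. z \<noteq> 0"
      using k0(2) dot_zero_right[of v k0] dot_commute[of v k0] by auto
    ultimately show ?thesis
      by (auto simp: S' p)
  qed
  then show "ann n K \<subseteq> ann n K'" and "v \<in> ann n K'"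
    and "\<forall>Z. lin_closed n Z \<longrightarrow> span_inv Z (S, K) \<longrightarrow> span_inv Z (S', K')"
    and "\<forall>q \<in> set S'. q \<in> set S \<or> (\<exists>z \<in> set (\<phi> q). z \<noteq> 0)"
    by blast+
qed

lemma fold_ins_correct:
  assumes "ins_shape m n st" and "\<forall>x \<in> set xs. fst x = \<phi> (snd x) \<and> length (fst x) = n"
  shows "ann n (snd st) \<subseteq> ann n (snd (fold ins xs st)) \<and>
    (\<forall>x \<in> set xs. fst x \<in> ann n (snd (fold ins xs st))) \<and>
    (\<forall>Z. lin_closed n Z \<longrightarrow> span_inv Z st \<longrightarrow> span_inv Z (fold ins xs st)) \<and>
    (\<forall>q \<in> set (fst (fold ins xs st)). q \<in> set (fst st) \<or> (\<exists>z \<in> set (\<phi> q). z \<noteq> 0))"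
  using assms
proof (induction xs arbitrary: st)
  case (Cons y xs)
  obtain v p S K where y: "y = (v, p)" and st: "st = (S, K)" by (metis surj_pair)
  obtain S' K' where r: "ins (v, p) (S, K) = (S', K')" by force
  have sh: "ins_shape m n (S', K')"
    using ins_shape_ins[OF Cons.prems(1), of y] by (simp only: y st r)
  have v: "length v = n" "\<phi> p = v" using Cons.prems(2) by (auto simp: y)
  note a = ann_ins[OF Cons.prems(1)[unfolded st] v r]
  have f: "fold ins (y # xs) st = fold ins xs (S', K')"
    by (simp only: fold_simps y st r)
  have IH: "ann n K' \<subseteq> ann n (snd (fold ins xs (S', K')))"
    "\<forall>x \<in> set xs. fst x \<in> ann n (snd (fold ins xs (S', K')))"
    "\<forall>Z. lin_closed n Z \<longrightarrow> span_inv Z (S', K') \<longrightarrow> span_inv Z (fold ins xs (S', K'))"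
    "\<forall>q \<in> set (fst (fold ins xs (S', K'))). q \<in> set S' \<or> (\<exists>z \<in> set (\<phi> q). z \<noteq> 0)"
  proof -
    have "\<forall>x \<in> set xs. fst x = \<phi> (snd x) \<and> length (fst x) = n"
      using Cons.prems(2) by (meson list.set_intros(2))
    from Cons.IH[OF sh this] show "ann n K' \<subseteq> ann n (snd (fold ins xs (S', K')))"
      "\<forall>x \<in> set xs. fst x \<in> ann n (snd (fold ins xs (S', K')))"
      "\<forall>Z. lin_closed n Z \<longrightarrow> span_inv Z (S', K') \<longrightarrow> span_inv Z (fold ins xs (S', K'))"
      "\<forall>q \<in> set (fst (fold ins xs (S', K'))). q \<in> set S' \<or> (\<exists>z \<in> set (\<phi> q). z \<noteq> 0)"
      by simp_all
  qed
  show ?case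
    unfolding f
  proof (intro conjI)
    show "ann n (snd st) \<subseteq> ann n (snd (fold ins xs (S', K')))"
      using a(1) IH(1) by (auto simp: st)
    show "\<forall>x \<in> set (y # xs). fst x \<in> ann n (snd (fold ins xs (S', K')))"
      using a(2) IH(1,2) by (auto simp: y)
    show "\<forall>Z. lin_closed n Z \<longrightarrow> span_inv Z st \<longrightarrow> span_inv Z (fold ins xs (S', K'))"
      using a(3) IH(3) by (auto simp: st)
    show "\<forall>q \<in> set (fst (fold ins xs (S', K'))). q \<in> set (fst st) \<or> (\<exists>z \<in> set (\<phi> q). z \<noteq> 0)"
      using a(4) IH(4) by (auto simp: st)
  qed
qed simp

text \<open>The annihilator of the identity is zero, so \<open>span_inv\<close> holds initially for
  every subspace. The first two claims make the final annihilator the span of all inserted vectors,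
  generated by the selected ones.\<close>

lemma extraction_correct:
  assumes xs: "\<And>x. x \<in> set xs \<Longrightarrow> fst x = \<phi> (snd x) \<and> length (fst x) = n"
  shows "x \<in> set xs \<Longrightarrow> fst x \<in> ann n (snd (fold ins xs ([], idm n)))"
    and "lin_closed n Z \<Longrightarrow> (\<And>p. p \<in> set (fst (fold ins xs ([], idm n))) \<Longrightarrow> \<phi> p \<in> Z) \<Longrightarrow>
      ann n (snd (fold ins xs ([], idm n))) \<subseteq> Z"
    and "p \<in> set (fst (fold ins xs ([], idm n))) \<Longrightarrow> \<exists>z \<in> set (\<phi> p). z \<noteq> 0"
proof -
  have c: "\<forall>x \<in> set xs. fst x \<in> ann n (snd (fold ins xs ([], idm n)))"
    "\<forall>Z. lin_closed n Z \<longrightarrow> span_inv Z ([], idm n) \<longrightarrow> span_inv Z (fold ins xs ([], idm n))"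
    "\<forall>q \<in> set (fst (fold ins xs ([], idm n))). \<exists>z \<in> set (\<phi> q). z \<noteq> 0"
  proof -
    have "\<forall>x \<in> set xs. fst x = \<phi> (snd x) \<and> length (fst x) = n" using xs by blast
    from fold_ins_correct[OF ins_shape_idm this, of "[]"]
    show "\<forall>x \<in> set xs. fst x \<in> ann n (snd (fold ins xs ([], idm n)))"
      "\<forall>Z. lin_closed n Z \<longrightarrow> span_inv Z ([], idm n) \<longrightarrow> span_inv Z (fold ins xs ([], idm n))"
      "\<forall>q \<in> set (fst (fold ins xs ([], idm n))). \<exists>z \<in> set (\<phi> q). z \<noteq> 0"
      by simp_all
  qed
  show "x \<in> set xs \<Longrightarrow> fst x \<in> ann n (snd (fold ins xs ([], idm n)))" using c(1) by blast
  show "p \<in> set (fst (fold ins xs ([], idm n))) \<Longrightarrow> \<exists>z \<in> set (\<phi> p). z \<noteq> 0" using c(3) by blast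
  assume Z: "lin_closed n Z" and S: "\<And>p. p \<in> set (fst (fold ins xs ([], idm n))) \<Longrightarrow> \<phi> p \<in> Z"
  have "span_inv Z ([], idm n)"
    using Z by (simp add: span_inv_def ann_idm lin_closed_def)
  then have "span_inv Z (fold ins xs ([], idm n))" using c(2) Z by blast
  then show "ann n (snd (fold ins xs ([], idm n))) \<subseteq> Z"
    using S by (auto simp: span_inv_def split_def)
qed

end

section \<open>Flattened matrices and the images of words\<close>

lemma mv_axmy: "sq_rows n A \<Longrightarrow> length x = n \<Longrightarrow> length y = n \<Longrightarrow>
    mv A (axmy c x y) = axmy c (mv A x) (mv A y)"
  by (rule nth_equalityI) (auto simp: mv_def sq_rows_def dot_axmy_right axmy_def[of _ "map _ _"])

lemma mv_zero: "mv A (replicate n 0) = replicate (length A) 0"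
  by (simp add: mv_def dot_commute[of _ "replicate n 0"] dot_replicate_left map_replicate_const)

lemma length_mv [simp]: "length (mv A x) = length A"
  by (simp add: mv_def)

lemma axmy_append: "length xs = length ys \<Longrightarrow> axmy c (xs @ xs') (ys @ ys') = axmy c xs ys @ axmy c xs' ys'"
  by (simp add: axmy_def)

lemma concat_axmy:
  "length A = length B \<Longrightarrow> (\<And>r. r \<in> set A \<Longrightarrow> length r = n) \<Longrightarrow> (\<And>r. r \<in> set B \<Longrightarrow> length r = n) \<Longrightarrow>
    concat (map2 (axmy c) A B) = axmy c (concat A) (concat B)"
  by (induction A B rule: list_induct2) (simp_all add: axmy_append)

lemma mv_map2_axmy:
  "length A = length B \<Longrightarrow> (\<And>r. r \<in> set A \<Longrightarrow> length r = n) \<Longrightarrow> (\<And>r. r \<in> set B \<Longrightarrow> length r = n) \<Longrightarrow>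
    length x = n \<Longrightarrow> mv (map2 (axmy c) A B) x = axmy c (mv A x) (mv B x)"
  by (induction A B rule: list_induct2) (simp_all add: mv_def dot_axmy_left)

lemma sq_rows_map2_axmy: "sq_rows n A \<Longrightarrow> sq_rows n B \<Longrightarrow> sq_rows n (map2 (axmy c) A B)"
  unfolding sq_rows_def by (auto simp: in_set_zip)

lemma length_concat_sq_rows: "sq_rows n A \<Longrightarrow> length (concat A) = n * n"
proof -
  assume "sq_rows n A"
  then have "map length A = replicate n n" by (auto simp: sq_rows_def list_eq_iff_nth_eq)
  then show ?thesis by (simp add: length_concat sum_list_replicate)
qed

lemma concat_inj_sq_rows: "sq_rows n A \<Longrightarrow> sq_rows n B \<Longrightarrow> concat A = concat B \<Longrightarrow> A = B"
  by (rule concat_injective) (auto simp: sq_rows_def in_set_zip)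

definition spanning :: "nat \<Rightarrow> complex list list list \<Rightarrow> complex list list list" where
  "spanning n As = fst (fold ins (map (\<lambda>A. (concat A, A)) As) ([], idm (n * n)))"

definition iter_images :: "nat \<Rightarrow> complex list list list \<Rightarrow> nat \<Rightarrow> complex list list" where
  "iter_images n As k = (next_images n (spanning n As) ^^ k) (idm n)"

text \<open>If the last list is empty, the subspaces \<open>U k\<close> decide: letters of
  \<open>S\<close> map \<open>U k\<close> into \<open>U (Suc k)\<close>, this condition is linear in
  the letter and so passes to all of \<open>As\<close>, and \<open>U n\<close> is zero. Conversely,
  a vector in the last list would be the nonzero image of a unit vector under a word of length
  \<open>n\<close>.\<close>

theorem iter_images_correct:
  assumes As: "\<And>A. A \<in> set As \<Longrightarrow> sq_rows n A"
  shows "iter_images n As n = [] \<longleftrightarrow>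
    (\<forall>ws x. length ws = n \<longrightarrow> set ws \<subseteq> set As \<longrightarrow> length x = n \<longrightarrow> foldr mv ws x = replicate n 0)"
proof
  let ?X = "iter_images n As"
  define S where "S = spanning n As"
  have SA: "set S \<subseteq> set As"
    unfolding S_def spanning_def using set_fold_ins by fastforce
  then have Ssq: "\<And>A. A \<in> set S \<Longrightarrow> sq_rows n A" using As by blast
  have im: "fst x = snd x \<and> length (fst x) = n" if "x \<in> set (images S X)" for x X
    using that Ssq by (auto simp: set_images sq_rows_def)
  have X_Suc: "?X (Suc k) = fst (fold ins (images S (?X k)) ([], idm n))" for k
    by (simp add: iter_images_def next_images_def S_def)
  have X_len: "length x = n" if "x \<in> set (?X k)" for x k
  proof (cases k)
    case 0
    then show ?thesis using that by (simp add: iter_images_def length_idm_row)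
  next
    case (Suc k')
    then show ?thesis using that im set_fold_ins[of "images S (?X k')" "([], idm n)"]
      by (fastforce simp: X_Suc)
  qed
  {
    assume nil: "\<forall>ws x. length ws = n \<longrightarrow> set ws \<subseteq> set As \<longrightarrow> length x = n \<longrightarrow>
      foldr mv ws x = replicate n 0"
    have word: "\<exists>ws e. length ws = k \<and> set ws \<subseteq> set S \<and> length e = n \<and> x = foldr mv ws e"
      if "x \<in> set (?X k)" for x k
      using that
    proof (induction k arbitrary: x)
      case 0
      then show ?case
        by (intro exI[of _ "[]"] exI[of _ x]) (simp add: iter_images_def length_idm_row)
    next
      case (Suc k)
      then obtain A y where "A \<in> set S" "y \<in> set (?X k)" "x = mv A y"
        using set_fold_ins[of "images S (?X k)" "([], idm n)"] by (fastforce simp: X_Suc set_images)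
      with Suc.IH[of y] show ?case
        by (metis foldr.simps(2) comp_apply insert_subset length_Cons list.simps(15))
    qed
    show "?X n = []"
    proof (cases n)
      case (Suc n')
      show ?thesis
      proof (rule ccontr)
        assume "?X n \<noteq> []"
        then obtain x where x: "x \<in> set (?X n)" by (metis last_in_set)
        have "x \<in> set (fst (fold ins (images S (?X n')) ([], idm n)))"
          unfolding X_Suc[symmetric] Suc[symmetric] by (rule x)
        with im have "\<exists>z \<in> set x. z \<noteq> 0"
          by (rule extraction_correct(3)[of "images S (?X n')" "\<lambda>x. x" n x])
        moreover have "x = replicate n 0" using word[OF x] nil SA by (metis subset_trans)
        ultimately show False by (simp add: in_set_replicate)
      qed
    qed (simp add: iter_images_def)
  }
  assume Xn: "?X n = []"
  \<comment> \<open>The span of the \<open>k\<close>-th list, available as an annihilator except for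
    \<open>k = 0\<close>, where the list is the identity and the span is everything.\<close>
  define U where "U k = (case k of 0 \<Rightarrow> {x. length x = n}
    | Suc k' \<Rightarrow> ann n (snd (fold ins (images S (?X k')) ([], idm n))))" for k
  have U_closed: "lin_closed n (U k)" for k
  proof (cases k)
    case (Suc k')
    have "ins_shape n n (fold ins (images S (?X k')) ([], idm n))"
      by (intro ins_shape_fold ins_shape_idm)
    then show ?thesis
      unfolding U_def Suc nat.case by (intro lin_closed_ann) (auto simp: ins_shape_def split_def)
  qed (simp add: U_def lin_closed_def)
  have U_min: "U k \<subseteq> Z" if "lin_closed n Z" "set (?X k) \<subseteq> Z" for Z k
  proof (cases k)
    case 0
    then show ?thesis using that lin_closed_idm[OF that(1)] by (auto simp: U_def iter_images_def)
  next
    case (Suc k')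
    have "ann n (snd (fold ins (images S (?X k')) ([], idm n))) \<subseteq> Z"
      by (rule extraction_correct(2)[of "images S (?X k')" "\<lambda>x. x" n Z, OF im that(1)])
        (use that(2) in \<open>auto simp: Suc X_Suc\<close>)
    then show ?thesis by (simp add: U_def Suc)
  qed
  have U_len: "length u = n" if "u \<in> U k" for u k
    using U_closed[of k] that by (simp add: lin_closed_def)
  have U_S: "mv A u \<in> U (Suc k)" if A: "A \<in> set S" and u: "u \<in> U k" for A u k
  proof -
    \<comment> \<open>The vectors that \<open>A\<close> maps correctly form a subspace, so it
      suffices to find the generators of \<open>U k\<close> among them.\<close>
    let ?Z = "{u. length u = n \<and> mv A u \<in> U (Suc k)}"
    have "lin_closed n ?Z"
      using U_closed[of "Suc k"] Ssq[OF A] mv_axmy[OF Ssq[OF A]] mv_zero[of A n]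
      by (auto simp: lin_closed_def sq_rows_def)
    moreover have "set (?X k) \<subseteq> ?Z"
    proof
      fix x assume x: "x \<in> set (?X k)"
      then have "(mv A x, mv A x) \<in> set (images S (?X k))" using A by (auto simp: set_images)
      then have "mv A x \<in> U (Suc k)"
        using extraction_correct(1)[of "images S (?X k)" "\<lambda>x. x" n "(mv A x, mv A x)", OF im]
        by (simp add: U_def)
      then show "x \<in> ?Z" using X_len[OF x] by simp
    qed
    ultimately show ?thesis using U_min u by blast
  qed
  have U_As: "mv A u \<in> U (Suc k)" if A: "A \<in> set As" and u: "u \<in> U k" for A u k
  proof -
    \<comment> \<open>The same argument one level up: the matrices that map \<open>U k\<close> into
      \<open>U (Suc k)\<close> form, after flattening, a subspace that contains the selected
      matrices.\<close>
    let ?Z = "{concat B | B. sq_rows n B \<and> (\<forall>u \<in> U k. mv B u \<in> U (Suc k))}"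
    have cl: "lin_closed (n * n) ?Z"
      unfolding lin_closed_def
    proof (intro conjI ballI allI; (elim CollectE exE conjE)?)
      fix x B assume "x = concat B" "sq_rows n B"
      then show "length x = n * n" by (simp add: length_concat_sq_rows)
    next
      let ?B = "replicate n (replicate n (0::complex))"
      have "concat ?B = replicate (n * n) 0"
        using length_concat_sq_rows[of n ?B] by (intro replicate_eqI) (auto simp: sq_rows_def split: if_splits)
      moreover have "mv ?B u = replicate n 0" for u
        by (simp add: mv_def dot_replicate_left map_replicate_const)
      ultimately show "replicate (n * n) 0 \<in> ?Z"
        using U_closed[of "Suc k"] by (intro CollectI exI[of _ ?B]) (auto simp: sq_rows_def lin_closed_def)
    next
      fix x y c B C
      assume B: "x = concat B" "sq_rows n B" "\<forall>u \<in> U k. mv B u \<in> U (Suc k)"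
        and C: "y = concat C" "sq_rows n C" "\<forall>u \<in> U k. mv C u \<in> U (Suc k)"
      have "axmy c x y = concat (map2 (axmy c) B C)"
        using concat_axmy[of B C n c] B C by (simp add: sq_rows_def)
      moreover have "\<forall>u \<in> U k. mv (map2 (axmy c) B C) u \<in> U (Suc k)"
      proof
        fix u assume u: "u \<in> U k"
        have "mv (map2 (axmy c) B C) u = axmy c (mv B u) (mv C u)"
          by (rule mv_map2_axmy[where n = n]) (use B C U_len[OF u] in \<open>auto simp: sq_rows_def\<close>)
        then show "mv (map2 (axmy c) B C) u \<in> U (Suc k)"
          using B C u U_closed[of "Suc k"] by (simp add: lin_closed_def)
      qed
      ultimately show "axmy c x y \<in> ?Z"
        using sq_rows_map2_axmy[OF B(2) C(2)] by blast
    qed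
    have "concat A \<in> ?Z"
    proof -
      let ?xs = "map (\<lambda>A. (concat A, A)) As"
      have xs: "fst x = concat (snd x) \<and> length (fst x) = n * n" if "x \<in> set ?xs" for x
        using that As length_concat_sq_rows by auto
      have "(concat A, A) \<in> set ?xs" using A by auto
      from extraction_correct(1)[of ?xs concat "n * n", OF xs this]
      have "concat A \<in> ann (n * n) (snd (fold ins ?xs ([], idm (n * n))))" by simp
      moreover have "ann (n * n) (snd (fold ins ?xs ([], idm (n * n)))) \<subseteq> ?Z"
        by (rule extraction_correct(2)[of ?xs concat "n * n", OF xs cl])
          (use Ssq U_S in \<open>auto simp: S_def spanning_def\<close>)
      ultimately show ?thesis by blast
    qed
    then obtain B where "concat A = concat B" "sq_rows n B" "\<forall>u \<in> U k. mv B u \<in> U (Suc k)" by auto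
    then show ?thesis using concat_inj_sq_rows[OF As[OF A]] u by metis
  qed
  have word: "foldr mv ws x \<in> U (length ws)" if "set ws \<subseteq> set As" "length x = n" for ws x
    using that
  proof (induction ws)
    case (Cons A ws)
    then show ?case using U_As[of A "foldr mv ws x" "length ws"] by simp
  qed (simp add: U_def)
  have "U n \<subseteq> {replicate n 0}"
    using U_min[OF lin_closed_zero] Xn by simp
  then show "\<forall>ws x. length ws = n \<longrightarrow> set ws \<subseteq> set As \<longrightarrow> length x = n \<longrightarrow>
      foldr mv ws x = replicate n 0"
    using word by (metis subset_singletonD singletonD empty_iff)
qed

section \<open>Traces and nilpotency\<close>

definition mtrace :: "complex mat \<Rightarrow> complex" where
  "mtrace A = (\<Sum>i<dim_row A. A $$ (i, i))"

definition mprod :: "nat \<Rightarrow> complex mat list \<Rightarrow> complex mat" where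
  "mprod n ws = foldr (*) ws (1\<^sub>m n)"

lemma mprod_Nil [simp]: "mprod n [] = 1\<^sub>m n"
  and mprod_Cons [simp]: "mprod n (A # ws) = A * mprod n ws"
  by (simp_all add: mprod_def)

lemma mprod_carrier: "set ws \<subseteq> carrier_mat n n \<Longrightarrow> mprod n ws \<in> carrier_mat n n"
  by (induction ws) auto

lemma mprod_append:
  "set us \<subseteq> carrier_mat n n \<Longrightarrow> set ws \<subseteq> carrier_mat n n \<Longrightarrow> mprod n (us @ ws) = mprod n us * mprod n ws"
proof (induction us)
  case Nil
  then show ?case using mprod_carrier[of ws n] by simp
next
  case (Cons A us)
  then show ?case
    using assoc_mult_mat[of A n n "mprod n us" n "mprod n ws" n] mprod_carrier[of us n] mprod_carrier[of ws n]
    by simp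
qed

lemma mult_index:
  assumes "A \<in> carrier_mat n m" "B \<in> carrier_mat m l" "i < n" "j < l"
  shows "(A * B) $$ (i, j) = (\<Sum>k<m. A $$ (i, k) * B $$ (k, j))"
  using assms by (simp add: scalar_prod_def atLeast0LessThan)

lemma mprod_conjugate:
  assumes G: "G \<in> carrier_mat n n" "H \<in> carrier_mat n n" "G * H = 1\<^sub>m n" "H * G = 1\<^sub>m n"
    and ws: "set ws \<subseteq> carrier_mat n n"
  shows "mprod n (map (\<lambda>A. G * A * H) ws) = G * mprod n ws * H"
  using ws
proof (induction ws)
  case Nil
  then show ?case using G by simp
next
  case (Cons A ws)
  let ?X = "mprod n ws"
  have X: "?X \<in> carrier_mat n n" using Cons.prems mprod_carrier[of ws n] by simp
  have A: "A \<in> carrier_mat n n" using Cons.prems by simp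
  have "G * A * H * (G * ?X * H) = G * A * (H * (G * (?X * H)))"
    using G X A by (simp add: assoc_mult_mat[of _ n n _ n _ n])
  also have "H * (G * (?X * H)) = ?X * H"
    using assoc_mult_mat[OF G(2,1), of "?X * H" n] G X by simp
  also have "G * A * (?X * H) = G * (A * ?X) * H"
    using G X A by (simp add: assoc_mult_mat[of _ n n _ n _ n])
  finally show ?case using Cons by simp
qed

lemma mprod_entry_bound:
  assumes ws: "set ws \<subseteq> carrier_mat n n" and r: "0 \<le> r"
    and bd: "\<And>A p q. A \<in> set ws \<Longrightarrow> p < n \<Longrightarrow> q < n \<Longrightarrow> cmod (A $$ (p, q)) \<le> r"
    and pq: "p < n" "q < n"
  shows "cmod (mprod n ws $$ (p, q)) \<le> (real n * r) ^ length ws"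
  using ws bd pq(1)
proof (induction ws arbitrary: p)
  case Nil
  then show ?case using pq(2) by (simp add: one_mat_def)
next
  case (Cons A ws)
  have X: "mprod n ws \<in> carrier_mat n n" using Cons.prems mprod_carrier[of ws n] by simp
  have A: "A \<in> carrier_mat n n" using Cons.prems by simp
  have "cmod (mprod n (A # ws) $$ (p, q)) \<le> (\<Sum>k<n. cmod (A $$ (p, k) * mprod n ws $$ (k, q)))"
    unfolding mprod_Cons mult_index[OF A X Cons.prems(3) pq(2)] by (rule norm_sum)
  also have "\<dots> \<le> (\<Sum>k<n. r * (real n * r) ^ length ws)"
  proof (rule sum_mono)
    fix k assume k: "k \<in> {..<n}"
    have "cmod (mprod n ws $$ (k, q)) \<le> (real n * r) ^ length ws"
      using Cons.IH[of k] Cons.prems k by simp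
    then show "cmod (A $$ (p, k) * mprod n ws $$ (k, q)) \<le> r * (real n * r) ^ length ws"
      unfolding norm_mult using Cons.prems(2)[of A p k] Cons.prems(3) k r by (intro mult_mono) auto
  qed
  finally show ?case by (simp add: mult_ac)
qed

section \<open>The trace\<close>

lemma mtrace_add: "A \<in> carrier_mat n n \<Longrightarrow> B \<in> carrier_mat n n \<Longrightarrow> mtrace (A + B) = mtrace A + mtrace B"
  by (simp add: mtrace_def sum.distrib)

lemma mtrace_smult: "A \<in> carrier_mat n n \<Longrightarrow> mtrace (c \<cdot>\<^sub>m A) = c * mtrace A"
  by (simp add: mtrace_def sum_distrib_left)

lemma mtrace_mult:
  assumes "A \<in> carrier_mat n m" "B \<in> carrier_mat m n"
  shows "mtrace (A * B) = (\<Sum>i<n. \<Sum>j<m. A $$ (i, j) * B $$ (j, i))"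
  using assms by (auto simp: mtrace_def scalar_prod_def atLeast0LessThan intro!: sum.cong)

lemma mtrace_comm:
  assumes "A \<in> carrier_mat n m" "B \<in> carrier_mat m n"
  shows "mtrace (A * B) = mtrace (B * A)"
  unfolding mtrace_mult[OF assms] mtrace_mult[OF assms(2,1)]
  by (subst sum.swap) (simp add: mult.commute)

lemma mtrace_similar:
  assumes P: "P \<in> carrier_mat n n" "Q \<in> carrier_mat n n" "Q * P = 1\<^sub>m n" and B: "B \<in> carrier_mat n n"
  shows "mtrace (P * B * Q) = mtrace B"
proof -
  have "mtrace (P * B * Q) = mtrace (Q * (P * B))"
    by (rule mtrace_comm) (use P B in auto)
  also have "Q * (P * B) = B"
    using assoc_mult_mat[OF P(2,1) B] P(3) B by simp
  finally show ?thesis .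
qed

section \<open>Powers of triangular matrices and nilpotency from traces\<close>

lemma upper_triangular_pow:
  assumes B: "B \<in> carrier_mat n n" "upper_triangular B"
  shows "upper_triangular (B ^\<^sub>m k)" and "i < n \<Longrightarrow> (B ^\<^sub>m k) $$ (i, i) = (B $$ (i, i)) ^ k"
proof -
  have *: "(\<forall>i<n. \<forall>j<i. (B ^\<^sub>m k) $$ (i, j) = 0) \<and> (\<forall>i<n. (B ^\<^sub>m k) $$ (i, i) = (B $$ (i, i)) ^ k)"
  proof (induction k)
    case 0
    then show ?case using B by auto
  next
    case (Suc k)
    have C: "B ^\<^sub>m k \<in> carrier_mat n n" using B(1) by simp
    have z: "B $$ (i, j) = 0" if "j < i" "i < n" for i j using B that by auto
    have e: "(B ^\<^sub>m Suc k) $$ (i, j) = (\<Sum>l<n. (B ^\<^sub>m k) $$ (i, l) * B $$ (l, j))" if "i < n" "j < n" for i j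
      using that B C by (simp add: scalar_prod_def atLeast0LessThan)
    have "(B ^\<^sub>m Suc k) $$ (i, j) = 0" if "i < n" "j < i" for i j
    proof -
      have "(B ^\<^sub>m k) $$ (i, l) * B $$ (l, j) = 0" if "l < n" for l
        using Suc z \<open>i < n\<close> \<open>j < i\<close> that by (cases "l < i") auto
      then show ?thesis using that by (subst e) auto
    qed
    moreover have "(B ^\<^sub>m Suc k) $$ (i, i) = (B $$ (i, i)) ^ Suc k" if i: "i < n" for i
    proof -
      have "(B ^\<^sub>m k) $$ (i, l) * B $$ (l, i) = (if l = i then (B $$ (i, i)) ^ Suc k else 0)" if "l < n" for l
        using Suc z i that by (cases l i rule: linorder_cases) (auto simp: power_commutes)
      then have "(B ^\<^sub>m Suc k) $$ (i, i) = (\<Sum>l<n. if l = i then (B $$ (i, i)) ^ Suc k else 0)"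
        using i by (subst e) (auto intro: sum.cong)
      then show ?thesis using i by simp
    qed
    ultimately show ?case by blast
  qed
  then show "upper_triangular (B ^\<^sub>m k)" using B(1) by auto
  show "i < n \<Longrightarrow> (B ^\<^sub>m k) $$ (i, i) = (B $$ (i, i)) ^ k" using * by blast
qed

lemma strictly_upper_pow:
  assumes B: "B \<in> carrier_mat n n" and z: "\<And>i j. i < n \<Longrightarrow> j \<le> i \<Longrightarrow> B $$ (i, j) = 0"
  shows "B ^\<^sub>m n = 0\<^sub>m n n"
proof -
  \<comment> \<open>The support of the powers moves up by one diagonal with every factor.\<close>
  have "\<forall>i<n. \<forall>j<n. j < i + k \<longrightarrow> (B ^\<^sub>m k) $$ (i, j) = 0" for k
  proof (induction k)
    case 0
    then show ?case using B by auto
  next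
    case (Suc k)
    have C: "B ^\<^sub>m k \<in> carrier_mat n n" using B by simp
    show ?case
    proof (intro allI impI)
      fix i j assume ij: "i < n" "j < n" "j < i + Suc k"
      have "(B ^\<^sub>m Suc k) $$ (i, j) = (\<Sum>l<n. (B ^\<^sub>m k) $$ (i, l) * B $$ (l, j))"
        using ij B C by (simp add: scalar_prod_def atLeast0LessThan)
      also have "\<dots> = 0"
      proof (rule sum.neutral, rule ballI)
        fix l assume "l \<in> {..<n}"
        then show "(B ^\<^sub>m k) $$ (i, l) * B $$ (l, j) = 0"
          using Suc ij z[of l j] by (cases "l < i + k") auto
      qed
      finally show "(B ^\<^sub>m Suc k) $$ (i, j) = 0" .
    qed
  qed
  from this[of n] show ?thesis using B by (intro eq_matI) auto
qed

text \<open>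
  Testing with a polynomial that vanishes at \<open>0\<close> and at all values but \<open>\<mu>\<close> isolates the
  multiplicity of \<open>\<mu>\<close>.
\<close>

lemma power_sums_zero:
  fixes x :: "nat \<Rightarrow> complex"
  assumes "\<And>k. k \<ge> 1 \<Longrightarrow> (\<Sum>i<n. x i ^ k) = 0" and "i < n"
  shows "x i = 0"
proof (rule ccontr)
  define \<mu> where "\<mu> = x i"
  assume "x i \<noteq> 0"
  then have mu: "\<mu> \<noteq> 0" by (simp add: \<mu>_def)
  \<comment> \<open>The hypothesis says nothing about the exponent 0, whose power sum is
    \<open>n\<close>. The factor \<open>[:0, 1:]\<close> makes the constant coefficient of
    \<open>p\<close> zero, so this sum does not enter.\<close>
  define p :: "complex poly" where "p = [:0, 1:] * (\<Prod>v \<in> x ` {..<n} - {\<mu>}. [:- v, 1:])"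
  have p: "poly p z = z * (\<Prod>v \<in> x ` {..<n} - {\<mu>}. z - v)" for z
    by (simp add: p_def poly_prod)
  have "coeff p 0 = 0" using p[of 0] by (simp add: poly_0_coeff_0)
  have "(\<Sum>j<n. poly p (x j)) = (\<Sum>j<n. \<Sum>k\<le>degree p. coeff p k * x j ^ k)"
    by (simp add: poly_altdef)
  also have "\<dots> = (\<Sum>k\<le>degree p. coeff p k * (\<Sum>j<n. x j ^ k))"
    by (subst sum.swap) (simp add: sum_distrib_left)
  also have "\<dots> = 0"
  proof (rule sum.neutral, rule ballI)
    fix k
    show "coeff p k * (\<Sum>j<n. x j ^ k) = 0"
      using assms(1)[of k] \<open>coeff p 0 = 0\<close> by (cases k) auto
  qed
  finally have s: "(\<Sum>j<n. poly p (x j)) = 0" .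
  have "poly p (x j) = (if x j = \<mu> then poly p \<mu> else 0)" if "j < n" for j
    using that by (auto simp: p)
  then have "(\<Sum>j<n. poly p (x j)) = (\<Sum>j<n. if x j = \<mu> then poly p \<mu> else 0)"
    by (intro sum.cong) auto
  also have "\<dots> = of_nat (card {j \<in> {..<n}. x j = \<mu>}) * poly p \<mu>"
    by (simp add: sum.If_cases Int_def)
  finally have "of_nat (card {j \<in> {..<n}. x j = \<mu>}) * poly p \<mu> = 0" using s by simp
  moreover have "poly p \<mu> \<noteq> 0" using mu by (simp add: p)
  moreover have "i \<in> {j \<in> {..<n}. x j = \<mu>}" using assms(2) by (simp add: \<mu>_def)
  then have "card {j \<in> {..<n}. x j = \<mu>} \<noteq> 0" by (auto simp: card_eq_0_iff)
  ultimately show False by simp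
qed

text \<open>In a triangular form the traces of the powers are the power sums of the diagonal. So the
  diagonal vanishes and the form is strictly upper triangular.\<close>

lemma nilpotent_if_traces_zero:
  assumes A: "A \<in> carrier_mat n n" and tr: "\<And>k. k \<ge> 1 \<Longrightarrow> mtrace (A ^\<^sub>m k) = 0"
  shows "A ^\<^sub>m n = 0\<^sub>m n n"
proof -
  obtain es where "char_poly A = (\<Prod>a\<leftarrow>es. [:- a, 1:])"
    using char_poly_factorized[OF A] by auto
  from schur_decomposition_exists[OF A this] obtain B where B: "B \<in> carrier_mat n n" "upper_triangular B"
    and "similar_mat A B" by blast
  then obtain P Q where w: "similar_mat_wit A B P Q" by (auto simp: similar_mat_def)
  from similar_mat_witD2[OF A w] have PQ: "P * Q = 1\<^sub>m n" "Q * P = 1\<^sub>m n"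
    "P \<in> carrier_mat n n" "Q \<in> carrier_mat n n" by auto
  have pow: "A ^\<^sub>m k = P * (B ^\<^sub>m k) * Q" for k
    by (rule similar_mat_wit_pow_id[OF w])
  have "(\<Sum>i<n. (B $$ (i, i)) ^ k) = 0" if "k \<ge> 1" for k
  proof -
    have "mtrace (A ^\<^sub>m k) = mtrace (B ^\<^sub>m k)"
      unfolding pow by (rule mtrace_similar[OF PQ(3,4,2)]) (use B in simp)
    also have "\<dots> = (\<Sum>i<n. (B $$ (i, i)) ^ k)"
      using B upper_triangular_pow(2)[OF B] by (simp add: mtrace_def)
    finally show ?thesis using tr[OF that] by simp
  qed
  from power_sums_zero[OF this] have "B $$ (i, i) = 0" if "i < n" for i
    using that by blast
  then have "B $$ (i, j) = 0" if "i < n" "j \<le> i" for i j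
    using that B by (cases "i = j") auto
  then have "B ^\<^sub>m n = 0\<^sub>m n n" by (rule strictly_upper_pow[OF B(1)])
  then show ?thesis using pow PQ by simp
qed

text \<open>The \<open>n + 1\<close> vectors are the columns of a square matrix completed by a zero
  row. It is singular, and a kernel vector gives the coefficients.\<close>

lemma linear_dependence:
  fixes v :: "nat \<Rightarrow> complex vec"
  shows "\<exists>c. (\<exists>k\<le>n. c k \<noteq> 0) \<and> (\<forall>i<n. (\<Sum>k\<le>n. c k * v k $ i) = 0)"
proof -
  define A where "A = mat\<^sub>r (Suc n) (Suc n)
    (\<lambda>i. if i = n then 0\<^sub>v (Suc n) else vec (Suc n) (\<lambda>k. v k $ i))"
  have A: "A \<in> carrier_mat (Suc n) (Suc n)" by (simp add: A_def)
  have "det A = 0"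
    unfolding A_def by (rule det_row_0) auto
  then obtain c where c: "c \<in> carrier_vec (Suc n)" "c \<noteq> 0\<^sub>v (Suc n)" "A *\<^sub>v c = 0\<^sub>v (Suc n)"
    using det_0_iff_vec_prod_zero[OF A] by blast
  have "\<exists>k\<le>n. c $ k \<noteq> 0"
  proof (rule ccontr)
    assume "\<not> (\<exists>k\<le>n. c $ k \<noteq> 0)"
    then have "c = 0\<^sub>v (Suc n)" using c(1) by (intro eq_vecI) auto
    with c(2) show False by simp
  qed
  moreover have "(\<Sum>k\<le>n. c $ k * v k $ i) = 0" if "i < n" for i
  proof -
    have "(A *\<^sub>v c) $ i = (\<Sum>k\<in>{0..<Suc n}. A $$ (i, k) * c $ k)"
      using that A c(1) by (simp add: scalar_prod_def)
    also have "\<dots> = (\<Sum>k\<le>n. c $ k * v k $ i)"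
      using that by (intro sum.cong) (auto simp: A_def)
    finally show ?thesis using c(3) that by simp
  qed
  ultimately show ?thesis by blast
qed

section \<open>Subspaces and the length of their chains\<close>

lemma smult_mat_vec:
  fixes A :: "complex mat"
  shows "A \<in> carrier_mat n m \<Longrightarrow> v \<in> carrier_vec m \<Longrightarrow> (c \<cdot>\<^sub>m A) *\<^sub>v v = c \<cdot>\<^sub>v (A *\<^sub>v v)"
  by (intro eq_vecI) (auto simp: scalar_prod_def sum_distrib_left mult.assoc)

lemma mat_mult_zero_vec: "A \<in> carrier_mat n m \<Longrightarrow> (A :: complex mat) *\<^sub>v 0\<^sub>v m = 0\<^sub>v n"
  by (intro eq_vecI) auto

definition subsp :: "nat \<Rightarrow> complex vec set \<Rightarrow> bool" where
  "subsp n U \<longleftrightarrow> U \<subseteq> carrier_vec n \<and> 0\<^sub>v n \<in> U \<and> (\<forall>x \<in> U. \<forall>y \<in> U. x + y \<in> U) \<and> (\<forall>x \<in> U. \<forall>c. c \<cdot>\<^sub>v x \<in> U)"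

lemma subsp_sum:
  assumes U: "subsp n U" and "finite I" and "\<And>k. k \<in> I \<Longrightarrow> v k \<in> U"
  shows "vec n (\<lambda>i. \<Sum>k\<in>I. c k * v k $ i) \<in> U"
  using assms(2,3)
proof (induction I)
  case empty
  have "vec n (\<lambda>i. \<Sum>k\<in>{}. c k * v k $ i) = 0\<^sub>v n" by (intro eq_vecI) auto
  then show ?case using U unfolding subsp_def by simp
next
  case (insert k I)
  have v: "v k \<in> carrier_vec n" using U insert.prems by (auto simp: subsp_def)
  have "vec n (\<lambda>i. \<Sum>k\<in>insert k I. c k * v k $ i) = c k \<cdot>\<^sub>v v k + vec n (\<lambda>i. \<Sum>k\<in>I. c k * v k $ i)"
    using insert.hyps v by (intro eq_vecI) auto
  moreover have "c k \<cdot>\<^sub>v v k \<in> U" using U insert.prems by (auto simp: subsp_def)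
  ultimately show ?case using U insert by (auto simp: subsp_def)
qed

text \<open>Solving a linear dependence of the \<open>v k\<close> for an index that is extremal
  among those with nonzero coefficient puts that \<open>v k\<close> into \<open>U k\<close>. Taking
  for \<open>R\<close> either order of the indices covers descending and ascending chains
  alike.\<close>

lemma no_long_chain:
  assumes U: "\<And>k. k \<le> n \<Longrightarrow> subsp n (U k)"
    and v: "\<And>k. k \<le> n \<Longrightarrow> v k \<in> carrier_vec n \<and> v k \<notin> U k"
    and mem: "\<And>k l. k \<le> n \<Longrightarrow> l \<le> n \<Longrightarrow> R k l \<Longrightarrow> v l \<in> U k"
    and tot: "\<And>J. J \<subseteq> {..n} \<Longrightarrow> J \<noteq> {} \<Longrightarrow> \<exists>k \<in> J. \<forall>l \<in> J - {k}. R k l"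
  shows False
proof -
  obtain c where c: "\<exists>k\<le>n. c k \<noteq> 0" and z: "\<And>i. i < n \<Longrightarrow> (\<Sum>k\<le>n. c k * v k $ i) = 0"
    using linear_dependence[of n v] by blast
  let ?J = "{k. k \<le> n \<and> c k \<noteq> 0}"
  obtain k where k: "k \<le> n" "c k \<noteq> 0" and R: "\<And>l. l \<le> n \<Longrightarrow> c l \<noteq> 0 \<Longrightarrow> l \<noteq> k \<Longrightarrow> R k l"
    using tot[of ?J] c by auto
  let ?d = "\<lambda>l. - c l / c k"
  have "vec n (\<lambda>i. \<Sum>l\<in>?J - {k}. ?d l * v l $ i) \<in> U k"
    by (rule subsp_sum[OF U[OF k(1)]]) (use mem[OF k(1)] R in auto)
  moreover have "vec n (\<lambda>i. \<Sum>l\<in>?J - {k}. ?d l * v l $ i) = v k"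
  proof (rule eq_vecI)
    fix i assume "i < dim_vec (v k)"
    then have i: "i < n" using v[OF k(1)] by auto
    have "0 = (\<Sum>l\<le>n. c l * v l $ i)" using z[OF i] by simp
    also have "\<dots> = (\<Sum>l\<in>?J. c l * v l $ i)" by (rule sum.mono_neutral_right) auto
    also have "\<dots> = c k * v k $ i + (\<Sum>l\<in>?J - {k}. c l * v l $ i)"
      using k by (intro sum.remove) auto
    finally have "v k $ i = - (\<Sum>l\<in>?J - {k}. c l * v l $ i) / c k"
      using k(2) by (simp add: field_simps add_eq_0_iff)
    then show "vec n (\<lambda>i. \<Sum>l\<in>?J - {k}. ?d l * v l $ i) $ i = v k $ i"
      using i by (simp add: sum_negf sum_divide_distrib)
  qed (use v[OF k(1)] in auto)
  ultimately show False using v[OF k(1)] by simp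
qed

section \<open>The algebra generated by a set of matrices\<close>

context
  fixes n :: nat and G :: "complex mat set"
  assumes G: "G \<subseteq> carrier_mat n n"
begin

text \<open>The generated algebra without unit: the empty word is excluded because the identity has
  trace \<open>n\<close>.\<close>

inductive_set walg :: "complex mat set" where
  word: "set ws \<subseteq> G \<Longrightarrow> ws \<noteq> [] \<Longrightarrow> mprod n ws \<in> walg"
| add: "A \<in> walg \<Longrightarrow> B \<in> walg \<Longrightarrow> A + B \<in> walg"
| smult: "A \<in> walg \<Longrightarrow> c \<cdot>\<^sub>m A \<in> walg"

lemma walg_carrier: "A \<in> walg \<Longrightarrow> A \<in> carrier_mat n n"
proof (induction rule: walg.induct)
  case (word ws)
  then show ?case using mprod_carrier[of ws n] G by blast
qed auto

lemma walg_mult: "A \<in> walg \<Longrightarrow> B \<in> walg \<Longrightarrow> A * B \<in> walg"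
proof (induction arbitrary: B rule: walg.induct)
  case (word ws)
  from word(3) show ?case
  proof (induction rule: walg.induct)
    case (word us)
    then show ?case
      using mprod_append[of ws n us] walg.word[of "ws @ us"] \<open>set ws \<subseteq> G\<close> G by auto
  next
    case (add B C)
    have "mprod n ws \<in> carrier_mat n n" using mprod_carrier[of ws n] \<open>set ws \<subseteq> G\<close> G by blast
    then show ?case
      using add mult_add_distrib_mat[of "mprod n ws" n n B n C] walg_carrier by (simp add: walg.add)
  next
    case (smult B c)
    have "mprod n ws \<in> carrier_mat n n" using mprod_carrier[of ws n] \<open>set ws \<subseteq> G\<close> G by blast
    then show ?case
      using smult mult_smult_distrib[of "mprod n ws" n n B n c] walg_carrier by (simp add: walg.smult)
  qed
next
  case (add A C)
  then show ?case
    using add_mult_distrib_mat[of A n n C B n] walg_carrier by (simp add: walg.add)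
next
  case (smult A c)
  then show ?case
    using mult_smult_assoc_mat[of A n n B n c] walg_carrier by (simp add: walg.smult)
qed

lemma walg_pow: "A \<in> walg \<Longrightarrow> A ^\<^sub>m Suc k \<in> walg"
proof (induction k)
  case 0
  then show ?case using walg_carrier[of A] by simp
next
  case (Suc k)
  then show ?case using walg_mult[of "A ^\<^sub>m Suc k" A] by simp
qed

context
  assumes tr: "\<And>ws. set ws \<subseteq> G \<Longrightarrow> ws \<noteq> [] \<Longrightarrow> mtrace (mprod n ws) = 0"
begin

text \<open>The trace vanishes on nonempty words, hence by linearity on \<open>walg\<close>, which
  contains all positive powers of its elements.\<close>

lemma walg_nilpotent: "A \<in> walg \<Longrightarrow> A ^\<^sub>m n = 0\<^sub>m n n"
proof -
  have tr0: "B \<in> walg \<Longrightarrow> mtrace B = 0" for B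
  proof (induction rule: walg.induct)
    case (add A B)
    then show ?case using mtrace_add walg_carrier by force
  next
    case (smult A c)
    then show ?case using mtrace_smult[OF walg_carrier] by simp
  qed (use tr in auto)
  assume A: "A \<in> walg"
  show ?thesis
  proof (rule nilpotent_if_traces_zero[OF walg_carrier[OF A]])
    fix k :: nat assume "k \<ge> 1"
    then obtain k' where "k = Suc k'" by (cases k) auto
    then show "mtrace (A ^\<^sub>m k) = 0" using tr0[OF walg_pow[OF A]] by simp
  qed
qed

text \<open>
  Otherwise one could choose \<open>v\<^sub>0, v\<^sub>1, \<dots>\<close> outside \<open>W\<close> with \<open>v\<^sub>k\<^sub>+\<^sub>1 \<in> G v\<^sub>k\<close>. The descending
  subspaces \<open>A v\<^sub>k + W\<close>, where \<open>A\<close> is the algebra generated by \<open>G\<close>, become stationary, so some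
  \<open>v = v\<^sub>k\<^sub>+\<^sub>1\<close> satisfies \<open>v \<in> b v + W\<close> with \<open>b \<in> A\<close>; as \<open>b\<close> is nilpotent, \<open>v \<in> W\<close>.
\<close>

lemma exists_vector_into:
  assumes W: "subsp n W" and inv: "\<And>A w. A \<in> G \<Longrightarrow> w \<in> W \<Longrightarrow> A *\<^sub>v w \<in> W"
    and u: "u \<in> carrier_vec n" "u \<notin> W"
  shows "\<exists>v \<in> carrier_vec n - W. \<forall>A \<in> G. A *\<^sub>v v \<in> W"
proof (rule ccontr)
  assume "\<not> ?thesis"
  then have next_ex: "\<exists>A \<in> G. A *\<^sub>v v \<notin> W" if "v \<in> carrier_vec n - W" for v
    using that by blast
  then obtain f where f: "\<And>v. v \<in> carrier_vec n - W \<Longrightarrow> f v \<in> G \<and> f v *\<^sub>v v \<notin> W" by metis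
  define v where "v k = ((\<lambda>v. f v *\<^sub>v v) ^^ k) u" for k :: nat
  have v: "v k \<in> carrier_vec n - W" for k
  proof (induction k)
    case (Suc k)
    have "f (v k) \<in> carrier_mat n n" using f[OF Suc] G by blast
    then show ?case using f[OF Suc] Suc by (simp add: v_def)
  qed (use u in \<open>simp add: v_def\<close>)
  have v_Suc: "v (Suc k) = f (v k) *\<^sub>v v k" for k by (simp add: v_def)
  have Ww: "W \<subseteq> carrier_vec n" using W by (simp add: subsp_def)
  have walg_W: "B *\<^sub>v w \<in> W" if "B \<in> walg" "w \<in> W" for B w
    using that
  proof (induction arbitrary: w rule: walg.induct)
    case (word ws)
    have "set ws \<subseteq> G \<Longrightarrow> mprod n ws *\<^sub>v w \<in> W"
    proof (induction ws)
      case Nil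
      then show ?case using word(3) Ww by (simp add: subset_iff)
    next
      case (Cons A ws)
      then have "A *\<^sub>v (mprod n ws *\<^sub>v w) \<in> W" using inv by simp
      moreover have "A \<in> carrier_mat n n" "mprod n ws \<in> carrier_mat n n" "w \<in> carrier_vec n"
        using Cons.prems G mprod_carrier[of ws n] word(3) Ww by auto
      ultimately show ?case by (simp add: assoc_mult_mat_vec)
    qed
    then show ?case using word by simp
  next
    case (add A B)
    then have "A *\<^sub>v w + B *\<^sub>v w \<in> W" using W by (simp add: subsp_def)
    moreover have "w \<in> carrier_vec n" using add Ww by blast
    ultimately show ?case using add add_mult_distrib_mat_vec[of A n n B w] walg_carrier by simp
  next
    case (smult A c)
    then have "c \<cdot>\<^sub>v (A *\<^sub>v w) \<in> W" using W by (simp add: subsp_def)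
    moreover have "w \<in> carrier_vec n" using smult Ww by blast
    ultimately show ?case using smult smult_mat_vec[of A n n w c] walg_carrier by simp
  qed
  define U where "U k = {B *\<^sub>v v k + w | B w. B \<in> walg \<and> w \<in> W}" for k
  have gen: "f (v k) \<in> walg" for k
  proof -
    have "f (v k) \<in> G" using f[OF v] by blast
    moreover from this have "mprod n [f (v k)] = f (v k)" using G by (auto intro: right_mult_one_mat)
    ultimately show ?thesis using walg.word[of "[f (v k)]"] by simp
  qed
  have zero: "0\<^sub>m n n \<in> walg"
  proof -
    have "0 \<cdot>\<^sub>m f (v 0) = 0\<^sub>m n n" using walg_carrier[OF gen[of 0]] by (intro eq_matI) auto
    then show ?thesis using walg.smult[OF gen[of 0], of 0] by simp
  qed
  have U: "subsp n (U k)" for k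
    unfolding subsp_def
  proof (intro conjI subsetI ballI allI)
    have vk: "v k \<in> carrier_vec n" using v by blast
    show "0\<^sub>v n \<in> U k"
    proof -
      have "0\<^sub>v n = 0\<^sub>m n n *\<^sub>v v k + 0\<^sub>v n" using vk by auto
      then show ?thesis using zero W by (auto simp: U_def subsp_def)
    qed
    fix x assume "x \<in> U k"
    then obtain B w where x: "x = B *\<^sub>v v k + w" "B \<in> walg" "w \<in> W" by (auto simp: U_def)
    have Bw: "B \<in> carrier_mat n n" "w \<in> carrier_vec n" using x walg_carrier Ww by auto
    show "x \<in> carrier_vec n" using x Bw vk by auto
    show "c \<cdot>\<^sub>v x \<in> U k" for c
    proof -
      have "c \<cdot>\<^sub>v x = (c \<cdot>\<^sub>m B) *\<^sub>v v k + c \<cdot>\<^sub>v w"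
        using Bw vk by (simp add: x smult_add_distrib_vec[of _ n] smult_mat_vec[of _ n n])
      moreover have "c \<cdot>\<^sub>m B \<in> walg" using x(2) by (rule walg.smult)
      moreover have "c \<cdot>\<^sub>v w \<in> W" using x(3) W by (auto simp: subsp_def)
      ultimately show ?thesis unfolding U_def by blast
    qed
    fix y assume "y \<in> U k"
    then obtain C z where y: "y = C *\<^sub>v v k + z" "C \<in> walg" "z \<in> W" by (auto simp: U_def)
    have Cz: "C \<in> carrier_mat n n" "z \<in> carrier_vec n" using y walg_carrier Ww by auto
    have "x + y = (B + C) *\<^sub>v v k + (w + z)"
      using Bw Cz vk by (intro eq_vecI) (auto simp: x y add_mult_distrib_mat_vec[of _ n n])
    moreover have "B + C \<in> walg" using x(2) y(2) by (rule walg.add)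
    moreover have "w + z \<in> W" using x(3) y(3) W by (auto simp: subsp_def)
    ultimately show "x + y \<in> U k" unfolding U_def by blast
  qed
  have vU: "v (Suc k) \<in> U k" for k
  proof -
    have "v (Suc k) = f (v k) *\<^sub>v v k + 0\<^sub>v n"
      using v[of "Suc k"] v_Suc[of k] by simp
    then show ?thesis using gen W by (auto simp: U_def subsp_def)
  qed
  have U_dec: "U (Suc k) \<subseteq> U k" for k
  proof
    fix x assume "x \<in> U (Suc k)"
    then obtain B w where x: "x = B *\<^sub>v v (Suc k) + w" "B \<in> walg" "w \<in> W" by (auto simp: U_def)
    have "B *\<^sub>v v (Suc k) = (B * f (v k)) *\<^sub>v v k"
      using assoc_mult_mat_vec[of B n n "f (v k)" n "v k"] walg_carrier x gen v by (simp add: v_Suc)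
    then show "x \<in> U k" using x walg_mult[OF x(2) gen[of k]] by (auto simp: U_def)
  qed
  have U_mono: "k \<le> l \<Longrightarrow> U l \<subseteq> U k" for k l
    by (rule lift_Suc_antimono_le[of U, OF U_dec])
  have "\<exists>k. v (Suc k) \<in> U (Suc k)"
  proof (rule ccontr)
    assume no: "\<nexists>k. v (Suc k) \<in> U (Suc k)"
    \<comment> \<open>\<open>v (Suc l)\<close> lies in \<open>U l\<close>, which is contained in
      \<open>U (Suc k)\<close> for \<open>k < l\<close>; so a dependence is solved for its least
      index.\<close>
    show False
    proof (rule no_long_chain[of n "\<lambda>k. U (Suc k)" "\<lambda>k. v (Suc k)" "\<lambda>k l. k < l"])
      show "v (Suc l) \<in> U (Suc k)" if "k < l" for k l
        using vU[of l] U_mono[of "Suc k" l] that by auto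
      show "\<exists>k \<in> J. \<forall>l \<in> J - {k}. k < l" if "J \<subseteq> {..n}" "J \<noteq> {}" for J :: "nat set"
      proof -
        have "finite J" using that finite_subset by blast
        then show ?thesis using that Min_in[of J] Min_le[of J] by (intro bexI[of _ "Min J"]) (auto simp: order_less_le)
      qed
    qed (use U no v in auto)
  qed
  then obtain k where "v (Suc k) \<in> U (Suc k)" by blast
  then obtain B w where eq': "v (Suc k) = B *\<^sub>v v (Suc k) + w" and B: "B \<in> walg" and w: "w \<in> W"
    unfolding U_def by blast
  note eq = eq'[symmetric]
  let ?x = "v (Suc k)"
  have x: "?x \<in> carrier_vec n" using v by blast
  have Bc: "B \<in> carrier_mat n n" using walg_carrier[OF B] .
  \<comment> \<open>Iterating x = B x + w puts x into B^j x + W; for \<open>j = n\<close> the first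
    summand vanishes by nilpotency.\<close>
  have "\<exists>w \<in> W. (B ^\<^sub>m j) *\<^sub>v ?x + w = ?x" for j
  proof (induction j)
    case 0
    have "B ^\<^sub>m 0 *\<^sub>v ?x + 0\<^sub>v n = ?x" using x Bc by simp
    then show ?case using W by (auto simp: subsp_def)
  next
    case (Suc j)
    then obtain z where z: "z \<in> W" "(B ^\<^sub>m j) *\<^sub>v ?x + z = ?x" by blast
    have c: "w \<in> carrier_vec n" "z \<in> carrier_vec n" using w z(1) Ww by auto
    have Bj: "B ^\<^sub>m j \<in> carrier_mat n n" using Bc by simp
    have c': "(B ^\<^sub>m Suc j) *\<^sub>v ?x \<in> carrier_vec n" "(B ^\<^sub>m j) *\<^sub>v w \<in> carrier_vec n"
      "B *\<^sub>v ?x \<in> carrier_vec n"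
      using Bj Bc by (auto intro!: mult_mat_vec_carrier[of _ n n] x c)
    have "(B ^\<^sub>m j) *\<^sub>v ?x = (B ^\<^sub>m j) *\<^sub>v (B *\<^sub>v ?x + w)" by (simp only: eq)
    also have "\<dots> = (B ^\<^sub>m j) *\<^sub>v (B *\<^sub>v ?x) + (B ^\<^sub>m j) *\<^sub>v w"
      by (rule mult_add_distrib_mat_vec[OF Bj c'(3) c(1)])
    also have "(B ^\<^sub>m j) *\<^sub>v (B *\<^sub>v ?x) = (B ^\<^sub>m Suc j) *\<^sub>v ?x"
      using assoc_mult_mat_vec[OF Bj Bc x] by simp
    finally have "(B ^\<^sub>m Suc j) *\<^sub>v ?x + ((B ^\<^sub>m j) *\<^sub>v w + z) = ?x"
      using z(2) assoc_add_vec[OF c'(1,2) c(2)] by argo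
    \<comment> \<open>The exponent 0 is separate because the identity need not belong to
      \<open>walg\<close>.\<close>
    moreover have "(B ^\<^sub>m j) *\<^sub>v w \<in> W"
    proof (cases j)
      case 0
      then show ?thesis using w c Bc by simp
    next
      case (Suc i)
      then show ?thesis using walg_W[OF walg_pow[OF B] w] by simp
    qed
    ultimately show ?case using z(1) W unfolding subsp_def by blast
  qed
  from this[of n] obtain w' where w': "w' \<in> W" "(B ^\<^sub>m n) *\<^sub>v ?x + w' = ?x" by blast
  have "(B ^\<^sub>m n) *\<^sub>v ?x = 0\<^sub>v n"
    using walg_nilpotent[OF B] x by (auto intro!: eq_vecI)
  then have "w' = ?x" using w' Ww by auto
  with w'(1) have "?x \<in> W" by simp
  then show False using v by blast
qed

text \<open>The subspaces \<open>W j\<close> killed by all words of length \<open>j\<close> ascend,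
  strictly as long as they are not everything: a vector that all letters map into \<open>W j\<close>
  belongs to \<open>W (Suc j)\<close>. A strict chain in dimension \<open>n\<close> has at most
  \<open>n\<close> steps.\<close>

theorem words_vanish:
  assumes ws: "set ws \<subseteq> G" "length ws = n"
  shows "mprod n ws = 0\<^sub>m n n"
proof -
  define W where "W j = {v \<in> carrier_vec n. \<forall>ws. set ws \<subseteq> G \<longrightarrow> length ws = j \<longrightarrow> mprod n ws *\<^sub>v v = 0\<^sub>v n}" for j
  have mc: "mprod n ws \<in> carrier_mat n n" if "set ws \<subseteq> G" for ws
    using mprod_carrier[of ws n] that G by blast
  have W: "subsp n (W j)" for j
    unfolding subsp_def
  proof (intro conjI subsetI ballI allI)
    show "0\<^sub>v n \<in> W j" using mc mat_mult_zero_vec by (auto simp: W_def)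
    show "x + y \<in> W j" if "x \<in> W j" "y \<in> W j" for x y
      using that mc mult_add_distrib_mat_vec[of _ n n x y] by (auto simp: W_def)
    show "c \<cdot>\<^sub>v x \<in> W j" if "x \<in> W j" for x c
      using that mc mult_mat_vec[of _ n n x c] by (auto simp: W_def)
  qed (auto simp: W_def)
  have step: "v \<in> W (Suc j)" if v: "v \<in> carrier_vec n" "\<forall>A \<in> G. A *\<^sub>v v \<in> W j" for v j
  proof -
    have "mprod n ws *\<^sub>v v = 0\<^sub>v n" if ws: "set ws \<subseteq> G" "length ws = Suc j" for ws
    proof -
      obtain us A where us: "ws = us @ [A]" using ws(2) by (metis length_Suc_conv_rev)
      have A: "A \<in> G" "set us \<subseteq> G" "length us = j" using ws us by auto
      have Ac: "A \<in> carrier_mat n n" using A G by blast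
      have "mprod n ws = mprod n us * A"
        using mprod_append[of us n "[A]"] A G Ac by (auto simp: us)
      then have "mprod n ws *\<^sub>v v = mprod n us *\<^sub>v (A *\<^sub>v v)"
        using assoc_mult_mat_vec[OF mc[OF A(2)] Ac v(1)] by simp
      then show ?thesis using v(2) A by (auto simp: W_def)
    qed
    then show ?thesis using v(1) by (simp add: W_def)
  qed
  have inv: "A *\<^sub>v w \<in> W j" if A: "A \<in> G" and w: "w \<in> W (Suc j)" for A w j
  proof -
    have Ac: "A \<in> carrier_mat n n" using A G by blast
    have wc: "w \<in> carrier_vec n" using w by (simp add: W_def)
    have "mprod n ws *\<^sub>v (A *\<^sub>v w) = 0\<^sub>v n" if ws: "set ws \<subseteq> G" "length ws = j" for ws
    proof -
      have "mprod n (ws @ [A]) = mprod n ws * A"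
        using mprod_append[of ws n "[A]"] ws A G Ac by auto
      then have "mprod n ws *\<^sub>v (A *\<^sub>v w) = mprod n (ws @ [A]) *\<^sub>v w"
        using assoc_mult_mat_vec[OF mc[OF ws(1)] Ac wc] by simp
      then show ?thesis using w ws A by (simp add: W_def)
    qed
    then show ?thesis using Ac wc by (simp add: W_def)
  qed
  have W_Suc: "W j \<subseteq> W (Suc j)" for j
  proof (induction j)
    case 0
    have "W 0 = {0\<^sub>v n}" by (auto simp: W_def)
    then show ?case using W[of "Suc 0"] by (simp add: subsp_def)
  next
    case (Suc j)
    show ?case
    proof
      fix x assume x: "x \<in> W (Suc j)"
      then have "\<forall>A \<in> G. A *\<^sub>v x \<in> W (Suc j)" using inv Suc by blast
      moreover have "x \<in> carrier_vec n" using x by (simp add: W_def)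
      ultimately show "x \<in> W (Suc (Suc j))" by (intro step)
    qed
  qed
  have W_mono: "i \<le> j \<Longrightarrow> W i \<subseteq> W j" for i j
    by (rule lift_Suc_mono_le[of W, OF W_Suc])
  have "W n = carrier_vec n"
  proof (rule ccontr)
    assume "W n \<noteq> carrier_vec n"
    then obtain u where u: "u \<in> carrier_vec n" "u \<notin> W n" by (auto simp: W_def)
    have "\<exists>v \<in> carrier_vec n - W j. v \<in> W (Suc j)" if "j \<le> n" for j
    proof -
      have "\<exists>v \<in> carrier_vec n - W j. \<forall>A \<in> G. A *\<^sub>v v \<in> W j"
      proof (rule exists_vector_into[OF W _ u(1)])
        show "A *\<^sub>v w \<in> W j" if "A \<in> G" "w \<in> W j" for A w
          using inv[OF that(1)] W_Suc[of j] that(2) by blast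
        show "u \<notin> W j" using u(2) W_mono[OF that] by blast
      qed
      then show ?thesis using step by blast
    qed
    then obtain v where v: "\<And>j. j \<le> n \<Longrightarrow> v j \<in> carrier_vec n - W j \<and> v j \<in> W (Suc j)" by metis
    show False
    proof (rule no_long_chain[of n W v "\<lambda>k l. l < k"])
      show "v l \<in> W k" if "k \<le> n" "l \<le> n" "l < k" for k l
        using v[OF that(2)] W_mono[of "Suc l" k] that(3) by auto
      show "\<exists>k \<in> J. \<forall>l \<in> J - {k}. l < k" if "J \<subseteq> {..n}" "J \<noteq> {}" for J :: "nat set"
      proof -
        have "finite J" using that finite_subset by blast
        then show ?thesis using that Max_in[of J] Max_ge[of J] by (intro bexI[of _ "Max J"]) (auto simp: order_less_le)
      qed
    qed (use W v in auto)
  qed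
  then have z: "mprod n ws *\<^sub>v v = 0\<^sub>v n" if "v \<in> carrier_vec n" for v
    using that ws by (auto simp: W_def)
  show ?thesis
  proof (rule eq_matI)
    fix i j assume ij: "i < dim_row (0\<^sub>m n n)" "j < dim_col (0\<^sub>m n n)"
    have "(mprod n ws *\<^sub>v unit_vec n j) $ i = mprod n ws $$ (i, j)"
      using ij mc[OF ws(1)] by (simp add: scalar_prod_right_unit[of _ n])
    then show "mprod n ws $$ (i, j) = 0\<^sub>m n n $$ (i, j)"
      using z[of "unit_vec n j"] ij by simp
  qed (use mc[OF ws(1)] in auto)
qed

end
end

section \<open>Positive definite Hermitian forms\<close>

definition hform :: "(nat \<Rightarrow> nat \<Rightarrow> complex) \<Rightarrow> nat \<Rightarrow> (nat \<Rightarrow> complex) \<Rightarrow> complex" where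
  "hform h n x = (\<Sum>i<n. \<Sum>j<n. cnj (x i) * h i j * x j)"

text \<open>Completing the square in the last variable.\<close>

lemma cholesky:
  assumes "\<And>i j. i < n \<Longrightarrow> j < n \<Longrightarrow> cnj (h i j) = h j i"
    and "\<And>x. \<exists>i<n. x i \<noteq> 0 \<Longrightarrow> Re (hform h n x) > 0"
  shows "\<exists>R. (\<forall>i j. i < j \<longrightarrow> R i j = 0) \<and> (\<forall>i<n. R i i \<noteq> 0) \<and>
    (\<forall>x. hform h n x = complex_of_real (\<Sum>i<n. (cmod (\<Sum>j<n. R i j * x j))\<^sup>2))"
  using assms
proof (induction n arbitrary: h)
  case 0
  show ?case by (rule exI[of _ "\<lambda>_ _. 0"]) (simp add: hform_def)
next
  case (Suc n)
  have herm: "cnj (h i j) = h j i" if "i \<le> n" "j \<le> n" for i j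
    using that by (intro Suc.prems(1)) simp_all
  define d where "d = Re (h n n)"
  have "hform h (Suc n) (\<lambda>i. if i = n then 1 else 0) = h n n"
  proof -
    have "(\<Sum>i<n. \<Sum>j<Suc n. cnj (if i = n then 1 else 0) * h i j * (if j = n then 1 else 0)) = 0"
      by (intro sum.neutral ballI) auto
    moreover have "(\<Sum>j<n. cnj 1 * h n j * (if j = n then 1 else 0)) = 0"
      by (intro sum.neutral ballI) auto
    ultimately show ?thesis by (simp add: hform_def)
  qed
  then have d: "d > 0" using Suc.prems(2)[of "\<lambda>i. if i = n then 1 else 0"] by (auto simp: d_def)
  have hd: "h n n = of_real d"
    using arg_cong[OF herm[of n n], of Im] by (simp add: d_def complex_eq_iff)
  \<comment> \<open>The Schur complement of the last diagonal entry; its last row and column are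
    zero.\<close>
  define h' where "h' i j = h i j - h i n * h n j / d" for i j
  define L where "L x = (\<Sum>j<Suc n. h n j * x j)" for x
  have split: "hform h (Suc n) x = hform h' n x + of_real ((cmod (L x))\<^sup>2 / d)" for x
  proof -
    have "of_real ((cmod (L x))\<^sup>2) = cnj (L x) * L x"
      by (metis complex_norm_square mult.commute)
    also have "\<dots> = (\<Sum>i<Suc n. \<Sum>j<Suc n. cnj (x i) * (h i n * h n j) * x j)"
    proof -
      have "cnj (L x) = (\<Sum>i<Suc n. cnj (x i) * h i n)"
        unfolding L_def cnj_sum complex_cnj_mult
        by (intro sum.cong refl) (use herm[of n] in \<open>simp add: less_Suc_eq_le\<close>)
      then show ?thesis
        unfolding L_def by (simp only: sum_product) (intro sum.cong refl, simp)
    qed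
    finally have "of_real ((cmod (L x))\<^sup>2 / d) = (\<Sum>i<Suc n. \<Sum>j<Suc n. cnj (x i) * (h i n * h n j / d) * x j)"
      by (simp only: of_real_divide sum_divide_distrib) (intro sum.cong refl, simp)
    then have "hform h (Suc n) x - of_real ((cmod (L x))\<^sup>2 / d) = (\<Sum>i<Suc n. \<Sum>j<Suc n. cnj (x i) * h' i j * x j)"
      unfolding hform_def h'_def by (simp only: sum_subtractf[symmetric]) (intro sum.cong refl, simp add: algebra_simps)
    also have "\<dots> = hform h' n x"
    proof -
      have "h' n j = 0" "h' j n = 0" for j
        using d by (simp_all add: h'_def hd)
      then show ?thesis by (simp add: hform_def)
    qed
    finally show ?thesis by (simp add: algebra_simps)
  qed
  have "\<exists>R. (\<forall>i j. i < j \<longrightarrow> R i j = 0) \<and> (\<forall>i<n. R i i \<noteq> 0) \<and>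
    (\<forall>x. hform h' n x = complex_of_real (\<Sum>i<n. (cmod (\<Sum>j<n. R i j * x j))\<^sup>2))"
  proof (rule Suc.IH)
    show "cnj (h' i j) = h' j i" if "i < n" "j < n" for i j
      using herm[of i j] herm[of i n] herm[of n j] that by (simp add: h'_def)
    fix x :: "nat \<Rightarrow> complex" assume x: "\<exists>i<n. x i \<noteq> 0"
    \<comment> \<open>The last coordinate is chosen to make \<open>L y = 0\<close>. It does not
      enter \<open>h'\<close>, so positivity of \<open>h\<close> at \<open>y\<close> is positivity
      of \<open>h'\<close> at \<open>x\<close>.\<close>
    define y where "y = x(n := - (\<Sum>j<n. h n j * x j) / d)"
    have "L y = 0" using d by (simp add: L_def y_def hd)
    moreover have "hform h' n y = hform h' n x"
      unfolding hform_def by (intro sum.cong refl) (auto simp: y_def)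
    ultimately have "hform h (Suc n) y = hform h' n x" using split[of y] by simp
    moreover have "\<exists>i<Suc n. y i \<noteq> 0" using x by (auto simp: y_def intro: less_SucI)
    ultimately show "Re (hform h' n x) > 0" using Suc.prems(2)[of y] by simp
  qed
  then obtain R where R: "\<And>i j. i < j \<Longrightarrow> R i j = 0" "\<And>i. i < n \<Longrightarrow> R i i \<noteq> 0"
    "\<And>x. hform h' n x = complex_of_real (\<Sum>i<n. (cmod (\<Sum>j<n. R i j * x j))\<^sup>2)" by blast
  define S where "S i j = (if i < n then R i j else if i = n \<and> j \<le> n then h n j / of_real (sqrt d) else 0)" for i j
  have "hform h (Suc n) x = complex_of_real (\<Sum>i<Suc n. (cmod (\<Sum>j<Suc n. S i j * x j))\<^sup>2)" for x
  proof -
    have "(\<Sum>j<Suc n. S i j * x j) = (\<Sum>j<n. R i j * x j)" if "i < n" for i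
      using R(1)[of i n] that by (simp add: S_def)
    moreover have "(\<Sum>j<Suc n. S n j * x j) = L x / of_real (sqrt d)"
      unfolding L_def sum_divide_distrib by (intro sum.cong) (auto simp: S_def)
    moreover have "(cmod (L x / of_real (sqrt d)))\<^sup>2 = (cmod (L x))\<^sup>2 / d"
      using d by (simp add: norm_divide power_divide)
    ultimately show ?thesis by (simp add: split R(3))
  qed
  moreover have "S i j = 0" if "i < j" for i j
    using that R(1)[of i j] by (auto simp: S_def)
  moreover have "S i i \<noteq> 0" if "i < Suc n" for i
    by (cases "i = n") (use that R(2)[of i] d in \<open>auto simp: S_def hd\<close>)
  ultimately show ?case by (intro exI[of _ S]) blast
qed

definition normsq :: "complex vec \<Rightarrow> real" where
  "normsq x = (\<Sum>j<dim_vec x. (cmod (x $ j))\<^sup>2)"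

text \<open>Forms are treated as real functions, since \<open>path_form\<close> is built from sums
  and compositions; the Hermitian matrix behind them is extracted only for the Cholesky
  factor.\<close>

definition is_form :: "nat \<Rightarrow> (complex vec \<Rightarrow> real) \<Rightarrow> bool" where
  "is_form n q \<longleftrightarrow> (\<exists>h. (\<forall>i<n. \<forall>j<n. cnj (h i j) = h j i) \<and>
     (\<forall>x \<in> carrier_vec n. complex_of_real (q x) = hform h n (($) x)))"

section \<open>Closure properties of Hermitian forms\<close>

lemma is_form_normsq: "is_form n normsq"
  unfolding is_form_def
proof (intro exI conjI ballI)
  let ?h = "\<lambda>i j. if i = j then 1 else 0 :: complex"
  show "\<forall>i<n. \<forall>j<n. cnj (?h i j) = ?h j i" by auto
  fix x :: "complex vec" assume x: "x \<in> carrier_vec n"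
  have "(\<Sum>j<n. cnj (x $ i) * ?h i j * x $ j) = (cmod (x $ i))\<^sup>2" if "i < n" for i
  proof -
    have "(\<Sum>j<n. cnj (x $ i) * ?h i j * x $ j) = (\<Sum>j<n. if j = i then cnj (x $ i) * x $ i else 0)"
      by (intro sum.cong) auto
    also have "\<dots> = (cmod (x $ i))\<^sup>2"
      using that complex_norm_square[of "x $ i"] by (simp add: mult.commute)
    finally show ?thesis .
  qed
  then show "complex_of_real (normsq x) = hform ?h n (($) x)"
    using x by (simp add: normsq_def hform_def)
qed

lemma is_form_add:
  assumes "is_form n q" "is_form n r"
  shows "is_form n (\<lambda>x. q x + r x)"
proof -
  obtain h k where h: "\<forall>i<n. \<forall>j<n. cnj (h i j) = h j i" "\<forall>x \<in> carrier_vec n. complex_of_real (q x) = hform h n (($) x)"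
    and k: "\<forall>i<n. \<forall>j<n. cnj (k i j) = k j i" "\<forall>x \<in> carrier_vec n. complex_of_real (r x) = hform k n (($) x)"
    using assms by (auto simp: is_form_def)
  show ?thesis
    unfolding is_form_def
    by (rule exI[of _ "\<lambda>i j. h i j + k i j"])
      (use h k in \<open>auto simp: hform_def sum.distrib distrib_left distrib_right\<close>)
qed

lemma is_form_scale:
  assumes "is_form n q"
  shows "is_form n (\<lambda>x. c * q x)"
proof -
  obtain h where h: "\<forall>i<n. \<forall>j<n. cnj (h i j) = h j i" "\<forall>x \<in> carrier_vec n. complex_of_real (q x) = hform h n (($) x)"
    using assms by (auto simp: is_form_def)
  show ?thesis
    unfolding is_form_def
    by (rule exI[of _ "\<lambda>i j. complex_of_real c * h i j"])
      (use h in \<open>auto simp: hform_def sum_distrib_left intro!: sum.cong\<close>)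
qed

lemma is_form_zero: "is_form n (\<lambda>x. 0)"
  unfolding is_form_def by (rule exI[of _ "\<lambda>i j. 0"]) (simp add: hform_def)

lemma is_form_sum:
  assumes "finite A" "\<And>a. a \<in> A \<Longrightarrow> is_form n (q a)"
  shows "is_form n (\<lambda>x. \<Sum>a\<in>A. q a x)"
  using assms by (induction A) (auto simp: is_form_zero intro: is_form_add)

text \<open>The new matrix is the adjoint of \<open>A\<close> times \<open>h\<close> times
  \<open>A\<close>; the long chain of equalities only exchanges the four sums.\<close>

lemma is_form_comp:
  assumes A: "A \<in> carrier_mat m n" and q: "is_form m q"
  shows "is_form n (\<lambda>x. q (A *\<^sub>v x))"
proof -
  obtain h where h: "\<And>i j. i < m \<Longrightarrow> j < m \<Longrightarrow> cnj (h i j) = h j i"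
    "\<forall>x \<in> carrier_vec m. complex_of_real (q x) = hform h m (($) x)"
    using q by (auto simp: is_form_def)
  define k where "k i j = (\<Sum>p<m. \<Sum>r<m. cnj (A $$ (p, i)) * h p r * A $$ (r, j))" for i j
  have "cnj (k i j) = k j i" for i j
    unfolding k_def cnj_sum
    by (subst sum.swap, intro sum.cong refl) (use h(1) in \<open>simp add: mult_ac\<close>)
  moreover have "complex_of_real (q (A *\<^sub>v x)) = hform k n (($) x)" if x: "x \<in> carrier_vec n" for x
  proof -
    have e: "(A *\<^sub>v x) $ p = (\<Sum>i<n. A $$ (p, i) * x $ i)" if "p < m" for p
      using that A x by (simp add: scalar_prod_def atLeast0LessThan)
    have "complex_of_real (q (A *\<^sub>v x)) = hform h m (($) (A *\<^sub>v x))"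
      using h(2) A x by simp
    also have "\<dots> = (\<Sum>p<m. \<Sum>r<m. cnj (\<Sum>i<n. A $$ (p, i) * x $ i) * h p r * (\<Sum>j<n. A $$ (r, j) * x $ j))"
      unfolding hform_def by (intro sum.cong refl) (simp add: e)
    also have "\<dots> = (\<Sum>p<m. \<Sum>r<m. \<Sum>i<n. \<Sum>j<n. cnj (x $ i) * (cnj (A $$ (p, i)) * h p r * A $$ (r, j)) * x $ j)"
      by (intro sum.cong refl) (simp add: sum_distrib_left sum_distrib_right mult_ac)
    also have "\<dots> = (\<Sum>p<m. \<Sum>i<n. \<Sum>r<m. \<Sum>j<n. cnj (x $ i) * (cnj (A $$ (p, i)) * h p r * A $$ (r, j)) * x $ j)"
      by (rule sum.cong[OF refl], rule sum.swap)
    also have "\<dots> = (\<Sum>i<n. \<Sum>p<m. \<Sum>r<m. \<Sum>j<n. cnj (x $ i) * (cnj (A $$ (p, i)) * h p r * A $$ (r, j)) * x $ j)"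
      by (rule sum.swap)
    also have "\<dots> = (\<Sum>i<n. \<Sum>p<m. \<Sum>j<n. \<Sum>r<m. cnj (x $ i) * (cnj (A $$ (p, i)) * h p r * A $$ (r, j)) * x $ j)"
      by (rule sum.cong[OF refl], rule sum.cong[OF refl], rule sum.swap)
    also have "\<dots> = (\<Sum>i<n. \<Sum>j<n. \<Sum>p<m. \<Sum>r<m. cnj (x $ i) * (cnj (A $$ (p, i)) * h p r * A $$ (r, j)) * x $ j)"
      by (rule sum.cong[OF refl], rule sum.swap)
    also have "\<dots> = hform k n (($) x)"
      unfolding hform_def k_def by (simp add: sum_distrib_left sum_distrib_right)
    finally show ?thesis .
  qed
  ultimately show ?thesis unfolding is_form_def by blast
qed

lemma normsq_nonneg: "normsq x \<ge> 0"
  by (simp add: normsq_def sum_nonneg)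

lemma normsq_eq_0: "x \<in> carrier_vec n \<Longrightarrow> normsq x = 0 \<longleftrightarrow> x = 0\<^sub>v n"
  by (auto simp: normsq_def sum_nonneg_eq_0_iff)

text \<open>Dominating \<open>normsq\<close> makes the form positive definite, and a triangular
  Cholesky factor with nonzero diagonal is invertible.\<close>

lemma form_eq_normsq:
  assumes q: "is_form n q" and pos: "\<And>x. x \<in> carrier_vec n \<Longrightarrow> q x \<ge> normsq x"
  shows "\<exists>R \<in> carrier_mat n n. det R \<noteq> 0 \<and> (\<forall>x \<in> carrier_vec n. q x = normsq (R *\<^sub>v x))"
proof -
  obtain h where h: "\<And>i j. i < n \<Longrightarrow> j < n \<Longrightarrow> cnj (h i j) = h j i"
    "\<And>x. x \<in> carrier_vec n \<Longrightarrow> complex_of_real (q x) = hform h n (($) x)"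
    using q by (auto simp: is_form_def)
  have "\<exists>R. (\<forall>i j. i < j \<longrightarrow> R i j = 0) \<and> (\<forall>i<n. R i i \<noteq> 0) \<and>
    (\<forall>x. hform h n x = complex_of_real (\<Sum>i<n. (cmod (\<Sum>j<n. R i j * x j))\<^sup>2))"
  proof (rule cholesky[OF h(1)])
    fix x :: "nat \<Rightarrow> complex" assume x: "\<exists>i<n. x i \<noteq> 0"
    have "hform h n x = hform h n (($) (vec n x))"
      unfolding hform_def by (intro sum.cong) auto
    also have "\<dots> = of_real (q (vec n x))" by (simp add: h(2))
    finally have "Re (hform h n x) = q (vec n x)" by simp
    moreover have "normsq (vec n x) \<noteq> 0"
    proof
      assume "normsq (vec n x) = 0"
      then have "vec n x = 0\<^sub>v n" by (simp add: normsq_eq_0[of _ n])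
      then show False using x by (metis index_vec index_zero_vec(1))
    qed
    ultimately show "Re (hform h n x) > 0"
      using pos[of "vec n x"] normsq_nonneg[of "vec n x"] by simp
  qed
  then obtain R where R: "\<And>i j. i < j \<Longrightarrow> R i j = 0" "\<And>i. i < n \<Longrightarrow> R i i \<noteq> 0"
    "\<And>x. hform h n x = complex_of_real (\<Sum>i<n. (cmod (\<Sum>j<n. R i j * x j))\<^sup>2)" by blast
  let ?R = "mat n n (\<lambda>(i, j). R i j)"
  have "det ?R = prod_list (diag_mat ?R)"
    by (rule det_lower_triangular[where n = n]) (use R(1) in auto)
  also have "\<dots> \<noteq> 0"
    using R(2) by (auto simp: diag_mat_def prod_list_zero_iff)
  finally have "det ?R \<noteq> 0" .
  moreover have "q x = normsq (?R *\<^sub>v x)" if x: "x \<in> carrier_vec n" for x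
  proof -
    have "complex_of_real (q x) = complex_of_real (normsq (?R *\<^sub>v x))"
      using x by (simp add: h(2) R(3) normsq_def scalar_prod_def atLeast0LessThan)
    then show ?thesis by (simp only: of_real_eq_iff)
  qed
  ultimately show ?thesis by (intro bexI[of _ ?R]) auto
qed

lemma frobenius_norm_columns:
  assumes "A \<in> carrier_mat n m"
  shows "(frobenius_norm A)\<^sup>2 = (\<Sum>j<m. normsq (A *\<^sub>v unit_vec m j))"
proof -
  have "(frobenius_norm A)\<^sup>2 = (\<Sum>i<n. \<Sum>j<m. (cmod (A $$ (i, j)))\<^sup>2)"
    using assms by (simp add: frobenius_norm_def sum_nonneg)
  also have "\<dots> = (\<Sum>j<m. \<Sum>i<n. (cmod (A $$ (i, j)))\<^sup>2)" by (rule sum.swap)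
  also have "\<dots> = (\<Sum>j<m. normsq (A *\<^sub>v unit_vec m j))"
  proof (rule sum.cong)
    fix j assume "j \<in> {..<m}"
    then have "A *\<^sub>v unit_vec m j = col A j" using assms by (intro eq_vecI) auto
    then show "(\<Sum>i<n. (cmod (A $$ (i, j)))\<^sup>2) = normsq (A *\<^sub>v unit_vec m j)"
      using assms \<open>j \<in> _\<close> by (simp add: normsq_def)
  qed simp
  finally show ?thesis .
qed

lemma normsq_unit_vec: "j < m \<Longrightarrow> normsq (unit_vec m j) = 1"
proof -
  assume "j < m"
  have "normsq (unit_vec m j) = (\<Sum>i<m. if i = j then 1 else 0)"
    unfolding normsq_def by (intro sum.cong) (auto simp: unit_vec_def)
  then show ?thesis using \<open>j < m\<close> by simp
qed

section \<open>Semistability as non-nilpotency\<close>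

lemma sum_list_index: "(\<Sum>p<length xs. f (xs ! p)) = (\<Sum>x\<leftarrow>xs. f x)"
  by (simp add: sum_list_sum_nth atLeast0LessThan)

locale quiver_representation = fin_digraph Q for Q :: quiver +
  fixes \<alpha> :: "nat \<Rightarrow> nat"
begin

text \<open>The standard basis of the direct sum of the spaces at the vertices. The vertices come in
  the order of the input encoding, so that a program can assemble padded matrices by
  concatenation.\<close>

definition basis :: "(nat \<times> nat) list" where
  "basis = concat (map (\<lambda>i. map (Pair i) [0..<\<alpha> i]) (sorted_list_of_set (verts Q)))"

abbreviation dim :: nat where
  "dim \<equiv> total_dim Q \<alpha>"

abbreviation vertex :: "nat \<Rightarrow> nat" where
  "vertex p \<equiv> fst (basis ! p)"

abbreviation coord :: "nat \<Rightarrow> nat" where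
  "coord p \<equiv> snd (basis ! p)"

lemma length_basis: "length basis = dim"
proof -
  have "length basis = (\<Sum>i\<leftarrow>sorted_list_of_set (verts Q). \<alpha> i)"
    by (simp add: basis_def length_concat comp_def)
  then show ?thesis
    by (simp add: total_dim_def sum_list_distinct_conv_sum_set)
qed

lemma set_basis: "set basis = (SIGMA i:verts Q. {..<\<alpha> i})"
  by (auto simp: basis_def)

lemma basis_nth: "p < dim \<Longrightarrow> vertex p \<in> verts Q \<and> coord p < \<alpha> (vertex p)"
  using nth_mem[of p basis] by (auto simp: length_basis set_basis)

lemma sum_basis:
  fixes f :: "nat \<Rightarrow> nat \<Rightarrow> 'a :: comm_monoid_add"
  shows "(\<Sum>p<dim. f (vertex p) (coord p)) = (\<Sum>i\<in>verts Q. \<Sum>r<\<alpha> i. f i r)"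
proof -
  have "(\<Sum>p<dim. f (vertex p) (coord p)) = (\<Sum>x\<leftarrow>basis. f (fst x) (snd x))"
    using sum_list_index[of "\<lambda>x. f (fst x) (snd x)" basis] by (simp add: length_basis)
  also have "\<dots> = (\<Sum>i\<leftarrow>sorted_list_of_set (verts Q). \<Sum>r<\<alpha> i. f i r)"
  proof -
    have "sum_list (concat xss) = (\<Sum>xs\<leftarrow>xss. sum_list xs)" for xss :: "'a list list"
      by (induction xss) auto
    then show ?thesis
      by (simp add: basis_def map_concat comp_def interv_sum_list_conv_sum_set_nat atLeast0LessThan)
  qed
  also have "\<dots> = (\<Sum>i\<in>verts Q. \<Sum>r<\<alpha> i. f i r)"
    by (simp add: sum_list_distinct_conv_sum_set)
  finally show ?thesis .
qed

lemma exists_basis_nth: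
  assumes "i \<in> verts Q" "r < \<alpha> i"
  obtains p where "p < dim" "basis ! p = (i, r)"
proof -
  have "(i, r) \<in> set basis" using assms by (simp add: set_basis)
  then show ?thesis using that by (metis in_set_conv_nth length_basis)
qed

text \<open>The arc as an endomorphism of the direct sum. A product over arcs that do not compose is
  zero, so words need not be restricted to paths.\<close>

definition hat :: "(nat \<Rightarrow> complex mat) \<Rightarrow> nat \<Rightarrow> complex mat" where
  "hat V a = mat dim dim (\<lambda>(p, q). if vertex p = head Q a \<and> vertex q = tail Q a
     then V a $$ (coord p, coord q) else 0)"

definition block :: "(nat \<Rightarrow> complex mat) \<Rightarrow> complex mat" where
  "block g = mat dim dim (\<lambda>(p, q). if vertex p = vertex q then g (vertex p) $$ (coord p, coord q) else 0)"

lemma hat_carrier [simp]: "hat V a \<in> carrier_mat dim dim"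
  and block_carrier [simp]: "block g \<in> carrier_mat dim dim"
  by (simp_all add: hat_def block_def)

lemma sum_vertex:
  fixes f :: "nat \<Rightarrow> complex"
  assumes "v \<in> verts Q"
  shows "(\<Sum>s<dim. if vertex s = v then f (coord s) else 0) = (\<Sum>r<\<alpha> v. f r)"
proof -
  have "(\<Sum>s<dim. if vertex s = v then f (coord s) else 0) = (\<Sum>i\<in>verts Q. \<Sum>r<\<alpha> i. if i = v then f r else 0)"
    by (rule sum_basis)
  also have "\<dots> = (\<Sum>i\<in>verts Q. if i = v then \<Sum>r<\<alpha> v. f r else 0)"
    by (intro sum.cong) auto
  finally show ?thesis using assms by simp
qed

lemma block_mult_hat:
  assumes a: "a \<in> arcs Q" and V: "V a \<in> carrier_mat (\<alpha> (head Q a)) (\<alpha> (tail Q a))"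
    and g: "\<And>i. i \<in> verts Q \<Longrightarrow> g i \<in> carrier_mat (\<alpha> i) (\<alpha> i)"
  shows "block g * hat V a = hat (\<lambda>a. g (head Q a) * V a) a"
proof (rule eq_matI)
  fix p q assume "p < dim_row (hat (\<lambda>a. g (head Q a) * V a) a)" "q < dim_col (hat (\<lambda>a. g (head Q a) * V a) a)"
  then have pq: "p < dim" "q < dim" by (simp_all add: hat_def)
  let ?h = "head Q a"
  have h: "?h \<in> verts Q" using a by (rule head_in_verts)
  have "(block g * hat V a) $$ (p, q) = (\<Sum>s<dim. block g $$ (p, s) * hat V a $$ (s, q))"
    by (rule mult_index) (use pq in simp_all)
  also have "\<dots> = (\<Sum>s<dim. if vertex s = ?h then (if vertex p = ?h \<and> vertex q = tail Q a
      then g ?h $$ (coord p, coord s) * V a $$ (coord s, coord q) else 0) else 0)"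
    by (intro sum.cong) (use pq in \<open>auto simp: block_def hat_def\<close>)
  also have "\<dots> = (\<Sum>r<\<alpha> ?h. if vertex p = ?h \<and> vertex q = tail Q a
      then g ?h $$ (coord p, r) * V a $$ (r, coord q) else 0)"
    by (rule sum_vertex[OF h])
  also have "\<dots> = (if vertex p = ?h \<and> vertex q = tail Q a then (g ?h * V a) $$ (coord p, coord q) else 0)"
    using basis_nth[OF pq(1)] basis_nth[OF pq(2)] mult_index[OF g[OF h] V, of "coord p" "coord q"] by auto
  finally show "(block g * hat V a) $$ (p, q) = hat (\<lambda>a. g (head Q a) * V a) a $$ (p, q)"
    using pq by (simp add: hat_def)
qed (simp_all add: hat_def block_def)

lemma hat_mult_block:
  assumes a: "a \<in> arcs Q" and V: "V a \<in> carrier_mat (\<alpha> (head Q a)) (\<alpha> (tail Q a))"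
    and g: "\<And>i. i \<in> verts Q \<Longrightarrow> g i \<in> carrier_mat (\<alpha> i) (\<alpha> i)"
  shows "hat V a * block g = hat (\<lambda>a. V a * g (tail Q a)) a"
proof (rule eq_matI)
  fix p q assume "p < dim_row (hat (\<lambda>a. V a * g (tail Q a)) a)" "q < dim_col (hat (\<lambda>a. V a * g (tail Q a)) a)"
  then have pq: "p < dim" "q < dim" by (simp_all add: hat_def)
  let ?t = "tail Q a"
  have t: "?t \<in> verts Q" using a by (rule tail_in_verts)
  have "(hat V a * block g) $$ (p, q) = (\<Sum>s<dim. hat V a $$ (p, s) * block g $$ (s, q))"
    by (rule mult_index) (use pq in simp_all)
  also have "\<dots> = (\<Sum>s<dim. if vertex s = ?t then (if vertex p = head Q a \<and> vertex q = ?t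
      then V a $$ (coord p, coord s) * g ?t $$ (coord s, coord q) else 0) else 0)"
    by (intro sum.cong) (use pq in \<open>auto simp: block_def hat_def\<close>)
  also have "\<dots> = (\<Sum>r<\<alpha> ?t. if vertex p = head Q a \<and> vertex q = ?t
      then V a $$ (coord p, r) * g ?t $$ (r, coord q) else 0)"
    by (rule sum_vertex[OF t])
  also have "\<dots> = (if vertex p = head Q a \<and> vertex q = ?t then (V a * g ?t) $$ (coord p, coord q) else 0)"
    using basis_nth[OF pq(1)] basis_nth[OF pq(2)] mult_index[OF V g[OF t], of "coord p" "coord q"] by auto
  finally show "(hat V a * block g) $$ (p, q) = hat (\<lambda>a. V a * g (tail Q a)) a $$ (p, q)"
    using pq by (simp add: hat_def)
qed (simp_all add: hat_def block_def)

lemma block_mult_inverse: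
  assumes g: "\<And>i. i \<in> verts Q \<Longrightarrow> g i \<in> carrier_mat (\<alpha> i) (\<alpha> i)"
    and h: "\<And>i. i \<in> verts Q \<Longrightarrow> h i \<in> carrier_mat (\<alpha> i) (\<alpha> i)"
    and inv: "\<And>i. i \<in> verts Q \<Longrightarrow> g i * h i = 1\<^sub>m (\<alpha> i)"
  shows "block g * block h = 1\<^sub>m dim"
proof (rule eq_matI)
  fix p q assume "p < dim_row (1\<^sub>m dim :: complex mat)" "q < dim_col (1\<^sub>m dim :: complex mat)"
  then have pq: "p < dim" "q < dim" by simp_all
  have v: "vertex p \<in> verts Q" using basis_nth[OF pq(1)] by simp
  have "(block g * block h) $$ (p, q) = (\<Sum>s<dim. block g $$ (p, s) * block h $$ (s, q))"
    by (rule mult_index) (use pq in simp_all)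
  also have "\<dots> = (\<Sum>s<dim. if vertex s = vertex p then (if vertex p = vertex q
      then g (vertex p) $$ (coord p, coord s) * h (vertex p) $$ (coord s, coord q) else 0) else 0)"
    by (intro sum.cong) (use pq in \<open>auto simp: block_def\<close>)
  also have "\<dots> = (\<Sum>r<\<alpha> (vertex p). if vertex p = vertex q
      then g (vertex p) $$ (coord p, r) * h (vertex p) $$ (r, coord q) else 0)"
    by (rule sum_vertex[OF v])
  also have "\<dots> = (if vertex p = vertex q then (g (vertex p) * h (vertex p)) $$ (coord p, coord q) else 0)"
    using basis_nth[OF pq(1)] basis_nth[OF pq(2)] mult_index[OF g[OF v] h[OF v], of "coord p" "coord q"] by auto
  also have "\<dots> = (if vertex p = vertex q \<and> coord p = coord q then 1 else 0)"
    using basis_nth[OF pq(1)] basis_nth[OF pq(2)] inv[OF v] by auto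
  also have "vertex p = vertex q \<and> coord p = coord q \<longleftrightarrow> p = q"
  proof -
    have "distinct basis"
      by (rule card_distinct) (simp add: set_basis length_basis total_dim_def)
    then show ?thesis using pq length_basis by (metis nth_eq_iff_index_eq prod_eq_iff)
  qed
  finally show "(block g * block h) $$ (p, q) = 1\<^sub>m dim $$ (p, q)"
    using pq by simp
qed (simp_all add: block_def)

definition nilpotent :: "(nat \<Rightarrow> complex mat) \<Rightarrow> bool" where
  "nilpotent V \<longleftrightarrow> (\<forall>ws. set ws \<subseteq> hat V ` arcs Q \<longrightarrow> length ws = dim \<longrightarrow> mprod dim ws = 0\<^sub>m dim dim)"

definition cost :: "(nat \<Rightarrow> complex mat) \<Rightarrow> (nat \<Rightarrow> complex mat) \<Rightarrow> real" where
  "cost V g = (\<Sum>a \<in> arcs Q. (frobenius_norm (act Q \<alpha> g V a))\<^sup>2)"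

section \<open>The group action in padded form\<close>

lemma GL_inverse:
  assumes "g \<in> GL Q \<alpha>" "i \<in> verts Q"
  shows "g i \<in> carrier_mat (\<alpha> i) (\<alpha> i)" "inv\<^bsub>matrix_ring (\<alpha> i)\<^esub> (g i) \<in> carrier_mat (\<alpha> i) (\<alpha> i)"
    "g i * inv\<^bsub>matrix_ring (\<alpha> i)\<^esub> (g i) = 1\<^sub>m (\<alpha> i)"
    "inv\<^bsub>matrix_ring (\<alpha> i)\<^esub> (g i) * g i = 1\<^sub>m (\<alpha> i)"
proof -
  interpret R: ring "matrix_ring (\<alpha> i)" by (rule ring_mat)
  have u: "g i \<in> Units (matrix_ring (\<alpha> i))" using assms by (auto simp: GL_def)
  show "g i \<in> carrier_mat (\<alpha> i) (\<alpha> i)" "inv\<^bsub>matrix_ring (\<alpha> i)\<^esub> (g i) \<in> carrier_mat (\<alpha> i) (\<alpha> i)"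
    "g i * inv\<^bsub>matrix_ring (\<alpha> i)\<^esub> (g i) = 1\<^sub>m (\<alpha> i)"
    "inv\<^bsub>matrix_ring (\<alpha> i)\<^esub> (g i) * g i = 1\<^sub>m (\<alpha> i)"
    using R.Units_closed[OF u] R.Units_inv_closed[OF u] R.Units_r_inv[OF u] R.Units_l_inv[OF u]
    by (simp_all add: ring_mat_simps)
qed

lemma act_carrier:
  assumes V: "is_representation Q \<alpha> V" and g: "g \<in> GL Q \<alpha>" and a: "a \<in> arcs Q"
  shows "act Q \<alpha> g V a \<in> carrier_mat (\<alpha> (head Q a)) (\<alpha> (tail Q a))"
  using V a GL_inverse[OF g head_in_verts[OF a]] GL_inverse[OF g tail_in_verts[OF a]]
  unfolding act_def is_representation_def by (metis mult_carrier_mat)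

text \<open>The action becomes conjugation by one block diagonal matrix, common to all arcs; this is
  why traces of words are invariant.\<close>

lemma hat_act:
  assumes V: "is_representation Q \<alpha> V" and g: "g \<in> GL Q \<alpha>" and a: "a \<in> arcs Q"
  shows "hat (act Q \<alpha> g V) a = block g * hat V a * block (\<lambda>i. inv\<^bsub>matrix_ring (\<alpha> i)\<^esub> (g i))"
proof -
  have Va: "V a \<in> carrier_mat (\<alpha> (head Q a)) (\<alpha> (tail Q a))"
    using V a by (simp add: is_representation_def)
  have "block g * hat V a = hat (\<lambda>a. g (head Q a) * V a) a"
    by (rule block_mult_hat[where V = V, OF a Va]) (rule GL_inverse[OF g])
  also have "\<dots> * block (\<lambda>i. inv\<^bsub>matrix_ring (\<alpha> i)\<^esub> (g i)) =
      hat (\<lambda>a. g (head Q a) * V a * inv\<^bsub>matrix_ring (\<alpha> (tail Q a))\<^esub> (g (tail Q a))) a"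
    by (rule hat_mult_block[where V = "\<lambda>a. g (head Q a) * V a", OF a])
      (rule mult_carrier_mat[OF GL_inverse(1)[OF g head_in_verts[OF a]] Va], rule GL_inverse(2)[OF g])
  also have "\<dots> = hat (act Q \<alpha> g V) a" by (simp only: hat_def act_def)
  finally show ?thesis by (rule sym)
qed

lemma cost_nonneg: "cost V g \<ge> 0"
  by (simp add: cost_def sum_nonneg)

lemma GL_nonempty: "GL Q \<alpha> \<noteq> {}"
proof -
  have "1\<^sub>m (\<alpha> i) \<in> Units (matrix_ring (\<alpha> i))" for i
    by (rule det_non_zero_imp_unit) auto
  then show ?thesis unfolding GL_def by (auto simp: PiE_eq_empty_iff)
qed

lemma semistable_cost: "semistable Q \<alpha> V \<longleftrightarrow> (INF g \<in> GL Q \<alpha>. cost V g) > 0"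
  by (simp add: semistable_def cost_def)

lemma hat_act_entry:
  assumes V: "is_representation Q \<alpha> V" and g: "g \<in> GL Q \<alpha>" and a: "a \<in> arcs Q"
    and pq: "p < dim" "q < dim"
  shows "cmod (hat (act Q \<alpha> g V) a $$ (p, q)) \<le> sqrt (cost V g)"
proof (cases "vertex p = head Q a \<and> vertex q = tail Q a")
  case True
  let ?A = "act Q \<alpha> g V a"
  have A: "?A \<in> carrier_mat (\<alpha> (head Q a)) (\<alpha> (tail Q a))" by (rule act_carrier[OF V g a])
  have rs: "coord p < dim_row ?A" "coord q < dim_col ?A"
    using True basis_nth[OF pq(1)] basis_nth[OF pq(2)] A by auto
  have "(cmod (?A $$ (coord p, coord q)))\<^sup>2 \<le> (\<Sum>j<dim_col ?A. (cmod (?A $$ (coord p, j)))\<^sup>2)"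
    using rs by (intro member_le_sum) auto
  also have "\<dots> \<le> (\<Sum>i<dim_row ?A. \<Sum>j<dim_col ?A. (cmod (?A $$ (i, j)))\<^sup>2)"
    using rs by (intro member_le_sum[of _ _ "\<lambda>i. \<Sum>j<dim_col ?A. (cmod (?A $$ (i, j)))\<^sup>2"]) (auto intro: sum_nonneg)
  also have "\<dots> = (frobenius_norm ?A)\<^sup>2"
    by (simp add: frobenius_norm_def sum_nonneg)
  also have "\<dots> \<le> cost V g"
    unfolding cost_def using a by (intro member_le_sum) auto
  finally have "cmod (?A $$ (coord p, coord q)) \<le> sqrt (cost V g)" by (rule real_le_rsqrt)
  then show ?thesis using pq True by (simp add: hat_def)
qed (use pq in \<open>auto simp: hat_def cost_nonneg\<close>)

lemma semistable_if_not_nilpotent: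
  assumes V: "is_representation Q \<alpha> V" and nn: "\<not> nilpotent V"
  shows "semistable Q \<alpha> V"
proof -
  have hc: "hat V ` arcs Q \<subseteq> carrier_mat dim dim" by auto
  have "\<exists>ws. set ws \<subseteq> hat V ` arcs Q \<and> ws \<noteq> [] \<and> mtrace (mprod dim ws) \<noteq> 0"
  proof (rule ccontr)
    assume "\<not> ?thesis"
    then have tr: "\<And>ws. set ws \<subseteq> hat V ` arcs Q \<Longrightarrow> ws \<noteq> [] \<Longrightarrow> mtrace (mprod dim ws) = 0" by blast
    show False using nn words_vanish[OF hc tr] unfolding nilpotent_def by blast
  qed
  then obtain ws where ws: "set ws \<subseteq> hat V ` arcs Q" "ws \<noteq> []" "mtrace (mprod dim ws) \<noteq> 0"
    by blast
  have "ws \<in> map (hat V) ` lists (arcs Q)"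
    using ws(1) unfolding lists_image[symmetric] by (simp add: lists_eq_set)
  then obtain as where as: "ws = map (hat V) as" "set as \<subseteq> arcs Q"
    by (auto simp: lists_eq_set)
  define \<tau> where "\<tau> = cmod (mtrace (mprod dim ws))"
  define L where "L = length ws"
  have \<tau>: "\<tau> > 0" using ws(3) by (simp add: \<tau>_def)
  have L: "L \<ge> 1" using ws(2) by (cases ws) (auto simp: L_def)
  \<comment> \<open>The invariant trace is the sum of \<open>dim\<close> diagonal entries of the
    same word in the transformed matrices, whose entries are at most the square root of the
    cost.\<close>
  have bound: "\<tau> \<le> real dim * (real dim * sqrt (cost V g)) ^ L" if g: "g \<in> GL Q \<alpha>" for g
  proof -
    let ?h = "\<lambda>i. inv\<^bsub>matrix_ring (\<alpha> i)\<^esub> (g i)"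
    have GH: "block g * block ?h = 1\<^sub>m dim" "block ?h * block g = 1\<^sub>m dim"
      by (rule block_mult_inverse; use GL_inverse[OF g] in simp)+
    have wc: "set ws \<subseteq> carrier_mat dim dim" using ws(1) by auto
    let ?us = "map (hat (act Q \<alpha> g V)) as"
    have "?us = map (\<lambda>A. block g * A * block ?h) ws"
      using as by (auto simp: hat_act[OF V g])
    then have "mprod dim ?us = block g * mprod dim ws * block ?h"
      using mprod_conjugate[OF block_carrier block_carrier GH wc] by simp
    then have "mtrace (mprod dim ?us) = mtrace (mprod dim ws)"
      using mtrace_similar[OF block_carrier block_carrier GH(2) mprod_carrier[OF wc]] by simp
    moreover have uc: "mprod dim ?us \<in> carrier_mat dim dim" by (rule mprod_carrier) auto
    ultimately have "\<tau> = cmod (\<Sum>p<dim. mprod dim ?us $$ (p, p))"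
      by (simp add: \<tau>_def mtrace_def)
    also have "\<dots> \<le> (\<Sum>p<dim. cmod (mprod dim ?us $$ (p, p)))" by (rule norm_sum)
    also have "\<dots> \<le> (\<Sum>p<dim. (real dim * sqrt (cost V g)) ^ length ?us)"
    proof (rule sum_mono)
      fix p assume p: "p \<in> {..<dim}"
      show "cmod (mprod dim ?us $$ (p, p)) \<le> (real dim * sqrt (cost V g)) ^ length ?us"
      proof (rule mprod_entry_bound)
        show "set ?us \<subseteq> carrier_mat dim dim" by auto
        show "0 \<le> sqrt (cost V g)" by (simp add: cost_nonneg)
        show "cmod (A $$ (p, q)) \<le> sqrt (cost V g)" if "A \<in> set ?us" "p < dim" "q < dim" for A p q
          using that as(2) hat_act_entry[OF V g] by auto
      qed (use p in simp_all)
    qed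
    finally show ?thesis by (simp add: L_def as(1))
  qed
  have n: "dim > 0"
  proof (rule ccontr)
    assume "\<not> dim > 0"
    then show False using GL_nonempty bound \<tau> by fastforce
  qed
  \<comment> \<open>\<open>t \<le> 1\<close> allows \<open>t ^ L\<close> to be replaced by
    \<open>t\<close>, and the factor 2 turns \<open>bound\<close> into \<tau> \<le> \<tau> /
    2.\<close>
  define t where "t = min 1 (\<tau> / (2 * real dim * real dim ^ L))"
  have t: "0 < t" "t \<le> 1" using \<tau> n by (auto simp: t_def)
  have "t\<^sup>2 \<le> cost V g" if g: "g \<in> GL Q \<alpha>" for g
  proof (rule ccontr)
    assume "\<not> t\<^sup>2 \<le> cost V g"
    then have s: "sqrt (cost V g) \<le> t" using t by (intro real_le_lsqrt) (auto simp: cost_nonneg)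
    have "\<tau> \<le> real dim * (real dim * t) ^ L"
      using bound[OF g] s cost_nonneg[of V g]
      by (smt (verit) mult_left_mono of_nat_0_le_iff power_mono real_sqrt_ge_zero zero_le_mult_iff)
    also have "\<dots> = real dim * real dim ^ L * t ^ L" by (simp add: power_mult_distrib)
    also have "\<dots> \<le> real dim * real dim ^ L * t"
      using t L power_decreasing[of 1 L t] by (intro mult_left_mono) auto
    also have "\<dots> \<le> real dim * real dim ^ L * (\<tau> / (2 * real dim * real dim ^ L))"
      by (intro mult_left_mono) (auto simp: t_def)
    also have "\<dots> = \<tau> / 2" using n by simp
    finally show False using \<tau> by simp
  qed
  then have "t\<^sup>2 \<le> (INF g \<in> GL Q \<alpha>. cost V g)"
    using GL_nonempty by (intro cINF_greatest)
  then show ?thesis using t by (simp add: semistable_cost less_le_trans[of 0 "t\<^sup>2"])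
qed

text \<open>
  For a nilpotent representation the form \<open>\<Sum>\<^sub>w c\<^bsup>|w|\<^esup> |V\<^sub>w x|\<^sup>2\<close>, summed over all paths \<open>w\<close> starting at
  \<open>i\<close>, is finite, and in the norms that it defines every \<open>V(a)\<close> has operator norm at most \<open>1 / \<surd>c\<close>.
\<close>

primrec path_form :: "(nat \<Rightarrow> complex mat) \<Rightarrow> real \<Rightarrow> nat \<Rightarrow> nat \<Rightarrow> complex vec \<Rightarrow> real" where
  "path_form V c 0 i x = normsq x"
| "path_form V c (Suc k) i x = normsq x +
     c * (\<Sum>a\<in>{a \<in> arcs Q. tail Q a = i}. path_form V c k (head Q a) (V a *\<^sub>v x))"

definition embed :: "nat \<Rightarrow> complex vec \<Rightarrow> complex vec" where
  "embed i x = vec dim (\<lambda>p. if vertex p = i then x $ coord p else 0)"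

lemma embed_carrier [simp]: "embed i x \<in> carrier_vec dim"
  by (simp add: embed_def)

lemma embed_eq_0:
  assumes "i \<in> verts Q" "x \<in> carrier_vec (\<alpha> i)" "embed i x = 0\<^sub>v dim"
  shows "x = 0\<^sub>v (\<alpha> i)"
proof (rule eq_vecI)
  fix r assume "r < dim_vec (0\<^sub>v (\<alpha> i) :: complex vec)"
  then obtain p where p: "p < dim" "basis ! p = (i, r)"
    using exists_basis_nth[OF assms(1), of r] by auto
  have "embed i x $ p = x $ r" using p by (simp add: embed_def)
  then show "x $ r = 0\<^sub>v (\<alpha> i) $ r" using assms p \<open>r < _\<close> by simp
qed (use assms in simp)

lemma hat_embed:
  assumes a: "a \<in> arcs Q" and V: "V a \<in> carrier_mat (\<alpha> (head Q a)) (\<alpha> (tail Q a))"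
    and x: "x \<in> carrier_vec (\<alpha> (tail Q a))"
  shows "hat V a *\<^sub>v embed (tail Q a) x = embed (head Q a) (V a *\<^sub>v x)"
proof (rule eq_vecI)
  fix p assume "p < dim_vec (embed (head Q a) (V a *\<^sub>v x))"
  then have p: "p < dim" by (simp add: embed_def)
  let ?t = "tail Q a"
  have t: "?t \<in> verts Q" using a by (rule tail_in_verts)
  have "(hat V a *\<^sub>v embed ?t x) $ p = (\<Sum>s<dim. hat V a $$ (p, s) * embed ?t x $ s)"
    using p by (simp add: hat_def embed_def scalar_prod_def atLeast0LessThan)
  also have "\<dots> = (\<Sum>s<dim. if vertex s = ?t then (if vertex p = head Q a
      then V a $$ (coord p, coord s) * x $ coord s else 0) else 0)"
    by (intro sum.cong) (use p in \<open>auto simp: embed_def hat_def\<close>)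
  also have "\<dots> = (\<Sum>r<\<alpha> ?t. if vertex p = head Q a then V a $$ (coord p, r) * x $ r else 0)"
    by (rule sum_vertex[OF t])
  also have "\<dots> = embed (head Q a) (V a *\<^sub>v x) $ p"
    using basis_nth[OF p] p V x by (auto simp: embed_def scalar_prod_def atLeast0LessThan)
  finally show "(hat V a *\<^sub>v embed ?t x) $ p = embed (head Q a) (V a *\<^sub>v x) $ p" .
qed (simp add: hat_def embed_def)

text \<open>The two truncations differ by the terms of the paths of length \<open>Suc k\<close>. The
  first arc of a path is the last letter of its word, so the induction splits words at their right
  end.\<close>

lemma path_form_stable:
  assumes V: "is_representation Q \<alpha> V"
    and "i \<in> verts Q" "x \<in> carrier_vec (\<alpha> i)"
    and "\<And>ws. set ws \<subseteq> hat V ` arcs Q \<Longrightarrow> length ws = Suc k \<Longrightarrow> mprod dim ws *\<^sub>v embed i x = 0\<^sub>v dim"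
  shows "path_form V c (Suc k) i x = path_form V c k i x"
  using assms(2-)
proof (induction k arbitrary: i x)
  case 0
  have "normsq (V a *\<^sub>v x) = 0" if a: "a \<in> arcs Q" "tail Q a = i" for a
  proof -
    have Va: "V a \<in> carrier_mat (\<alpha> (head Q a)) (\<alpha> (tail Q a))"
      using V a unfolding is_representation_def by blast
    have "mprod dim [hat V a] *\<^sub>v embed i x = 0\<^sub>v dim" using 0(3)[of "[hat V a]"] a by simp
    then have "embed (head Q a) (V a *\<^sub>v x) = 0\<^sub>v dim"
      using hat_embed[where V = V, OF a(1) Va] 0(2) a right_mult_one_mat[OF hat_carrier] by simp
    from embed_eq_0[OF head_in_verts[OF a(1)] _ this] show ?thesis
      using Va 0(2) a by (simp add: normsq_def)
  qed
  then show ?case by simp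
next
  case (Suc k)
  have "path_form V c (Suc k) (head Q a) (V a *\<^sub>v x) = path_form V c k (head Q a) (V a *\<^sub>v x)"
    if a: "a \<in> arcs Q" "tail Q a = i" for a
  proof (rule Suc.IH)
    have Va: "V a \<in> carrier_mat (\<alpha> (head Q a)) (\<alpha> (tail Q a))"
      using V a unfolding is_representation_def by blast
    show "head Q a \<in> verts Q" using a by simp
    show "V a *\<^sub>v x \<in> carrier_vec (\<alpha> (head Q a))" using Va Suc.prems(2) a by auto
    fix ws assume ws: "set ws \<subseteq> hat V ` arcs Q" "length ws = Suc k"
    have wc: "set ws \<subseteq> carrier_mat dim dim" using ws by auto
    have "mprod dim (ws @ [hat V a]) = mprod dim ws * hat V a"
      using mprod_append[OF wc, of "[hat V a]"] right_mult_one_mat[OF hat_carrier] by simp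
    then have "mprod dim ws *\<^sub>v (hat V a *\<^sub>v embed i x) = mprod dim (ws @ [hat V a]) *\<^sub>v embed i x"
      using assoc_mult_mat_vec[OF mprod_carrier[OF wc] hat_carrier embed_carrier] by simp
    also have "\<dots> = 0\<^sub>v dim" using Suc.prems(3)[of "ws @ [hat V a]"] ws a by simp
    finally show "mprod dim ws *\<^sub>v embed (head Q a) (V a *\<^sub>v x) = 0\<^sub>v dim"
      using hat_embed[where V = V, OF a(1) Va] Suc.prems(2) a by simp
  qed
  then have "(\<Sum>a\<in>{a \<in> arcs Q. tail Q a = i}. path_form V c (Suc k) (head Q a) (V a *\<^sub>v x)) =
      (\<Sum>a\<in>{a \<in> arcs Q. tail Q a = i}. path_form V c k (head Q a) (V a *\<^sub>v x))"
    by (intro sum.cong) auto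
  then show ?case by (simp only: path_form.simps(2))
qed

lemma path_form_ge: "c \<ge> 0 \<Longrightarrow> normsq x \<le> path_form V c k i x"
proof (induction k arbitrary: i x)
  case (Suc k)
  have "0 \<le> path_form V c k j y" for j y
    using Suc.IH[OF Suc.prems, of y j] normsq_nonneg[of y] by linarith
  then show ?case using Suc.prems by (simp add: sum_nonneg)
qed simp

lemma is_form_path_form:
  assumes V: "is_representation Q \<alpha> V"
  shows "is_form (\<alpha> i) (path_form V c k i)"
proof (induction k arbitrary: i)
  case 0
  show ?case using is_form_normsq by simp
next
  case (Suc k)
  have "is_form (\<alpha> i) (\<lambda>x. path_form V c k (head Q a) (V a *\<^sub>v x))" if "a \<in> {a \<in> arcs Q. tail Q a = i}" for a
  proof (rule is_form_comp[OF _ Suc.IH])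
    have "V a \<in> carrier_mat (\<alpha> (head Q a)) (\<alpha> (tail Q a))"
      using V that unfolding is_representation_def by blast
    then show "V a \<in> carrier_mat (\<alpha> (head Q a)) (\<alpha> i)" using that by simp
  qed
  then have "is_form (\<alpha> i) (\<lambda>x. normsq x + c * (\<Sum>a\<in>{a \<in> arcs Q. tail Q a = i}. path_form V c k (head Q a) (V a *\<^sub>v x)))"
    by (intro is_form_add is_form_normsq is_form_scale is_form_sum) auto
  then show ?case by simp
qed

text \<open>\<open>g\<close> carries the path forms to the standard norms. The Frobenius norm is
  then summed over the images of the unit vectors, each with squared norm at most
  \<open>1 / c\<close>, which yields the factor \<alpha> at the tail.\<close>

lemma small_cost_if_nilpotent:
  assumes V: "is_representation Q \<alpha> V" and nil: "nilpotent V" and c: "c > 0"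
  shows "\<exists>g \<in> GL Q \<alpha>. cost V g \<le> (\<Sum>a\<in>arcs Q. real (\<alpha> (tail Q a))) / c"
proof -
  let ?q = "path_form V c dim"
  have "\<exists>R \<in> carrier_mat (\<alpha> i) (\<alpha> i). det R \<noteq> 0 \<and> (\<forall>x \<in> carrier_vec (\<alpha> i). ?q i x = normsq (R *\<^sub>v x))" for i
    by (rule form_eq_normsq[OF is_form_path_form[OF V]]) (use c path_form_ge in simp)
  then obtain R where R: "\<And>i. R i \<in> carrier_mat (\<alpha> i) (\<alpha> i)" "\<And>i. det (R i) \<noteq> 0"
    "\<And>i x. x \<in> carrier_vec (\<alpha> i) \<Longrightarrow> ?q i x = normsq (R i *\<^sub>v x)" by metis
  define g where "g = restrict R (verts Q)"
  have gR: "g i = R i" if "i \<in> verts Q" for i using that by (simp add: g_def)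
  have g: "g \<in> GL Q \<alpha>"
    unfolding GL_def g_def using det_non_zero_imp_unit[OF R(1,2)] by auto
  \<comment> \<open>A word of length \<open>Suc dim\<close> contains a vanishing word of length
    \<open>dim\<close>, so the recursion is stationary from \<open>dim\<close> on.\<close>
  have stable: "path_form V c (Suc dim) i x = ?q i x" if "i \<in> verts Q" "x \<in> carrier_vec (\<alpha> i)" for i x
  proof (rule path_form_stable[OF V that])
    fix ws assume ws: "set ws \<subseteq> hat V ` arcs Q" "length ws = Suc dim"
    then obtain A us where us: "ws = A # us" by (cases ws) auto
    have "mprod dim us = 0\<^sub>m dim dim" using nil ws us by (simp add: nilpotent_def)
    then have "mprod dim ws = 0\<^sub>m dim dim"
      using ws us right_mult_zero_mat[OF hat_carrier] by auto
    then show "mprod dim ws *\<^sub>v embed i x = 0\<^sub>v dim" by (auto intro!: eq_vecI simp: embed_def)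
  qed
  \<comment> \<open>The summand of the single arc \<open>a\<close> in the recursion for
    \<open>Suc dim\<close>; stability brings the length back to \<open>dim\<close>.\<close>
  have contract: "c * ?q (head Q a) (V a *\<^sub>v x) \<le> ?q (tail Q a) x"
    if a: "a \<in> arcs Q" and x: "x \<in> carrier_vec (\<alpha> (tail Q a))" for a x
  proof -
    let ?A = "{b \<in> arcs Q. tail Q b = tail Q a}"
    have nn: "0 \<le> ?q j y" for j y
      using path_form_ge[of c y V dim j] normsq_nonneg[of y] c by linarith
    have "?q (head Q a) (V a *\<^sub>v x) \<le> (\<Sum>b\<in>?A. ?q (head Q b) (V b *\<^sub>v x))"
      using a nn by (intro member_le_sum[of a ?A "\<lambda>b. ?q (head Q b) (V b *\<^sub>v x)"]) auto
    then have "c * ?q (head Q a) (V a *\<^sub>v x) \<le> path_form V c (Suc dim) (tail Q a) x"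
      using c normsq_nonneg[of x] by (simp add: add_increasing)
    then show ?thesis using stable[OF tail_in_verts[OF a] x] by simp
  qed
  have "(frobenius_norm (act Q \<alpha> g V a))\<^sup>2 \<le> real (\<alpha> (tail Q a)) / c" if a: "a \<in> arcs Q" for a
  proof -
    let ?t = "tail Q a" and ?h = "head Q a" and ?B = "act Q \<alpha> g V a"
    let ?gi = "inv\<^bsub>matrix_ring (\<alpha> ?t)\<^esub> (g ?t)"
    have Va: "V a \<in> carrier_mat (\<alpha> ?h) (\<alpha> ?t)" using V a by (simp add: is_representation_def)
    note t = GL_inverse[OF g tail_in_verts[OF a]] and h = GL_inverse[OF g head_in_verts[OF a]]
    have "normsq (?B *\<^sub>v unit_vec (\<alpha> ?t) j) \<le> 1 / c" if j: "j < \<alpha> ?t" for j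
    proof -
      let ?e = "unit_vec (\<alpha> ?t) j :: complex vec"
      let ?y = "?gi *\<^sub>v ?e"
      have y: "?y \<in> carrier_vec (\<alpha> ?t)" using t(2) by auto
      have Vy: "V a *\<^sub>v ?y \<in> carrier_vec (\<alpha> ?h)" using Va y by auto
      have "?B *\<^sub>v ?e = (g ?h * V a) *\<^sub>v ?y"
        unfolding act_def by (rule assoc_mult_mat_vec[of _ "\<alpha> ?h" "\<alpha> ?t" _ "\<alpha> ?t"]) (use h Va t in auto)
      also have "\<dots> = g ?h *\<^sub>v (V a *\<^sub>v ?y)"
        by (rule assoc_mult_mat_vec[OF h(1) Va y])
      finally have "normsq (?B *\<^sub>v ?e) = ?q ?h (V a *\<^sub>v ?y)"
        using R(3)[OF Vy] gR a by simp
      then have "c * normsq (?B *\<^sub>v ?e) \<le> ?q ?t ?y" using contract[OF a y] by simp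
      also have "?q ?t ?y = normsq (g ?t *\<^sub>v ?y)" using R(3)[OF y] gR a by simp
      also have "g ?t *\<^sub>v ?y = ?e"
        using assoc_mult_mat_vec[OF t(1,2), of ?e] t(3) by simp
      finally have "c * normsq (?B *\<^sub>v ?e) \<le> 1" by (simp add: normsq_unit_vec[OF j])
      then show ?thesis using c by (simp add: field_simps)
    qed
    then have "(\<Sum>j<\<alpha> ?t. normsq (?B *\<^sub>v unit_vec (\<alpha> ?t) j)) \<le> (\<Sum>j<\<alpha> ?t. 1 / c)"
      by (intro sum_mono) auto
    then show ?thesis
      unfolding frobenius_norm_columns[OF act_carrier[OF V g a]] by simp
  qed
  then have "cost V g \<le> (\<Sum>a\<in>arcs Q. real (\<alpha> (tail Q a)) / c)"
    unfolding cost_def by (intro sum_mono)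
  then show ?thesis using g by (auto simp: sum_divide_distrib)
qed

theorem semistable_iff_not_nilpotent:
  assumes V: "is_representation Q \<alpha> V"
  shows "semistable Q \<alpha> V \<longleftrightarrow> \<not> nilpotent V"
proof
  assume s: "semistable Q \<alpha> V"
  show "\<not> nilpotent V"
  proof
    assume nil: "nilpotent V"
    define I where "I = (INF g \<in> GL Q \<alpha>. cost V g)"
    define K where "K = (\<Sum>a\<in>arcs Q. real (\<alpha> (tail Q a)))"
    have I: "I > 0" using s by (simp add: semistable_cost I_def)
    have K: "K \<ge> 0" by (simp add: K_def sum_nonneg)
    \<comment> \<open>This makes \<open>K / c\<close> smaller than half of \<open>I\<close>; the
      summand 1 keeps \<open>c\<close> positive for \<open>K = 0\<close>.\<close>
    define c where "c = 2 * (K + 1) / I"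
    have c: "c > 0" using I K by (simp add: c_def)
    obtain g where g: "g \<in> GL Q \<alpha>" "cost V g \<le> K / c"
      using small_cost_if_nilpotent[OF V nil c] by (auto simp: K_def)
    have "I \<le> cost V g"
      unfolding I_def by (rule cINF_lower[OF _ g(1)]) (auto intro!: bdd_belowI[of _ 0] simp: cost_nonneg)
    also have "\<dots> \<le> K / c" by (rule g(2))
    also have "\<dots> = I * (K / (2 * (K + 1)))" using I K by (simp add: c_def field_simps)
    also have "\<dots> < I * 1" using I K by (intro mult_strict_left_mono) (auto simp: field_simps)
    finally show False by simp
  qed
qed (rule semistable_if_not_nilpotent[OF V])

end

section \<open>The exponent of matrix multiplication is at least two\<close>

fun nums :: "tree \<Rightarrow> complex set" where
  "nums Tip = {}"
| "nums (Num x) = {x}"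
| "nums (Node x y) = nums x \<union> nums y"

lemma run_nums: "run P s t r \<Longrightarrow> \<exists>N. finite N \<and> card N \<le> t \<and> nums r \<subseteq> nums s \<union> {0, 1} \<union> N"
proof (induction rule: run.induct)
  case (fork p s t x q u y)
  then obtain N N' where "finite N" "card N \<le> t" "nums x \<subseteq> nums s \<union> {0, 1} \<union> N"
    "finite N'" "card N' \<le> u" "nums y \<subseteq> nums s \<union> {0, 1} \<union> N'" by blast
  then show ?case by (intro exI[of _ "N \<union> N'"]) (auto intro: order_trans[OF card_Un_le])
next
  case (seq p s t s' q u s'')
  then obtain N N' where "finite N" "card N \<le> t" "nums s' \<subseteq> nums s \<union> {0, 1} \<union> N"
    "finite N'" "card N' \<le> u" "nums s'' \<subseteq> nums s' \<union> {0, 1} \<union> N'" by blast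
  then show ?case by (intro exI[of _ "N \<union> N'"]) (auto intro: order_trans[OF card_Un_le])
next
  case (if_true c s t x y p u s' q)
  then obtain N where "finite N" "card N \<le> u" "nums s' \<subseteq> nums s \<union> {0, 1} \<union> N" by blast
  then show ?case by (intro exI[of _ N]) auto
next
  case (if_false c s t q u s' p)
  then obtain N where "finite N" "card N \<le> u" "nums s' \<subseteq> nums s \<union> {0, 1} \<union> N" by blast
  then show ?case by (intro exI[of _ N]) auto
next
  case (while_true c s t x y p u s' v s'')
  then obtain N N' where "finite N" "card N \<le> u" "nums s' \<subseteq> nums s \<union> {0, 1} \<union> N"
    "finite N'" "card N' \<le> v" "nums s'' \<subseteq> nums s' \<union> {0, 1} \<union> N'" by blast
  then show ?case by (intro exI[of _ "N \<union> N'"]) (auto intro: order_trans[OF card_Un_le])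
next
  case (add x y)
  show ?case by (intro exI[of _ "{x + y}"]) auto
next
  case (sub x y)
  show ?case by (intro exI[of _ "{x - y}"]) auto
next
  case (mul x y)
  show ?case by (intro exI[of _ "{x * y}"]) auto
next
  case (div y x)
  show ?case by (intro exI[of _ "{x / y}"]) auto
next
  case (is_zero x)
  have "nums (enc_bool b) = {}" for b by (cases b) auto
  then show ?case by (intro exI[of _ "{}"]) auto
qed (auto intro: exI[of _ "{}"])

lemma nums_enc_list: "nums (enc_list xs) = (\<Union>x\<in>set xs. nums x)"
  by (induction xs) auto

lemma nums_enc_mat: "nums (enc_mat A) = (\<Union>i<dim_row A. \<Union>j<dim_col A. {A $$ (i, j)})"
  by (simp add: enc_mat_def nums_enc_list mat_to_list_def atLeast0LessThan)

lemma nums_enc_nat: "nums (enc_nat n) = {}"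
  by (auto simp: enc_nat_def nums_enc_list)

text \<open>
  A rank one product \<open>x y\<^sup>T\<close> has \<open>n\<^sup>2\<close> different entries for suitable \<open>x\<close> and \<open>y\<close>, but only about \<open>2 n\<close>
  numbers occur in the input.
\<close>

lemma matmul_lower_bound:
  assumes "n \<ge> 1" and P: "\<And>A B. A \<in> carrier_mat n n \<Longrightarrow> B \<in> carrier_mat n n \<Longrightarrow>
      \<exists>t. run P (Node (enc_nat n) (Node (enc_mat A) (enc_mat B))) t (enc_mat (A * B)) \<and> real t \<le> T"
  shows "real n ^ 2 \<le> T + 2 * real n + 3"
proof -
  \<comment> \<open>The entries of the product are powers of 2 with exponents
    \<open>n * j + i\<close>, which run through all numbers below \<open>n * n\<close>.\<close>
  define A :: "complex mat" where "A = mat n n (\<lambda>(i, j). if j = 0 then 2 ^ i else 0)"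
  define B :: "complex mat" where "B = mat n n (\<lambda>(i, j). if i = 0 then 2 ^ (n * j) else 0)"
  have AB: "A \<in> carrier_mat n n" "B \<in> carrier_mat n n" by (simp_all add: A_def B_def)
  obtain t where t: "run P (Node (enc_nat n) (Node (enc_mat A) (enc_mat B))) t (enc_mat (A * B))" "real t \<le> T"
    using P[OF AB] by blast
  obtain N where N: "finite N" "card N \<le> t"
    "nums (enc_mat (A * B)) \<subseteq> nums (Node (enc_nat n) (Node (enc_mat A) (enc_mat B))) \<union> {0, 1} \<union> N"
    using run_nums[OF t(1)] by blast
  have entry: "(A * B) $$ (i, j) = 2 ^ (n * j + i)" if ij: "i < n" "j < n" for i j
  proof -
    have "(A * B) $$ (i, j) = (\<Sum>k<n. A $$ (i, k) * B $$ (k, j))"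
      using AB ij by (simp add: scalar_prod_def atLeast0LessThan)
    also have "\<dots> = (\<Sum>k<n. if k = 0 then 2 ^ i * 2 ^ (n * j) else 0)"
      by (intro sum.cong) (use ij in \<open>auto simp: A_def B_def\<close>)
    finally show ?thesis using ij by (simp add: power_add mult.commute)
  qed
  have "(\<lambda>k. 2 ^ k :: complex) ` {..<n * n} \<subseteq> nums (enc_mat (A * B))"
  proof
    fix z :: complex assume "z \<in> (\<lambda>k. 2 ^ k) ` {..<n * n}"
    then obtain k where k: "k < n * n" "z = 2 ^ k" by auto
    have "k div n < n" "k mod n < n"
      using k(1) assms(1) by (simp_all add: less_mult_imp_div_less)
    then show "z \<in> nums (enc_mat (A * B))"
      unfolding nums_enc_mat using AB entry[of "k mod n" "k div n"] k
      by (intro UN_I[of "k mod n"] UN_I[of "k div n"]) auto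
  qed
  also have "\<dots> \<subseteq> (\<lambda>i. 2 ^ i) ` {..<n} \<union> (\<lambda>j. 2 ^ (n * j)) ` {..<n} \<union> {0, 1} \<union> N" (is "_ \<subseteq> ?R")
  proof -
    have "nums (enc_mat A) \<subseteq> (\<lambda>i. 2 ^ i) ` {..<n} \<union> {0}" "nums (enc_mat B) \<subseteq> (\<lambda>j. 2 ^ (n * j)) ` {..<n} \<union> {0}"
      by (auto simp: nums_enc_mat A_def B_def split: if_splits)
    then show ?thesis using N(3) by (auto simp: nums_enc_nat)
  qed
  finally have sub: "(\<lambda>k. 2 ^ k :: complex) ` {..<n * n} \<subseteq> ?R" .
  have "inj (\<lambda>k. 2 ^ k :: complex)"
  proof (rule injI)
    fix k l :: nat assume "(2 :: complex) ^ k = 2 ^ l"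
    then have "cmod (2 ^ k) = cmod (2 ^ l)" by (rule arg_cong)
    then show "k = l" by (simp add: norm_power)
  qed
  then have "n * n = card ((\<lambda>k. 2 ^ k :: complex) ` {..<n * n})"
    by (subst card_image) (auto intro: inj_on_subset)
  also have "\<dots> \<le> card ?R" by (rule card_mono[OF _ sub]) (use N in auto)
  also have "\<dots> \<le> (card ((\<lambda>i. 2 ^ i :: complex) ` {..<n}) + card ((\<lambda>j. 2 ^ (n * j) :: complex) ` {..<n})) +
      card {0, 1 :: complex} + card N"
    by (intro order_trans[OF card_Un_le] add_mono order_refl)
  also have "\<dots> \<le> (n + n) + 2 + t"
    using card_image_le[of "{..<n}" "\<lambda>i. 2 ^ i :: complex"] card_image_le[of "{..<n}" "\<lambda>j. 2 ^ (n * j) :: complex"] N(2)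
    by simp
  finally have "real (n * n) \<le> real ((n + n) + 2 + t)" by (rule of_nat_mono)
  then show ?thesis using t(2) by (simp add: power2_eq_square)
qed

lemma matmul_exponent_ge_2:
  assumes "matmul_exponent \<omega>"
  shows "\<omega> \<ge> 2"
proof (rule ccontr)
  assume "\<not> \<omega> \<ge> 2"
  define e where "e = 2 - \<omega>"
  have e: "e > 0" using \<open>\<not> \<omega> \<ge> 2\<close> by (simp add: e_def)
  obtain P C where P: "\<And>n A B. n \<ge> 1 \<Longrightarrow> A \<in> carrier_mat n n \<Longrightarrow> B \<in> carrier_mat n n \<Longrightarrow>
        \<exists>t. run P (Node (enc_nat n) (Node (enc_mat A) (enc_mat B))) t (enc_mat (A * B)) \<and>
            real t \<le> C * real n powr \<omega>"
    using assms unfolding matmul_exponent_def by metis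
  define b where "b = max 1 (2 * C)"
  \<comment> \<open>The bound 6 lets half of \<open>n ^ 2\<close> absorb the summand
    \<open>2 * n + 3\<close>; the other bound makes \<open>n powr e\<close> exceed
    \<open>2 * C\<close>.\<close>
  obtain n :: nat where n: "real n > max 6 (b powr (1 / e))" using reals_Archimedean2 by blast
  have lower: "real n ^ 2 \<le> C * real n powr \<omega> + 2 * real n + 3"
    by (rule matmul_lower_bound[OF _ P]) (use n in auto)
  have "6 * real n \<le> real n ^ 2"
    unfolding power2_eq_square using n by (intro mult_right_mono) auto
  then have "real n ^ 2 \<le> 2 * C * real n powr \<omega>" using lower n by simp
  moreover have "real n ^ 2 = real n powr \<omega> * real n powr e"
    using n by (simp add: e_def powr_add[symmetric])
  ultimately have "real n powr \<omega> * real n powr e \<le> real n powr \<omega> * (2 * C)"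
    by (simp add: mult_ac)
  then have "real n powr e \<le> 2 * C" using n by simp
  moreover have "(b powr (1 / e)) powr e < real n powr e"
    using n e by (intro powr_less_mono2) auto
  then have "b < real n powr e" using e by (simp add: powr_powr b_def)
  ultimately show False by (simp add: b_def)
qed

section \<open>The program\<close>

text \<open>The padded matrix arises by concatenation alone, hence at cost 0. In the innermost body,
  index 0 is the vertex of a column block, 1 the row, 2 the vertex of the row block and 3 the
  arc.\<close>

definition Rows :: prog where
  "Rows = Concat_Map (arg 3)
     (If_Node (Eq_nat (fst_of (arg 0)) (fst_of (snd_of (arg 1))))
       (Map (snd_of (snd_of (arg 1)))
         (Concat_Map (arg 5)
           (If_Node (Eq_nat (fst_of (arg 0)) (fst_of (arg 3))) (arg 1) (Map (snd_of (arg 0)) Make_Zero))))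
       (Map (snd_of (arg 0)) (Map (arg 4) Make_Zero)))"

text \<open>The flattening is what is tested for linear dependence, the matrix itself is what is
  selected.\<close>

definition Hats :: prog where
  "Hats = Map (arg 3) (Let_in Rows (Fork (Concat_Map (arg 0) (arg 0)) (arg 0)))"

text \<open>\<open>n\<close> and \<open>n * n\<close> are obtained by concatenating unary numbers,
  at no cost. Dimension 0, where matrix multiplication is not specified, has its own branch; all
  norms are 0 there and the answer is negative.\<close>

definition (in matmul_program) Main_Prog :: prog where
  "Main_Prog = Seq (Fork Left (Fork Right Make_Tip))
     (Let_in (Concat_Map (arg 0) (snd_of (arg 0)))
       (If_Node (arg 0)
         (Let_in (Concat_Map (arg 0) (arg 1))
           (Let_in (Stage1 Hats)
             (If_Node (Seq (Fork (arg 0) (Fork (arg 2) Make_Tip)) Stage2)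
               (Fork Make_Tip Make_Tip) Make_Tip)))
         Make_Tip))"

section \<open>Padded matrices as lists of rows\<close>

lemma mv_mat_to_list:
  assumes "A \<in> carrier_mat n n" "x \<in> carrier_vec n"
  shows "mv (mat_to_list A) (list_of_vec x) = list_of_vec (A *\<^sub>v x)"
proof (rule nth_equalityI)
  show "length (mv (mat_to_list A) (list_of_vec x)) = length (list_of_vec (A *\<^sub>v x))"
    by (simp add: mat_to_list_def)
  fix i assume "i < length (mv (mat_to_list A) (list_of_vec x))"
  then have i: "i < n" using assms by (simp add: mat_to_list_def)
  then show "mv (mat_to_list A) (list_of_vec x) ! i = list_of_vec (A *\<^sub>v x) ! i"
    using assms by (simp add: mv_def mat_to_list_def dot_sum scalar_prod_def atLeast0LessThan list_of_vec_index)
qed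

lemma foldr_mv_mprod:
  assumes "set Ms \<subseteq> carrier_mat n n" "x \<in> carrier_vec n"
  shows "foldr mv (map mat_to_list Ms) (list_of_vec x) = list_of_vec (mprod n Ms *\<^sub>v x)"
  using assms(1)
proof (induction Ms)
  case Nil
  then show ?case using assms(2) by simp
next
  case (Cons A Ms)
  have c: "A \<in> carrier_mat n n" "mprod n Ms \<in> carrier_mat n n"
    using Cons.prems mprod_carrier[of Ms n] by auto
  then show ?case
    using Cons mv_mat_to_list[OF c(1), of "mprod n Ms *\<^sub>v x"] assms(2) by simp
qed

lemma sq_rows_mat_to_list: "A \<in> carrier_mat n n \<Longrightarrow> sq_rows n (mat_to_list A)"
  by (auto simp: sq_rows_def mat_to_list_def)

lemma map_nth_index: "map (\<lambda>p. f (xs ! p)) [0..<length xs] = map f xs"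
  by (rule nth_equalityI) auto

context quiver_representation
begin

definition hats :: "(nat \<Rightarrow> complex mat) \<Rightarrow> complex list list list" where
  "hats V = map (\<lambda>a. mat_to_list (hat V a)) (sorted_list_of_set (arcs Q))"

lemma hats_sq_rows: "A \<in> set (hats V) \<Longrightarrow> sq_rows dim A"
  by (auto simp: hats_def intro: sq_rows_mat_to_list)

lemma nilpotent_iff_iter_images: "nilpotent V \<longleftrightarrow> iter_images dim (hats V) dim = []"
proof -
  have "nilpotent V \<longleftrightarrow> (\<forall>ws x. length ws = dim \<longrightarrow> set ws \<subseteq> set (hats V) \<longrightarrow> length x = dim \<longrightarrow>
    foldr mv ws x = replicate dim 0)"
  proof
    assume nil: "nilpotent V"
    show "\<forall>ws x. length ws = dim \<longrightarrow> set ws \<subseteq> set (hats V) \<longrightarrow> length x = dim \<longrightarrow>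
      foldr mv ws x = replicate dim 0"
    proof (intro allI impI)
      fix ws and x :: "complex list"
      assume ws: "length ws = dim" "set ws \<subseteq> set (hats V)" "length x = dim"
      have "set (hats V) = mat_to_list ` (hat V ` arcs Q)" by (auto simp: hats_def)
      then have "ws \<in> map mat_to_list ` lists (hat V ` arcs Q)"
        using ws(2) unfolding lists_image[symmetric] by (simp add: lists_eq_set)
      then obtain Ms where Ms: "ws = map mat_to_list Ms" "set Ms \<subseteq> hat V ` arcs Q"
        by (auto simp: lists_eq_set)
      have "mprod dim Ms = 0\<^sub>m dim dim" using nil Ms ws(1) by (simp add: nilpotent_def)
      moreover have "set Ms \<subseteq> carrier_mat dim dim" using Ms(2) hat_carrier by blast
      moreover have "vec_of_list x \<in> carrier_vec dim" using ws(3) by (intro carrier_vecI) simp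
      ultimately have "foldr mv ws (list_of_vec (vec_of_list x)) = list_of_vec (0\<^sub>m dim dim *\<^sub>v vec_of_list x)"
        using foldr_mv_mprod[of Ms dim "vec_of_list x"] Ms(1) by simp
      also have "0\<^sub>m dim dim *\<^sub>v vec_of_list x = 0\<^sub>v dim"
        using ws(3) by (intro eq_vecI) (auto simp: scalar_prod_def)
      also have "list_of_vec (0\<^sub>v dim) = replicate dim (0 :: complex)"
        by (intro nth_equalityI) (auto simp: list_of_vec_index)
      finally show "foldr mv ws x = replicate dim 0" by (simp add: list_vec)
    qed
  next
    assume R: "\<forall>ws x. length ws = dim \<longrightarrow> set ws \<subseteq> set (hats V) \<longrightarrow> length x = dim \<longrightarrow>
      foldr mv ws x = replicate dim 0"
    show "nilpotent V"
      unfolding nilpotent_def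
    proof (intro allI impI)
      fix Ms assume Ms: "set Ms \<subseteq> hat V ` arcs Q" "length Ms = dim"
      have Mc: "set Ms \<subseteq> carrier_mat dim dim" using Ms(1) by auto
      have c: "mprod dim Ms \<in> carrier_mat dim dim" by (rule mprod_carrier[OF Mc])
      show "mprod dim Ms = 0\<^sub>m dim dim"
      proof (rule eq_matI)
        fix i j assume ij: "i < dim_row (0\<^sub>m dim dim :: complex mat)" "j < dim_col (0\<^sub>m dim dim :: complex mat)"
        let ?e = "unit_vec dim j :: complex vec"
        have "list_of_vec (mprod dim Ms *\<^sub>v ?e) = foldr mv (map mat_to_list Ms) (list_of_vec ?e)"
          by (rule foldr_mv_mprod[OF Mc, symmetric]) simp
        also have "\<dots> = replicate dim 0"
        proof -
          have "set (map mat_to_list Ms) \<subseteq> set (hats V)" using Ms(1) by (auto simp: hats_def)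
          then show ?thesis using R Ms(2) by simp
        qed
        finally have "list_of_vec (mprod dim Ms *\<^sub>v ?e) ! i = 0" using ij by simp
        moreover have "(mprod dim Ms *\<^sub>v ?e) $ i = mprod dim Ms $$ (i, j)"
          using ij c by (simp add: scalar_prod_right_unit[of _ dim])
        ultimately show "mprod dim Ms $$ (i, j) = 0\<^sub>m dim dim $$ (i, j)"
          using ij c by (simp add: list_of_vec_index)
      qed (use c in auto)
    qed
  qed
  then show ?thesis using iter_images_correct[of "hats V" dim] hats_sq_rows by blast
qed

text \<open>The padded matrix in the block order in which \<open>Rows\<close> produces it.\<close>

lemma mat_to_list_hat:
  assumes a: "a \<in> arcs Q" and V: "V a \<in> carrier_mat (\<alpha> (head Q a)) (\<alpha> (tail Q a))"
  shows "mat_to_list (hat V a) = concat (map (\<lambda>i. if i = head Q a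
     then map (\<lambda>row. concat (map (\<lambda>j. if j = tail Q a then row else replicate (\<alpha> j) 0) (sorted_list_of_set (verts Q))))
       (mat_to_list (V a))
     else replicate (\<alpha> i) (replicate dim 0)) (sorted_list_of_set (verts Q)))"
proof -
  let ?vs = "sorted_list_of_set (verts Q)"
  let ?e = "\<lambda>x y. if fst x = head Q a \<and> fst y = tail Q a then V a $$ (snd x, snd y) else 0"
  have "mat_to_list (hat V a) = map (\<lambda>p. map (\<lambda>q. ?e (basis ! p) (basis ! q)) [0..<length basis]) [0..<length basis]"
    by (simp add: mat_to_list_def hat_def length_basis)
  also have "\<dots> = map (\<lambda>x. map (?e x) basis) basis"
  proof -
    have "map (\<lambda>q. ?e x (basis ! q)) [0..<length basis] = map (?e x) basis" for x
      by (rule map_nth_index)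
    then show ?thesis by (simp only: map_nth_index[of "\<lambda>x. map (?e x) basis"])
  qed
  also have "\<dots> = concat (map (\<lambda>i. map (\<lambda>r. map (?e (i, r)) basis) [0..<\<alpha> i]) ?vs)"
    by (simp add: basis_def map_concat comp_def)
  also have "\<dots> = concat (map (\<lambda>i. if i = head Q a
     then map (\<lambda>row. concat (map (\<lambda>j. if j = tail Q a then row else replicate (\<alpha> j) 0) ?vs)) (mat_to_list (V a))
     else replicate (\<alpha> i) (replicate dim 0)) ?vs)"
  proof (intro arg_cong[of _ _ concat] map_cong refl)
    fix i
    have zero: "map (?e (i, r)) basis = replicate dim 0" if "i \<noteq> head Q a" for r
      using that by (simp add: map_replicate_const length_basis)
    have row: "map (?e (head Q a, r)) basis = concat (map (\<lambda>j. if j = tail Q a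
        then map (\<lambda>s. V a $$ (r, s)) [0..<\<alpha> (tail Q a)] else replicate (\<alpha> j) 0) ?vs)" for r
      by (auto simp: basis_def map_concat comp_def map_replicate_const intro!: arg_cong[of _ _ concat] map_cong)
    have V_list: "mat_to_list (V a) = map (\<lambda>r. map (\<lambda>s. V a $$ (r, s)) [0..<\<alpha> (tail Q a)]) [0..<\<alpha> (head Q a)]"
      using V by (simp add: mat_to_list_def)
    show "map (\<lambda>r. map (?e (i, r)) basis) [0..<\<alpha> i] = (if i = head Q a
      then map (\<lambda>row. concat (map (\<lambda>j. if j = tail Q a then row else replicate (\<alpha> j) 0) ?vs)) (mat_to_list (V a))
      else replicate (\<alpha> i) (replicate dim 0))"
    proof (cases "i = head Q a")
      case True
      show ?thesis unfolding True row V_list if_P[OF refl] map_map comp_def by (rule refl)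
    next
      case False
      then show ?thesis by (simp only: zero[OF False] if_False map_replicate_const length_upt diff_zero)
    qed
  qed
  finally show ?thesis .
qed

abbreviation enc_verts :: tree where
  "enc_verts \<equiv> enc_list (map (\<lambda>i. Node (enc_nat i) (enc_nat (\<alpha> i))) (sorted_list_of_set (verts Q)))"

abbreviation enc_arc :: "(nat \<Rightarrow> complex mat) \<Rightarrow> nat \<Rightarrow> tree" where
  "enc_arc V a \<equiv> Node (enc_nat (tail Q a)) (Node (enc_nat (head Q a)) (enc_mat (V a)))"

lemma ev_Rows:
  assumes a: "a \<in> arcs Q" and V: "V a \<in> carrier_mat (\<alpha> (head Q a)) (\<alpha> (tail Q a))"
  shows "ev Rows (Node (enc_arc V a) (Node d (Node (enc_nat dim) (Node enc_verts s)))) 0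
    (enc_rows (mat_to_list (hat V a)))"
proof -
  let ?p = "If_Node (Eq_nat (fst_of (arg 0)) (fst_of (arg 3))) (arg 1) (Map (snd_of (arg 0)) Make_Zero)"
  let ?q = "Map (snd_of (arg 0)) (Map (arg 4) Make_Zero)"
  let ?vs = "sorted_list_of_set (verts Q)"
  let ?s = "Node (enc_arc V a) (Node d (Node (enc_nat dim) (Node enc_verts s)))"
  let ?row = "\<lambda>row. concat (map (\<lambda>j. if j = tail Q a then row else replicate (\<alpha> j) 0) ?vs)"
  let ?g = "\<lambda>i. if i = head Q a then map ?row (mat_to_list (V a)) else replicate (\<alpha> i) (replicate dim 0)"
  let ?R = "Map (snd_of (snd_of (arg 1))) (Concat_Map (arg 5) ?p)"
  have "ev Rows ?s 0 (enc_list (concat (map (\<lambda>i. map enc_vec (?g i)) ?vs)))"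
    unfolding Rows_def
  proof (rule ev_Concat_Map_free[OF ev_args(4)])
    fix i
    let ?v = "\<lambda>i. Node (enc_nat i) (enc_nat (\<alpha> i))"
    let ?s1 = "Node (?v i) ?s"
    have "ev ?R ?s1 0 (enc_list (map (\<lambda>row. enc_vec (?row row)) (mat_to_list (V a))))"
    proof (rule ev_Map_free)
      show "ev (snd_of (snd_of (arg 1))) ?s1 0 (enc_rows (mat_to_list (V a)))"
        unfolding enc_mat_def[symmetric] by (rule ev_basic)+
      fix row
      let ?s2 = "Node (enc_vec row) ?s1"
      have "ev (Concat_Map (arg 5) ?p) ?s2 0
         (enc_list (concat (map (\<lambda>j. map Num (if j = tail Q a then row else replicate (\<alpha> j) 0)) ?vs)))"
      proof (rule ev_Concat_Map_free[OF ev_args(6)])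
        fix j
        have "ev ?p
          (Node (?v j) ?s2) ((0 + 0) + 0) (if j = tail Q a then enc_vec row else enc_vec (replicate (\<alpha> j) 0))"
          by (rule ev_If_bool ev_Eq_nat ev_zeros ev_fst ev_snd ev_args)+
        then show "ev ?p
          (Node (?v j) ?s2) 0 (enc_vec (if j = tail Q a then row else replicate (\<alpha> j) 0))"
          by (simp split: if_splits)
      qed
      then show "ev (Concat_Map (arg 5) ?p) ?s2 0
         (enc_vec (?row row))"
        by (simp add: map_concat comp_def)
    qed
    then have R: "ev ?R ?s1 0 (enc_rows (map ?row (mat_to_list (V a))))"
      by (simp add: comp_def)
    have "ev ?q ?s1 0
        (enc_list (map (\<lambda>_. enc_vec (replicate dim 0)) (replicate (\<alpha> i) Tip)))"
    proof (rule ev_Map_free[where e = "\<lambda>x. x"])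
      show "ev (snd_of (arg 0)) ?s1 0 (enc_list (map (\<lambda>x. x) (replicate (\<alpha> i) Tip)))"
        unfolding list.map_ident enc_nat_def[symmetric] by (rule ev_basic)+
      show "ev (Map (arg 4) Make_Zero) (Node t ?s1) 0 (enc_vec (replicate dim 0))" for t
        by (rule ev_zeros ev_args)+
    qed
    then have Z: "ev ?q ?s1 0
        (enc_rows (replicate (\<alpha> i) (replicate dim 0)))"
      by simp
    have "ev (If_Node (Eq_nat (fst_of (arg 0)) (fst_of (snd_of (arg 1)))) ?R ?q)
      ?s1 ((0 + 0) + 0) (if i = head Q a then enc_rows (map ?row (mat_to_list (V a)))
        else enc_rows (replicate (\<alpha> i) (replicate dim 0)))"
      by (rule ev_If_bool[OF _ R Z]) (rule ev_Eq_nat ev_fst ev_snd ev_args)+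
    then show "ev (If_Node (Eq_nat (fst_of (arg 0)) (fst_of (snd_of (arg 1)))) ?R ?q)
      ?s1 0 (enc_rows (?g i))"
      by (simp split: if_splits)
  qed
  moreover have "concat (map (\<lambda>i. map enc_vec (?g i)) ?vs) = map enc_vec (concat (map ?g ?vs))"
    by (simp only: map_concat map_map comp_def)
  ultimately show ?thesis
    by (simp only: mat_to_list_hat[where V = V, OF a V])
qed

lemma ev_Hats:
  assumes V: "is_representation Q \<alpha> V"
  shows "ev Hats (Node d (Node (enc_nat dim) (Node enc_verts
      (Node (enc_list (map (enc_arc V) (sorted_list_of_set (arcs Q)))) s)))) 0
    (enc_list (map (enc_elem enc_rows) (map (\<lambda>A. (concat A, A)) (hats V))))"
proof -
  let ?s = "Node d (Node (enc_nat dim) (Node enc_verts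
      (Node (enc_list (map (enc_arc V) (sorted_list_of_set (arcs Q)))) s)))"
  have "ev Hats ?s 0 (enc_list (map (\<lambda>a. Node (enc_vec (concat (mat_to_list (hat V a))))
      (enc_rows (mat_to_list (hat V a)))) (sorted_list_of_set (arcs Q))))"
    unfolding Hats_def
  proof (rule ev_Map_free[OF ev_args(4)])
    fix a assume "a \<in> set (sorted_list_of_set (arcs Q))"
    then have a: "a \<in> arcs Q" by simp
    then have Va: "V a \<in> carrier_mat (\<alpha> (head Q a)) (\<alpha> (tail Q a))"
      using V by (simp add: is_representation_def)
    let ?A = "mat_to_list (hat V a)"
    let ?s1 = "Node (enc_rows ?A) (Node (enc_arc V a) ?s)"
    have "ev (Concat_Map (arg 0) (arg 0)) ?s1 0 (enc_list (concat (map (map Num) ?A)))"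
      by (rule ev_Concat_Map_free ev_args)+
    then have "ev (Fork (Concat_Map (arg 0) (arg 0)) (arg 0)) ?s1 (0 + 0) (Node (enc_vec (concat ?A)) (enc_rows ?A))"
      by (intro ev_Fork ev_args) (simp add: map_concat)
    from ev_Let[OF ev_Rows[where V = V, OF a Va] this]
    show "ev (Let_in Rows (Fork (Concat_Map (arg 0) (arg 0)) (arg 0))) (Node (enc_arc V a) ?s) 0
        (Node (enc_vec (concat ?A)) (enc_rows ?A))" by simp
  qed
  then show ?thesis by (simp add: hats_def comp_def)
qed

end

lemma concat_replicate_Tip: "concat (map (\<lambda>i. replicate (f i) x) xs) = replicate (\<Sum>i\<leftarrow>xs. f i) x"
  by (induction xs) (simp_all add: replicate_add)

section \<open>The whole program and its cost\<close>

context matmul_program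
begin

lemma ev_Main_Prog:
  assumes "fin_digraph Q" and V: "is_representation Q \<alpha> V"
  defines "n \<equiv> total_dim Q \<alpha>"
  shows "ev Main_Prog (enc_representation Q \<alpha> V)
    (if n = 0 then 0 else (card (arcs Q) div (n * n)) * (M (n * n) + (n * n) * (n * n)) +
      (n * n + 1) * (n * n * ins_cost (n * n) (n * n)) + stage2_cost (n * n) n)
    (enc_bool (semistable Q \<alpha> V))"
proof -
  let ?p = "Fork (arg 0) (Fork (arg 2) Make_Tip)"
  interpret fin_digraph Q by fact
  interpret quiver_representation Q \<alpha> by unfold_locales
  let ?arcs = "enc_list (map (enc_arc V) (sorted_list_of_set (arcs Q)))"
  let ?s = "Node enc_verts (Node ?arcs Tip)"
  have inp: "enc_representation Q \<alpha> V = Node enc_verts ?arcs"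
    by (simp add: enc_representation_def)
  have ss: "semistable Q \<alpha> V \<longleftrightarrow> iter_images n (hats V) n \<noteq> []"
    using semistable_iff_not_nilpotent[OF V] nilpotent_iff_iter_images[of V] by (simp add: n_def)
  have e0: "ev (Fork Left (Fork Right Make_Tip)) (enc_representation Q \<alpha> V) (0 + (0 + 0)) ?s"
    unfolding inp by (rule ev_Fork ev_Left ev_Right ev_Tip)+
  have e1: "ev (Concat_Map (arg 0) (snd_of (arg 0))) ?s 0 (enc_nat n)"
  proof -
    have "ev (Concat_Map (arg 0) (snd_of (arg 0))) ?s 0
      (enc_list (concat (map (\<lambda>i. replicate (\<alpha> i) Tip) (sorted_list_of_set (verts Q)))))"
      by (rule ev_Concat_Map_free[OF ev_args(1)], unfold enc_nat_def[symmetric]) (rule ev_basic)+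
    then show ?thesis
      by (simp add: concat_replicate_Tip enc_nat_def n_def total_dim_def sum_list_distinct_conv_sum_set)
  qed
  let ?s1 = "Node (enc_nat n) ?s"
  let ?d = "n * n"
  let ?T1 = "(card (arcs Q) div ?d) * (M ?d + ?d * ?d) + (?d + 1) * (?d * ins_cost ?d ?d)"
  let ?T = "if n = 0 then 0 else ?T1 + stage2_cost ?d n"
  let ?F = "If_Node (Seq ?p Stage2) (Fork Make_Tip Make_Tip) Make_Tip"
  let ?I = "If_Node (arg 0) (Let_in (Concat_Map (arg 0) (arg 1)) (Let_in (Stage1 Hats) ?F)) Make_Tip"
  have "ev ?I ?s1 ?T (enc_bool (semistable Q \<alpha> V))"
  proof (cases "n = 0")
    case True
    have "\<not> semistable Q \<alpha> V" using ss True by (simp add: iter_images_def)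
    moreover have "ev (arg 0) ?s1 0 Tip" using ev_args(1) by (simp add: True enc_nat_def)
    then have "ev ?I ?s1 (0 + 0) Tip" by (rule ev_If_false) (rule ev_Tip)
    ultimately show ?thesis using True by simp
  next
    case False
    then obtain n' where n': "n = Suc n'" by (cases n) auto
    let ?s2 = "Node (enc_nat ?d) ?s1"
    have "ev (Concat_Map (arg 0) (arg 1)) ?s1 0 (enc_list (concat (map (\<lambda>_. replicate n Tip) (replicate n Tip))))"
      by (rule ev_Concat_Map_free[where e = "\<lambda>x. x"], unfold list.map_ident enc_nat_def[symmetric]) (rule ev_args)+
    moreover have "concat (map (\<lambda>_. replicate n Tip) (replicate n Tip)) = replicate ?d Tip"
      unfolding concat_replicate_Tip by (simp add: sum_list_replicate)
    ultimately have e2: "ev (Concat_Map (arg 0) (arg 1)) ?s1 0 (enc_nat ?d)"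
      by (simp only: enc_nat_def)
    let ?xs = "map (\<lambda>A. (concat A, A)) (hats V)"
    have h: "ev Hats ?s2 0 (enc_list (map (enc_elem enc_rows) ?xs))"
      using ev_Hats[OF V] by (simp only: n_def)
    have len: "length ?xs = card (arcs Q)" by (simp add: hats_def)
    have "ev (Stage1 Hats) ?s2 ((length ?xs div ?d) * (M ?d + ?d * ?d) + (?d + 1) * (?d * ins_cost ?d ?d))
      (enc_list (map enc_rows (fst (fold ins ?xs ([], idm ?d)))))"
    proof (rule ev_Stage1[OF h])
      show "length (fst x) = ?d" if "x \<in> set ?xs" for x
        using that hats_sq_rows length_concat_sq_rows by (auto simp: n_def)
      show "?d \<ge> 1" using n' by simp
    qed
    then have e3: "ev (Stage1 Hats) ?s2 ?T1 (enc_list (map enc_rows (spanning n (hats V))))"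
      unfolding len spanning_def .
    let ?S = "spanning n (hats V)"
    let ?s3 = "Node (enc_list (map enc_rows ?S)) ?s2"
    have sub: "set ?S \<subseteq> set (hats V)"
      unfolding spanning_def using set_fold_ins by fastforce
    have "ev (Seq ?p Stage2) ?s3 ((0 + (0 + 0)) + stage2_cost ?d n)
      (enc_rows ((next_images n ?S ^^ n) (idm n)))"
    proof (rule ev_Seq)
      show "ev ?p ?s3 (0 + (0 + 0))
        (Node (enc_list (map enc_rows ?S)) (Node (enc_nat n) Tip))"
        by (rule ev_Fork ev_args ev_Tip)+
      show "ev Stage2 (Node (enc_list (map enc_rows ?S)) (Node (enc_nat n) Tip)) (stage2_cost ?d n)
        (enc_rows ((next_images n ?S ^^ n) (idm n)))"
      proof (rule ev_Stage2)
        show "sq_rows n A" if "A \<in> set ?S" for A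
          using that sub hats_sq_rows by (auto simp: n_def)
        show "length ?S \<le> ?d" unfolding spanning_def by (rule length_fold_ins_idm)
      qed
    qed
    then have e4: "ev (Seq ?p Stage2) ?s3 (stage2_cost ?d n)
      (enc_list (map enc_vec (iter_images n (hats V) n)))"
      by (simp add: iter_images_def)
    have "ev ?F ?s3 (stage2_cost ?d n + 0)
      (if map enc_vec (iter_images n (hats V) n) = [] then Tip else Node Tip Tip)"
      by (rule ev_If_list[OF e4]) (rule ev_Fork_free ev_Tip)+
    then have e5: "ev ?F ?s3 (stage2_cost ?d n) (enc_bool (semistable Q \<alpha> V))"
      by (auto simp: ss split: if_splits)
    have a0: "ev (arg 0) ?s1 0 (Node Tip (enc_nat n'))" using ev_args(1) by (simp add: n' enc_nat_def)
    have "ev ?I ?s1 (0 + (0 + (?T1 + stage2_cost ?d n))) (enc_bool (semistable Q \<alpha> V))"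
      by (rule ev_If_true[OF a0] ev_Let[OF e2] ev_Let[OF e3] e5)+
    then show ?thesis using False by simp
  qed
  from ev_Seq[OF e0 ev_Let[OF e1 this]] show ?thesis
    unfolding Main_Prog_def by simp
qed

end

text \<open>At most m / d batches of cost about d^\<omega> amount to m d^(\<omega>-1). The
  eliminations take O(d^4) = O(n^8) operations and the iterated images O(n^6).\<close>

lemma cost_bound:
  fixes \<omega> C :: real and n m :: nat
  assumes \<omega>: "\<omega> \<ge> 2" and n: "n \<ge> 1" and C: "C \<ge> 0" and M: "real Md \<le> C * real (n * n) powr \<omega>"
  shows "real ((m div (n * n)) * (Md + (n * n) * (n * n)) +
      (n * n + 1) * (n * n * ins_cost (n * n) (n * n)) + stage2_cost (n * n) n)
    \<le> (C + 40) * (real n ^ 20 + real n powr (2 * \<omega> - 2) * real m)"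
proof -
  define x where "x = real n"
  define d where "d = real (n * n)"
  have x: "x \<ge> 1" using n by (simp add: x_def)
  have "d = x ^ 2" by (simp add: d_def x_def power2_eq_square)
  moreover have "x ^ 2 \<ge> 1" using x by (rule one_le_power)
  ultimately have d: "d = x ^ 2" "d \<ge> 1" by simp_all
  have dw: "d powr \<omega> = d * x powr (2 * \<omega> - 2)"
  proof -
    have "d powr \<omega> = x powr (2 * \<omega>)"
      using x by (simp add: d(1) powr_powr flip: powr_numeral)
    also have "\<dots> = x powr 2 * x powr (2 * \<omega> - 2)" by (simp add: powr_add[symmetric])
    finally show ?thesis using x by (simp add: d(1))
  qed
  \<comment> \<open>Here \<omega> \<ge> 2 enters: the \<open>d * d\<close> zero tests of a batch
    stay below d^\<omega>.\<close>
  have dx: "d \<le> x powr (2 * \<omega> - 2)"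
  proof -
    have "d = x powr 2" using x by (simp add: d(1))
    also have "\<dots> \<le> x powr (2 * \<omega> - 2)" using \<omega> x by (intro powr_mono) auto
    finally show ?thesis .
  qed
  let ?W = "x powr (2 * \<omega> - 2)"
  have q: "real (m div (n * n)) * d \<le> real m"
    unfolding d_def by (metis of_nat_le_iff of_nat_mult div_times_less_eq_dividend)
  have "real ((m div (n * n)) * (Md + (n * n) * (n * n))) = real (m div (n * n)) * (real Md + d * d)"
    by (simp add: d_def)
  also have "\<dots> \<le> real (m div (n * n)) * (C * (d * ?W) + d * ?W)"
    using M dx d(2) unfolding d_def[symmetric] dw by (intro mult_left_mono add_mono) auto
  also have "\<dots> = (C + 1) * ?W * (real (m div (n * n)) * d)" by (simp add: algebra_simps)
  also have "\<dots> \<le> (C + 1) * ?W * real m" using C q by (intro mult_left_mono) auto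
  finally have 1: "real ((m div (n * n)) * (Md + (n * n) * (n * n))) \<le> (C + 1) * ?W * real m" .
  have "real ((n * n + 1) * (n * n * ins_cost (n * n) (n * n))) = (d + 1) * d\<^sup>2 * (6 * d + 4)"
    by (simp add: d_def ins_cost_def power2_eq_square algebra_simps)
  also have "\<dots> \<le> (2 * d) * d\<^sup>2 * (10 * d)"
    using d(2) by (intro mult_mono) auto
  also have "\<dots> = 20 * x ^ 8" by (simp add: d(1) flip: power_mult power_add)
  finally have 2: "real ((n * n + 1) * (n * n * ins_cost (n * n) (n * n))) \<le> 20 * x ^ 8" .
  have "real (stage2_cost (n * n) n) = 8 * x ^ 6 + 4 * x ^ 5"
    by (simp add: stage2_cost_def ins_cost_def x_def algebra_simps eval_nat_numeral)
  also have "\<dots> \<le> 8 * x ^ 20 + 4 * x ^ 20"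
    using x by (intro add_mono mult_left_mono power_increasing) auto
  finally have 3: "real (stage2_cost (n * n) n) \<le> 12 * x ^ 20" by simp
  have "x ^ 8 \<le> x ^ 20" using x by (intro power_increasing) auto
  with 1 2 3 have "real ((m div (n * n)) * (Md + (n * n) * (n * n)) +
      (n * n + 1) * (n * n * ins_cost (n * n) (n * n)) + stage2_cost (n * n) n)
    \<le> (C + 1) * (?W * real m) + 32 * x ^ 20" by simp
  \<comment> \<open>The 32 collects 20 from the eliminations and 12 from the iterated
    images.\<close>
  also have "\<dots> \<le> (C + 40) * (?W * real m) + (C + 40) * x ^ 20"
    using C x by (intro add_mono mult_right_mono) auto
  finally show ?thesis by (simp add: x_def algebra_simps)
qed

theorem theorem6p5:
  fixes \<omega> :: real
  assumes "matmul_exponent \<omega>"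
  shows "\<exists>(P :: prog) (C :: real). \<forall>(Q :: quiver) (\<alpha> :: nat \<Rightarrow> nat) (V :: nat \<Rightarrow> complex mat).
    fin_digraph Q \<longrightarrow> is_representation Q \<alpha> V \<longrightarrow>
    (\<exists>t. run P (enc_representation Q \<alpha> V) t (enc_bool (semistable Q \<alpha> V)) \<and>
         real t \<le> C * (real (total_dim Q \<alpha>) ^ 20 +
                       real (total_dim Q \<alpha>) powr (2 * \<omega> - 2) * real (card (arcs Q))))"
proof -
  have \<omega>: "\<omega> \<ge> 2" using assms by (rule matmul_exponent_ge_2)
  obtain P\<^sub>0 C\<^sub>0 where P\<^sub>0: "\<And>n A B. n \<ge> 1 \<Longrightarrow> A \<in> carrier_mat n n \<Longrightarrow> B \<in> carrier_mat n n \<Longrightarrow>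
        \<exists>t. run P\<^sub>0 (Node (enc_nat n) (Node (enc_mat A) (enc_mat B))) t (enc_mat (A * B)) \<and>
            real t \<le> C\<^sub>0 * real n powr \<omega>"
    using assms unfolding matmul_exponent_def by metis
  \<comment> \<open>\<open>matmul_exponent\<close> does not state that its constant is nonnegative,
    which rounding and monotonicity require below.\<close>
  define C where "C = max 0 C\<^sub>0"
  \<comment> \<open>Costs are natural numbers, so the real bound may be rounded down.\<close>
  define M where "M n = nat \<lfloor>C * real n powr \<omega>\<rfloor>" for n :: nat
  have C: "C \<ge> 0" by (simp add: C_def)
  have M: "real (M n) \<le> C * real n powr \<omega>" for n
    unfolding M_def using C by (intro of_nat_floor) simp
  interpret matmul_program P\<^sub>0 M
  proof
    fix n :: nat and A B :: "complex mat"
    assume "n \<ge> 1" "A \<in> carrier_mat n n" "B \<in> carrier_mat n n"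
    then obtain t where t: "run P\<^sub>0 (Node (enc_nat n) (Node (enc_mat A) (enc_mat B))) t (enc_mat (A * B))"
      "real t \<le> C\<^sub>0 * real n powr \<omega>" using P\<^sub>0 by blast
    have "C\<^sub>0 * real n powr \<omega> \<le> C * real n powr \<omega>" by (intro mult_right_mono) (auto simp: C_def)
    then have "t \<le> M n" using t(2) unfolding M_def by (intro le_nat_floor) linarith
    then show "ev P\<^sub>0 (Node (enc_nat n) (Node (enc_mat A) (enc_mat B))) (M n) (enc_mat (A * B))"
      using t(1) unfolding ev_def by blast
  qed
  show ?thesis
  proof (rule exI[of _ Main_Prog], rule exI[of _ "C + 40"], intro allI impI)
    fix Q :: quiver and \<alpha> :: "nat \<Rightarrow> nat" and V :: "nat \<Rightarrow> complex mat"
    assume Q: "fin_digraph Q" and V: "is_representation Q \<alpha> V"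
    let ?n = "total_dim Q \<alpha>"
    obtain t where t: "run Main_Prog (enc_representation Q \<alpha> V) t (enc_bool (semistable Q \<alpha> V))"
      and le: "t \<le> (if ?n = 0 then 0 else
        (card (arcs Q) div (?n * ?n)) * (M (?n * ?n) + (?n * ?n) * (?n * ?n)) +
        (?n * ?n + 1) * (?n * ?n * ins_cost (?n * ?n) (?n * ?n)) + stage2_cost (?n * ?n) ?n)"
      using ev_Main_Prog[OF Q V] unfolding ev_def by blast
    have "real t \<le> (C + 40) * (real ?n ^ 20 + real ?n powr (2 * \<omega> - 2) * real (card (arcs Q)))"
    proof (cases "?n = 0")
      case False
      then have "real t \<le> real ((card (arcs Q) div (?n * ?n)) * (M (?n * ?n) + (?n * ?n) * (?n * ?n)) +
        (?n * ?n + 1) * (?n * ?n * ins_cost (?n * ?n) (?n * ?n)) + stage2_cost (?n * ?n) ?n)"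
        using le by (simp only: if_False of_nat_le_iff)
      also have "\<dots> \<le> (C + 40) * (real ?n ^ 20 + real ?n powr (2 * \<omega> - 2) * real (card (arcs Q)))"
        by (rule cost_bound[OF \<omega> _ C M]) (use False in simp)
      finally show ?thesis .
    qed (use le in simp)
    with t show "\<exists>t. run Main_Prog (enc_representation Q \<alpha> V) t (enc_bool (semistable Q \<alpha> V)) \<and>
      real t \<le> (C + 40) * (real ?n ^ 20 + real ?n powr (2 * \<omega> - 2) * real (card (arcs Q)))" by blast
  qed
qed

end
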